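(* (Gödel's Diagonal Lemma) Let $\mathsf{T}$ be a $\Sigma^A$ theory of $\mathcal{L}[A]$ extending $\mathsf{KP}[A]$. For every formula $\varphi(v)\in\mathcal{L}[A]$, perhaps with extra free variables, there exists a formula $\psi$ of $\mathcal{L}[A]$ such that $\mathsf{T}\vdash^A\varphi(\ulcorner\psi\urcorner)\leftrightarrow\psi$. Moreover, if $\varphi$ is $\Sigma[A]$, then so is $\psi$.
   Context: **Metatheory.** $\mathsf{KP}$ is Kripke–Platek set theory (Extensionality, Pair, Union, Foundation for arbitrary formulas, $\Delta_0$-Separation, $\Delta_0$-Collection). We work in $\mathsf{KP}+\mathsf{Tr}(A)+\mathsf{KP}^A$ ("$\mathsf{KP}$ plus $A$ is an admissible class"): the language is that of set theory with an additional unary predicate $x\in A$; the axioms are $\mathsf{KP}$, transitivity of $A$, the relativization $\varphi^A$ (unbounded quantifiers restricted to $A$) of each axiom $\varphi$ of $\mathsf{KP}$, and the foundation scheme for all formulas of the expanded language. ($A$ may be an admissible set, i.e. a transitive set model of $\mathsf{KP}$, or $V$.) A $\Sigma^A$-formula is $\psi^A$ for a $\Sigma$-formula $\psi$, with parameters from $A$ allowed; $\Sigma^A$-classes are defined accordingly. "Smallest" classes and relations below are least fixed points of positive $\Sigma^A$ operators, and are $\Sigma^A$-definable. **Language $\mathcal{L}[A]$.** Variables $v_a$ and constants $\ulcorner a\urcorner$ for all $a\in A$; terms are variables and constants; atomic formulas are $t_0=t_1$ and $t_0\in t_1$. $\mathcal{L}[A]$ is the smallest class containing the atomic formulas and closed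 under $\neg,\to,\forall x,\exists x$ and under $\bigwedge\Phi,\bigvee\Phi$ for sets $\Phi\in A$ of formulas. Formulas are coded as elements of $A$, so each formula $\varphi$ has a name, the constant $\ulcorner\varphi\urcorner$. $\Sigma[A]$ is the smallest class of $\mathcal{L}[A]$-formulas containing all literals (atomic formulas and their negations) and closed under infinitary conjunction and disjunction (over sets in $A$), bounded universal quantification and existential quantification. In $\mathsf{T}$ one may use $\mathsf{T}$-provably total $\Sigma[A]$-definable functions as function symbols inside $\Sigma[A]$-formulas: a formula so written stands for the ($\mathsf{T}$-provably equivalent) $\Sigma[A]$-formula obtained by eliminating these symbols. **Derivability.** A $\Sigma^A$ theory $\mathsf{T}$ is a $\Sigma^A$-class of $\mathcal{L}[A]$-sentences. $\mathsf{T}\vdash^A\varphi$ is the smallest relation such that all the following formulas are derivable: each $\varphi\in\mathsf{T}$; all $\mathcal{L}[A]$-instances of $\theta\to(\psi\to\theta)$, $(\theta\to(\theta\to\psi))\to(\theta\to\psi)$, $(\theta\to\psi)\to((\psi\to\eta)\to(\theta\to\eta))$, $(\theta\to\psi)\to(\neg\psi\to\neg\theta)$, $\theta\to\neg\neg\theta$, $\neg\neg\theta\to\theta$; $\bigwedge\Phi\to\varphi$ and $\varphi\to\bigvee\Phi$ for $\varphi\in\Phi\in A$; $\forall x\varphi(x)\to\varphi(t)$ and $\varphi(t)\to\exists x\varphi(x)$ for terms $t$; the equality axioms $x=x$, $x=y\to y=x$, $x=y\to(y=z\to x=z)$, $x=y\to(\varphi(x)\to\varphi(y))$; and derivability is closed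 under modus ponens; from $\varphi\to\psi$ for all $\psi\in\Psi$ (with $\Psi\in A$) infer $\varphi\to\bigwedge\Psi$; from $\varphi\to\psi$ for all $\varphi\in\Phi$ (with $\Phi\in A$) infer $\bigvee\Phi\to\psi$; from $\varphi\to\psi$ infer $\varphi\to\forall v\psi$ if $v$ is not free in $\varphi$; from $\varphi\to\psi$ infer $\exists v\varphi\to\psi$ if $v$ is not free in $\psi$. **Theories.** $\mathsf{R}[A]$ has the axioms: $\ulcorner a\urcorner\in\ulcorner b\urcorner$ for $a,b\in A$, $a\in b$; $\neg(\ulcorner a\urcorner\in\ulcorner b\urcorner)$ for $a,b\in A$, $a\notin b$; $\forall x(x\in\ulcorner a\urcorner\to\bigvee_{b\in a}x=\ulcorner b\urcorner)$ for $a\in A$. $\mathsf{KP}[A]$ consists of the axioms of $\mathsf{R}[A]$ and of $\mathsf{KP}$. *)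

theory Defs
  imports Main
begin

section \<open>The metatheory: structures for the language of sets with a predicate for A\<close>

text \<open>
  The metatheory is a first-order theory, so a statement proved in it is rendered as a statement
  about all of its models \<open>(V, \<in>, A)\<close>, ill-founded ones included; \<open>V\<close> is the type \<open>'v\<close>.
  First-order formulas of the metatheory are therefore needed as a datatype: for the axiom schemes,
  and because a class of the metatheory is a subset of \<open>V\<close> definable (with parameters) by such a
  formula.
\<close>

datatype meta_fm =
    MMem nat nat
  | MEq nat nat
  | MInA nat
  | MNeg meta_fm
  | MConj meta_fm meta_fm
  | MDisj meta_fm meta_fm
  | MImp meta_fm meta_fm
  | MAll nat meta_fm
  | MEx nat meta_fm

primrec pure :: "meta_fm \<Rightarrow> bool" where
  "pure (MMem i j) = True"
| "pure (MEq i j) = True"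
| "pure (MInA i) = False"
| "pure (MNeg p) = pure p"
| "pure (MConj p q) = (pure p \<and> pure q)"
| "pure (MDisj p q) = (pure p \<and> pure q)"
| "pure (MImp p q) = (pure p \<and> pure q)"
| "pure (MAll i p) = pure p"
| "pure (MEx i p) = pure p"

inductive meta_Delta0 :: "meta_fm \<Rightarrow> bool" where
  "meta_Delta0 (MMem i j)"
| "meta_Delta0 (MEq i j)"
| "meta_Delta0 p \<Longrightarrow> meta_Delta0 (MNeg p)"
| "meta_Delta0 p \<Longrightarrow> meta_Delta0 q \<Longrightarrow> meta_Delta0 (MConj p q)"
| "meta_Delta0 p \<Longrightarrow> meta_Delta0 q \<Longrightarrow> meta_Delta0 (MDisj p q)"
| "meta_Delta0 p \<Longrightarrow> meta_Delta0 q \<Longrightarrow> meta_Delta0 (MImp p q)"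
| "meta_Delta0 p \<Longrightarrow> i \<noteq> j \<Longrightarrow> meta_Delta0 (MAll i (MImp (MMem i j) p))"
| "meta_Delta0 p \<Longrightarrow> i \<noteq> j \<Longrightarrow> meta_Delta0 (MEx i (MConj (MMem i j) p))"

inductive meta_Sigma :: "meta_fm \<Rightarrow> bool" where
  "meta_Delta0 p \<Longrightarrow> meta_Sigma p"
| "meta_Sigma p \<Longrightarrow> meta_Sigma q \<Longrightarrow> meta_Sigma (MConj p q)"
| "meta_Sigma p \<Longrightarrow> meta_Sigma q \<Longrightarrow> meta_Sigma (MDisj p q)"
| "meta_Sigma p \<Longrightarrow> i \<noteq> j \<Longrightarrow> meta_Sigma (MAll i (MImp (MMem i j) p))"
| "meta_Sigma p \<Longrightarrow> meta_Sigma (MEx i p)"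

locale set_structure =
  fixes mem :: "'v \<Rightarrow> 'v \<Rightarrow> bool"  (infix "\<^bold>\<in>" 50)
    and A :: "'v set"
begin

text \<open>
  Truth with all unbounded quantifiers restricted to \<open>D\<close>: \<open>D = UNIV\<close> gives truth in \<open>V\<close>,
  \<open>D = A\<close> gives truth of the relativized formula.
\<close>

primrec sat :: "'v set \<Rightarrow> (nat \<Rightarrow> 'v) \<Rightarrow> meta_fm \<Rightarrow> bool" where
  "sat D e (MMem i j) = (e i \<^bold>\<in> e j)"
| "sat D e (MEq i j) = (e i = e j)"
| "sat D e (MInA i) = (e i \<in> A)"
| "sat D e (MNeg p) = (\<not> sat D e p)"
| "sat D e (MConj p q) = (sat D e p \<and> sat D e q)"
| "sat D e (MDisj p q) = (sat D e p \<or> sat D e q)"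
| "sat D e (MImp p q) = (sat D e p \<longrightarrow> sat D e q)"
| "sat D e (MAll i p) = (\<forall>a\<in>D. sat D (e(i := a)) p)"
| "sat D e (MEx i p) = (\<exists>a\<in>D. sat D (e(i := a)) p)"
  for D

text \<open>The axioms of KP relativized to \<open>D\<close>; parameters are the values of the environment \<open>e\<close>.\<close>

definition KP_in :: "'v set \<Rightarrow> bool" where
  "KP_in D \<longleftrightarrow>
    \<comment> \<open>Extensionality\<close>
    (\<forall>x\<in>D. \<forall>y\<in>D. (\<forall>z\<in>D. z \<^bold>\<in> x \<longleftrightarrow> z \<^bold>\<in> y) \<longrightarrow> x = y) \<and>
    \<comment> \<open>Pair\<close>
    (\<forall>x\<in>D. \<forall>y\<in>D. \<exists>z\<in>D. x \<^bold>\<in> z \<and> y \<^bold>\<in> z) \<and>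
    \<comment> \<open>Union\<close>
    (\<forall>x\<in>D. \<exists>z\<in>D. \<forall>y\<in>D. y \<^bold>\<in> x \<longrightarrow> (\<forall>w\<in>D. w \<^bold>\<in> y \<longrightarrow> w \<^bold>\<in> z)) \<and>
    \<comment> \<open>Foundation\<close>
    (\<forall>p e. pure p \<longrightarrow> range e \<subseteq> D \<longrightarrow>
       (\<exists>x\<in>D. sat D (e(0 := x)) p) \<longrightarrow>
       (\<exists>x\<in>D. sat D (e(0 := x)) p \<and> (\<forall>y\<in>D. y \<^bold>\<in> x \<longrightarrow> \<not> sat D (e(0 := y)) p))) \<and>
    \<comment> \<open>\<open>\<Delta>\<^sub>0\<close>-Separation\<close>
    (\<forall>p e. meta_Delta0 p \<longrightarrow> range e \<subseteq> D \<longrightarrow>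
       (\<forall>a\<in>D. \<exists>b\<in>D. \<forall>x\<in>D. x \<^bold>\<in> b \<longleftrightarrow> x \<^bold>\<in> a \<and> sat D (e(0 := x)) p)) \<and>
    \<comment> \<open>\<open>\<Delta>\<^sub>0\<close>-Collection\<close>
    (\<forall>p e. meta_Delta0 p \<longrightarrow> range e \<subseteq> D \<longrightarrow>
       (\<forall>a\<in>D. (\<forall>x\<in>D. x \<^bold>\<in> a \<longrightarrow> (\<exists>y\<in>D. sat D (e(0 := x, 1 := y)) p)) \<longrightarrow>
         (\<exists>b\<in>D. \<forall>x\<in>D. x \<^bold>\<in> a \<longrightarrow> (\<exists>y\<in>D. y \<^bold>\<in> b \<and> sat D (e(0 := x, 1 := y)) p))))"

definition definable_class :: "'v set \<Rightarrow> bool" where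
  "definable_class C \<longleftrightarrow> (\<exists>p e. C = {x. sat UNIV (e(0 := x)) p})"

definition definable_rel :: "('v \<times> 'v) set \<Rightarrow> bool" where
  "definable_rel R \<longleftrightarrow> (\<exists>p e. R = {(x, y). sat UNIV (e(0 := x, 1 := y)) p})"

definition Sigma_A_class :: "'v set \<Rightarrow> bool" where
  "Sigma_A_class C \<longleftrightarrow>
     (\<exists>p e. meta_Sigma p \<and> range e \<subseteq> A \<and> C = {x \<in> A. sat A (e(0 := x)) p})"

text \<open>
  The smallest class (relation) with a closure property, where classes are the definable ones. An
  intersection over arbitrary subsets of \<open>V\<close> would give the wrong notion in ill-founded models.
\<close>

definition least_class :: "('v set \<Rightarrow> bool) \<Rightarrow> 'v set" where
  "least_class cl = \<Inter>{C. definable_class C \<and> cl C}"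

definition least_rel :: "(('v \<times> 'v) set \<Rightarrow> bool) \<Rightarrow> ('v \<times> 'v) set" where
  "least_rel cl = \<Inter>{R. definable_rel R \<and> cl R}"


section \<open>Codes of terms and formulas\<close>

definition vempty :: 'v where
  "vempty = (THE z. \<forall>w. \<not> w \<^bold>\<in> z)"

definition vupair :: "'v \<Rightarrow> 'v \<Rightarrow> 'v" where
  "vupair x y = (THE z. \<forall>w. w \<^bold>\<in> z \<longleftrightarrow> w = x \<or> w = y)"

definition vpair :: "'v \<Rightarrow> 'v \<Rightarrow> 'v" where
  "vpair x y = vupair (vupair x x) (vupair x y)"

text \<open>Pairwise distinct markers (Zermelo numerals) for the syntactic constructors.\<close>

primrec tag :: "nat \<Rightarrow> 'v" where
  "tag 0 = vempty"
| "tag (Suc n) = vupair (tag n) (tag n)"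

definition Var :: "'v \<Rightarrow> 'v" where "Var a = vpair (tag 0) a"
definition Const :: "'v \<Rightarrow> 'v" where "Const a = vpair (tag 1) a"

definition EQ :: "'v \<Rightarrow> 'v \<Rightarrow> 'v" where "EQ s t = vpair (tag 2) (vpair s t)"
definition IN :: "'v \<Rightarrow> 'v \<Rightarrow> 'v" where "IN s t = vpair (tag 3) (vpair s t)"
definition NOT :: "'v \<Rightarrow> 'v" where "NOT \<phi> = vpair (tag 4) \<phi>"
definition IMP :: "'v \<Rightarrow> 'v \<Rightarrow> 'v" where "IMP \<phi> \<psi> = vpair (tag 5) (vpair \<phi> \<psi>)"

text \<open>\<open>ALL' a \<phi>\<close> and \<open>EX' a \<phi>\<close> quantify over the variable with index \<open>a\<close>, that is, \<open>Var a\<close>.\<close>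

definition ALL' :: "'v \<Rightarrow> 'v \<Rightarrow> 'v" where "ALL' a \<phi> = vpair (tag 6) (vpair a \<phi>)"
definition EX' :: "'v \<Rightarrow> 'v \<Rightarrow> 'v" where "EX' a \<phi> = vpair (tag 7) (vpair a \<phi>)"

text \<open>The argument of \<open>AND\<close> and \<open>OR\<close> is the (code of the) set of conjuncts or disjuncts.\<close>

definition AND :: "'v \<Rightarrow> 'v" where "AND \<Phi> = vpair (tag 8) \<Phi>"
definition OR :: "'v \<Rightarrow> 'v" where "OR \<Phi> = vpair (tag 9) \<Phi>"

definition AND2 :: "'v \<Rightarrow> 'v \<Rightarrow> 'v" where "AND2 \<phi> \<psi> = AND (vupair \<phi> \<psi>)"
definition OR2 :: "'v \<Rightarrow> 'v \<Rightarrow> 'v" where "OR2 \<phi> \<psi> = OR (vupair \<phi> \<psi>)"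
definition IFF :: "'v \<Rightarrow> 'v \<Rightarrow> 'v" where "IFF \<phi> \<psi> = AND2 (IMP \<phi> \<psi>) (IMP \<psi> \<phi>)"

definition BALL :: "'v \<Rightarrow> 'v \<Rightarrow> 'v \<Rightarrow> 'v" where
  "BALL a t \<phi> = ALL' a (IMP (IN (Var a) t) \<phi>)"
definition BEX :: "'v \<Rightarrow> 'v \<Rightarrow> 'v \<Rightarrow> 'v" where
  "BEX a t \<phi> = EX' a (AND2 (IN (Var a) t) \<phi>)"


section \<open>The language L[A]\<close>

definition Terms :: "'v set" where
  "Terms = Var ` A \<union> Const ` A"

definition Atomic :: "'v set" where
  "Atomic = {EQ s t | s t. s \<in> Terms \<and> t \<in> Terms} \<union> {IN s t | s t. s \<in> Terms \<and> t \<in> Terms}"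

definition Formulas :: "'v set" where
  "Formulas = least_class (\<lambda>C.
     Atomic \<subseteq> C \<and>
     (\<forall>\<phi>\<in>C. NOT \<phi> \<in> C) \<and>
     (\<forall>\<phi>\<in>C. \<forall>\<psi>\<in>C. IMP \<phi> \<psi> \<in> C) \<and>
     (\<forall>a\<in>A. \<forall>\<phi>\<in>C. ALL' a \<phi> \<in> C \<and> EX' a \<phi> \<in> C) \<and>
     (\<forall>\<Phi>\<in>A. (\<forall>\<phi>. \<phi> \<^bold>\<in> \<Phi> \<longrightarrow> \<phi> \<in> C) \<longrightarrow> AND \<Phi> \<in> C \<and> OR \<Phi> \<in> C))"

definition Sigma_formulas :: "'v set" where
  "Sigma_formulas = least_class (\<lambda>C.
     Atomic \<subseteq> C \<and>
     NOT ` Atomic \<subseteq> C \<and>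
     (\<forall>\<Phi>\<in>A. (\<forall>\<phi>. \<phi> \<^bold>\<in> \<Phi> \<longrightarrow> \<phi> \<in> C) \<longrightarrow> AND \<Phi> \<in> C \<and> OR \<Phi> \<in> C) \<and>
     (\<forall>a\<in>A. \<forall>t\<in>Terms. \<forall>\<phi>\<in>C. t \<noteq> Var a \<longrightarrow> BALL a t \<phi> \<in> C) \<and>
     (\<forall>a\<in>A. \<forall>\<phi>\<in>C. EX' a \<phi> \<in> C))"

text \<open>\<open>Has_free a\<close> is the class of formulas in which the variable \<open>Var a\<close> occurs free.\<close>

definition Has_free :: "'v \<Rightarrow> 'v set" where
  "Has_free a = least_class (\<lambda>C.
     (\<forall>s\<in>Terms. \<forall>t\<in>Terms. s = Var a \<or> t = Var a \<longrightarrow> EQ s t \<in> C \<and> IN s t \<in> C) \<and>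
     (\<forall>\<phi>\<in>C. NOT \<phi> \<in> C) \<and>
     (\<forall>\<phi>\<in>Formulas. \<forall>\<psi>\<in>Formulas. \<phi> \<in> C \<or> \<psi> \<in> C \<longrightarrow> IMP \<phi> \<psi> \<in> C) \<and>
     (\<forall>b\<in>A. \<forall>\<phi>\<in>C. b \<noteq> a \<longrightarrow> ALL' b \<phi> \<in> C \<and> EX' b \<phi> \<in> C) \<and>
     (\<forall>\<Phi>\<in>A. (\<forall>\<phi>. \<phi> \<^bold>\<in> \<Phi> \<longrightarrow> \<phi> \<in> Formulas) \<and> (\<exists>\<phi>\<in>C. \<phi> \<^bold>\<in> \<Phi>) \<longrightarrow> AND \<Phi> \<in> C \<and> OR \<Phi> \<in> C))"

definition Sentences :: "'v set" where
  "Sentences = {\<phi> \<in> Formulas. \<forall>a\<in>A. \<phi> \<notin> Has_free a}"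

text \<open>
  \<open>(\<phi>, \<phi>') \<in> Subst a t\<close>: the term \<open>t\<close> is free for \<open>Var a\<close> in \<open>\<phi>\<close>, and \<open>\<phi>'\<close> is the result of
  replacing all free occurrences of \<open>Var a\<close> in \<open>\<phi>\<close> by \<open>t\<close>. The proviso in the two quantifier
  clauses excludes variable capture; it is void when \<open>t\<close> is a constant.
\<close>

definition Subst :: "'v \<Rightarrow> 'v \<Rightarrow> ('v \<times> 'v) set" where
  "Subst a t = least_rel (\<lambda>R.
     (let sub = (\<lambda>s. if s = Var a then t else s) in
       (\<forall>s\<in>Terms. \<forall>s'\<in>Terms.
          (EQ s s', EQ (sub s) (sub s')) \<in> R \<and> (IN s s', IN (sub s) (sub s')) \<in> R)) \<and>
     (\<forall>(\<phi>, \<phi>')\<in>R. (NOT \<phi>, NOT \<phi>') \<in> R) \<and>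
     (\<forall>(\<phi>, \<phi>')\<in>R. \<forall>(\<psi>, \<psi>')\<in>R. (IMP \<phi> \<psi>, IMP \<phi>' \<psi>') \<in> R) \<and>
     (\<forall>\<phi>\<in>Formulas. (ALL' a \<phi>, ALL' a \<phi>) \<in> R \<and> (EX' a \<phi>, EX' a \<phi>) \<in> R) \<and>
     (\<forall>b\<in>A. \<forall>(\<phi>, \<phi>')\<in>R. b \<noteq> a \<and> (t \<noteq> Var b \<or> \<phi> \<notin> Has_free a) \<longrightarrow>
        (ALL' b \<phi>, ALL' b \<phi>') \<in> R \<and> (EX' b \<phi>, EX' b \<phi>') \<in> R) \<and>
     (\<forall>\<Phi>\<in>A. \<forall>\<Phi>'\<in>A.
        (\<forall>\<phi>. \<phi> \<^bold>\<in> \<Phi> \<longrightarrow> (\<exists>\<phi>'. \<phi>' \<^bold>\<in> \<Phi>' \<and> (\<phi>, \<phi>') \<in> R)) \<and>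
        (\<forall>\<phi>'. \<phi>' \<^bold>\<in> \<Phi>' \<longrightarrow> (\<exists>\<phi>. \<phi> \<^bold>\<in> \<Phi> \<and> (\<phi>, \<phi>') \<in> R)) \<longrightarrow>
        (AND \<Phi>, AND \<Phi>') \<in> R \<and> (OR \<Phi>, OR \<Phi>') \<in> R))"


section \<open>Derivability\<close>

definition Logical_axioms :: "'v set" where
  "Logical_axioms =
     {IMP \<theta> (IMP \<psi> \<theta>) | \<theta> \<psi>. \<theta> \<in> Formulas \<and> \<psi> \<in> Formulas} \<union>
     {IMP (IMP \<theta> (IMP \<theta> \<psi>)) (IMP \<theta> \<psi>) | \<theta> \<psi>. \<theta> \<in> Formulas \<and> \<psi> \<in> Formulas} \<union>
     {IMP (IMP \<theta> \<psi>) (IMP (IMP \<psi> \<eta>) (IMP \<theta> \<eta>)) | \<theta> \<psi> \<eta>.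
        \<theta> \<in> Formulas \<and> \<psi> \<in> Formulas \<and> \<eta> \<in> Formulas} \<union>
     {IMP (IMP \<theta> \<psi>) (IMP (NOT \<psi>) (NOT \<theta>)) | \<theta> \<psi>. \<theta> \<in> Formulas \<and> \<psi> \<in> Formulas} \<union>
     {IMP \<theta> (NOT (NOT \<theta>)) | \<theta>. \<theta> \<in> Formulas} \<union>
     {IMP (NOT (NOT \<theta>)) \<theta> | \<theta>. \<theta> \<in> Formulas} \<union>
     {IMP (AND \<Phi>) \<phi> | \<Phi> \<phi>. \<Phi> \<in> A \<and> AND \<Phi> \<in> Formulas \<and> \<phi> \<^bold>\<in> \<Phi>} \<union>
     {IMP \<phi> (OR \<Phi>) | \<Phi> \<phi>. \<Phi> \<in> A \<and> OR \<Phi> \<in> Formulas \<and> \<phi> \<^bold>\<in> \<Phi>} \<union>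
     {IMP (ALL' a \<phi>) \<phi>' | a t \<phi> \<phi>'.
        a \<in> A \<and> t \<in> Terms \<and> \<phi> \<in> Formulas \<and> (\<phi>, \<phi>') \<in> Subst a t} \<union>
     {IMP \<phi>' (EX' a \<phi>) | a t \<phi> \<phi>'.
        a \<in> A \<and> t \<in> Terms \<and> \<phi> \<in> Formulas \<and> (\<phi>, \<phi>') \<in> Subst a t}"

text \<open>In the last equality axiom, \<open>\<phi>(x)\<close> and \<open>\<phi>(y)\<close> arise from \<open>\<phi>\<close> by substitution for \<open>Var c\<close>.\<close>

definition Equality_axioms :: "'v set" where
  "Equality_axioms =
     {EQ (Var a) (Var a) | a. a \<in> A} \<union>
     {IMP (EQ (Var a) (Var b)) (EQ (Var b) (Var a)) | a b. a \<in> A \<and> b \<in> A} \<union>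
     {IMP (EQ (Var a) (Var b)) (IMP (EQ (Var b) (Var c)) (EQ (Var a) (Var c))) | a b c.
        a \<in> A \<and> b \<in> A \<and> c \<in> A} \<union>
     {IMP (EQ (Var a) (Var b)) (IMP \<phi>a \<phi>b) | a b c \<phi> \<phi>a \<phi>b.
        a \<in> A \<and> b \<in> A \<and> c \<in> A \<and> \<phi> \<in> Formulas \<and>
        (\<phi>, \<phi>a) \<in> Subst c (Var a) \<and> (\<phi>, \<phi>b) \<in> Subst c (Var b)}"

definition Derivable :: "'v set \<Rightarrow> 'v set" where
  "Derivable T = least_class (\<lambda>C.
     T \<subseteq> C \<and> Logical_axioms \<subseteq> C \<and> Equality_axioms \<subseteq> C \<and>
     (\<forall>\<phi>\<in>Formulas. \<forall>\<psi>\<in>Formulas. \<phi> \<in> C \<and> IMP \<phi> \<psi> \<in> C \<longrightarrow> \<psi> \<in> C) \<and>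
     (\<forall>\<phi>\<in>Formulas. \<forall>\<Psi>\<in>A. AND \<Psi> \<in> Formulas \<and> (\<forall>\<psi>. \<psi> \<^bold>\<in> \<Psi> \<longrightarrow> IMP \<phi> \<psi> \<in> C) \<longrightarrow>
        IMP \<phi> (AND \<Psi>) \<in> C) \<and>
     (\<forall>\<Phi>\<in>A. \<forall>\<psi>\<in>Formulas. OR \<Phi> \<in> Formulas \<and> (\<forall>\<phi>. \<phi> \<^bold>\<in> \<Phi> \<longrightarrow> IMP \<phi> \<psi> \<in> C) \<longrightarrow>
        IMP (OR \<Phi>) \<psi> \<in> C) \<and>
     (\<forall>a\<in>A. \<forall>\<phi>\<in>Formulas. \<forall>\<psi>\<in>Formulas. \<phi> \<notin> Has_free a \<and> IMP \<phi> \<psi> \<in> C \<longrightarrow>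
        IMP \<phi> (ALL' a \<psi>) \<in> C) \<and>
     (\<forall>a\<in>A. \<forall>\<phi>\<in>Formulas. \<forall>\<psi>\<in>Formulas. \<psi> \<notin> Has_free a \<and> IMP \<phi> \<psi> \<in> C \<longrightarrow>
        IMP (EX' a \<phi>) \<psi> \<in> C))"

abbreviation derives :: "'v set \<Rightarrow> 'v \<Rightarrow> bool"  (infix "\<turnstile>" 50) where
  "T \<turnstile> \<phi> \<equiv> \<phi> \<in> Derivable T"

definition Sigma_A_theory :: "'v set \<Rightarrow> bool" where
  "Sigma_A_theory T \<longleftrightarrow> Sigma_A_class T \<and> T \<subseteq> Sentences"


section \<open>The theories R[A] and KP[A]\<close>

definition R_axioms :: "'v set" where
  "R_axioms =
     {IN (Const a) (Const b) | a b. a \<in> A \<and> b \<in> A \<and> a \<^bold>\<in> b} \<union>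
     {NOT (IN (Const a) (Const b)) | a b. a \<in> A \<and> b \<in> A \<and> \<not> a \<^bold>\<in> b} \<union>
     {BALL c (Const a) (OR \<Phi>) | c a \<Phi>. c \<in> A \<and> a \<in> A \<and> \<Phi> \<in> A \<and>
        (\<forall>\<phi>. \<phi> \<^bold>\<in> \<Phi> \<longleftrightarrow> (\<exists>b. b \<^bold>\<in> a \<and> \<phi> = EQ (Var c) (Const b)))}"

text \<open>
  The (finitary, constant-free) formulas of the language of set theory, as a subclass of L[A].
  Finiteness is that of the metatheory, being built into the smallest class.
\<close>

definition Set_atomic :: "'v set" where
  "Set_atomic = {EQ (Var a) (Var b) | a b. a \<in> A \<and> b \<in> A} \<union> {IN (Var a) (Var b) | a b. a \<in> A \<and> b \<in> A}"

definition Set_formulas :: "'v set" where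
  "Set_formulas = least_class (\<lambda>C.
     Set_atomic \<subseteq> C \<and>
     (\<forall>\<phi>\<in>C. NOT \<phi> \<in> C) \<and>
     (\<forall>\<phi>\<in>C. \<forall>\<psi>\<in>C. IMP \<phi> \<psi> \<in> C \<and> AND2 \<phi> \<psi> \<in> C \<and> OR2 \<phi> \<psi> \<in> C) \<and>
     (\<forall>a\<in>A. \<forall>\<phi>\<in>C. ALL' a \<phi> \<in> C \<and> EX' a \<phi> \<in> C))"

definition Set_Delta0 :: "'v set" where
  "Set_Delta0 = least_class (\<lambda>C.
     Set_atomic \<subseteq> C \<and>
     (\<forall>\<phi>\<in>C. NOT \<phi> \<in> C) \<and>
     (\<forall>\<phi>\<in>C. \<forall>\<psi>\<in>C. IMP \<phi> \<psi> \<in> C \<and> AND2 \<phi> \<psi> \<in> C \<and> OR2 \<phi> \<psi> \<in> C) \<and>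
     (\<forall>a\<in>A. \<forall>b\<in>A. \<forall>\<phi>\<in>C. a \<noteq> b \<longrightarrow> BALL a (Var b) \<phi> \<in> C \<and> BEX a (Var b) \<phi> \<in> C))"

definition KP_instances :: "'v set" where
  "KP_instances =
     \<comment> \<open>Extensionality\<close>
     {ALL' x (ALL' y (IMP (ALL' z (IFF (IN (Var z) (Var x)) (IN (Var z) (Var y)))) (EQ (Var x) (Var y))))
        | x y z. {x, y, z} \<subseteq> A \<and> distinct [x, y, z]} \<union>
     \<comment> \<open>Pair\<close>
     {ALL' x (ALL' y (EX' z (AND2 (IN (Var x) (Var z)) (IN (Var y) (Var z)))))
        | x y z. {x, y, z} \<subseteq> A \<and> distinct [x, y, z]} \<union>
     \<comment> \<open>Union\<close>
     {ALL' x (EX' z (BALL y (Var x) (BALL w (Var y) (IN (Var w) (Var z)))))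
        | x y z w. {x, y, z, w} \<subseteq> A \<and> distinct [x, y, z, w]} \<union>
     \<comment> \<open>Foundation\<close>
     {IMP (EX' x \<phi>) (EX' x (AND2 \<phi> (BALL y (Var x) (NOT \<phi>'))))
        | x y \<phi> \<phi>'. {x, y} \<subseteq> A \<and> distinct [x, y] \<and> \<phi> \<in> Set_formulas \<and>
          \<phi> \<notin> Has_free y \<and> (\<phi>, \<phi>') \<in> Subst x (Var y)} \<union>
     \<comment> \<open>\<open>\<Delta>\<^sub>0\<close>-Separation\<close>
     {ALL' a (EX' b (ALL' x (IFF (IN (Var x) (Var b)) (AND2 (IN (Var x) (Var a)) \<phi>))))
        | a b x \<phi>. {a, b, x} \<subseteq> A \<and> distinct [a, b, x] \<and> \<phi> \<in> Set_Delta0 \<and> \<phi> \<notin> Has_free b} \<union>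
     \<comment> \<open>\<open>\<Delta>\<^sub>0\<close>-Collection\<close>
     {ALL' a (IMP (BALL x (Var a) (EX' y \<phi>)) (EX' b (BALL x (Var a) (BEX y (Var b) \<phi>))))
        | a b x y \<phi>. {a, b, x, y} \<subseteq> A \<and> distinct [a, b, x, y] \<and>
          \<phi> \<in> Set_Delta0 \<and> \<phi> \<notin> Has_free b}"

text \<open>Theories consist of sentences, so parameters are bound by a block of universal quantifiers.\<close>

definition KP_axioms :: "'v set" where
  "KP_axioms =
     least_class (\<lambda>C. KP_instances \<subseteq> C \<and> (\<forall>a\<in>A. \<forall>\<phi>\<in>C. ALL' a \<phi> \<in> C)) \<inter> Sentences"

definition KP_A :: "'v set" where
  "KP_A = R_axioms \<union> KP_axioms"

definition extends :: "'v set \<Rightarrow> 'v set \<Rightarrow> bool" where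
  "extends T S \<longleftrightarrow> (\<forall>\<phi>\<in>S. T \<turnstile> \<phi>)"

end

text \<open>The models of KP + Tr(A) + \<open>KP\<^sup>A\<close>, with foundation for the expanded language.\<close>

locale admissible_class = set_structure mem A
  for mem :: "'v \<Rightarrow> 'v \<Rightarrow> bool"  (infix "\<^bold>\<in>" 50) and A :: "'v set" +
  assumes KP_V: "KP_in UNIV"
    and A_transitive: "\<And>x y. y \<in> A \<Longrightarrow> x \<^bold>\<in> y \<Longrightarrow> x \<in> A"
    and KP_relativized: "KP_in A"
    and foundation: "\<And>p e. \<exists>x. sat UNIV (e(0 := x)) p \<Longrightarrow>
          \<exists>x. sat UNIV (e(0 := x)) p \<and> (\<forall>y. y \<^bold>\<in> x \<longrightarrow> \<not> sat UNIV (e(0 := y)) p)"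

end

theory Submission
  imports Defs
begin

text \<open>
  Instead of representing the substitution function inside \<open>T\<close>, take
  \<open>\<psi> = \<exists>x (x = \<ulcorner>\<delta>\<urcorner> \<and> \<delta>(x))\<close>. As a set, \<open>\<psi>\<close> arises from \<open>\<delta>\<close> by a fixed finite sequence of pairings with
  \<open>\<delta>\<close> and given elements of \<open>A\<close>. Each step \<open>z = {p, z'}\<close> is expressed by a bounded formula, and by Extensionality and
  the axioms of R[A] the theory \<open>T\<close> proves that \<open>z' = \<ulcorner>c\<urcorner>\<close> determines \<open>z = \<ulcorner>{p, c}\<urcorner>\<close>. Hence \<open>\<delta>(x)\<close>, which says
  that \<open>\<phi>\<close> holds of the result of applying this sequence of pairings to \<open>x\<close>, satisfies
  \<open>\<delta>(\<ulcorner>\<delta>\<urcorner>) \<leftrightarrow> \<phi>(\<ulcorner>\<psi>\<urcorner>)\<close> provably in \<open>T\<close>.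

  The structure \<open>(V, \<in>, A)\<close> may be ill-founded, so every induction has to be one over a definable class.
  A set \<open>w \<in> A\<close> of pairs each of which is obtained from pairs in \<open>w\<close> by a clause of the
  definition of substitution certifies all of its elements, by foundation, and \<open>\<Sigma>\<close>-Collection
  glues such sets together.

  Propositional reasoning in \<open>T\<close> is reduced to sets of formulas that are maximal consistent for the finitary
  connectives; these exist by Zorn's lemma in the ambient logic and need not be definable.
\<close>

section \<open>Definability\<close>

text \<open>The diagonal formula avoids recursion inside \<open>T\<close>: inserting a name of
  \<delta> at the free occurrences of \<open>x\<close> would rewrite \<delta> at every depth,
  whereas the quantified form leaves \<delta> intact, so the new code is a pairing term of fixed
  length. The code of \<delta> enters \<psi> twice, as a conjunct and inside its own name; the
  variable \<open>x\<close> stands for it at both places, so \<delta> never has to mention its own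
  code. A second obstacle is that \<open>Formulas\<close>, \<open>Has_free\<close>,
  \<open>Subst\<close> and \<open>Derivable\<close> are intersections of definable classes and are
  never shown to be definable themselves, so no induction predicate may refer to them. Membership is
  therefore proved for each definable closed class separately, nonmembership by exhibiting one such
  class, and sets of subformulas in \<open>A\<close> replace \<open>Formulas\<close> where a bounded
  condition is wanted. Definability is established for predicates on environments, composed
  connective by connective, instead of for explicit formulas.\<close>

lemmas conjunct22 = conjunct2[THEN conjunct2]

context admissible_class
begin

primrec val :: "(nat \<Rightarrow> 'v) \<Rightarrow> nat + 'v \<Rightarrow> 'v" where
  "val e (Inl n) = e n"
| "val e (Inr c) = c"

text \<open>
  The flag \<open>d\<close> selects \<open>\<Delta>\<^sub>0\<close> formulas over \<open>A\<close> (\<open>True\<close>) or arbitrary formulas over \<open>V\<close> (\<open>False\<close>). In the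
  index set \<open>J\<close>, \<open>Inl n\<close> stands for the variable \<open>n\<close> and \<open>Inr c\<close> for the parameter \<open>c\<close>. The defining formula
  has to exist for every placement \<open>\<rho>\<close> of these in the environment, so that variables can be shifted
  under a quantifier as with de Bruijn indices although the formulas have named variables.
\<close>

definition univ :: "bool \<Rightarrow> 'v set" where
  "univ d = (if d then A else UNIV)"

definition allowed :: "bool \<Rightarrow> meta_fm \<Rightarrow> bool" where
  "allowed d p \<longleftrightarrow> (d \<longrightarrow> meta_Delta0 p)"

definition realizes ::
    "bool \<Rightarrow> (nat + 'v) set \<Rightarrow> ((nat \<Rightarrow> 'v) \<Rightarrow> bool) \<Rightarrow> (nat + 'v \<Rightarrow> nat) \<Rightarrow> meta_fm \<Rightarrow> bool" where
  "realizes d J P \<rho> p \<longleftrightarrow> allowed d p \<and> (\<forall>E. range E \<subseteq> univ d \<longrightarrow>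
     (\<forall>c. Inr c \<in> J \<longrightarrow> E (\<rho> (Inr c)) = c) \<longrightarrow> sat (univ d) E p = P (\<lambda>n. E (\<rho> (Inl n))))"

definition expressible_on :: "bool \<Rightarrow> ((nat \<Rightarrow> 'v) \<Rightarrow> bool) \<Rightarrow> (nat + 'v) set \<Rightarrow> bool" where
  "expressible_on d P J \<longleftrightarrow> finite J \<and> (\<forall>c. Inr c \<in> J \<longrightarrow> c \<in> univ d) \<and>
     (\<forall>e e'. (\<forall>n. Inl n \<in> J \<longrightarrow> e n = e' n) \<longrightarrow> P e = P e') \<and> (\<forall>\<rho>. \<exists>p. realizes d J P \<rho> p)"

definition expressible :: "bool \<Rightarrow> ((nat \<Rightarrow> 'v) \<Rightarrow> bool) \<Rightarrow> bool" where
  "expressible d P \<longleftrightarrow> (\<exists>J. expressible_on d P J)"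

definition proj :: "bool \<Rightarrow> ((nat \<Rightarrow> 'v) \<Rightarrow> 'v) \<Rightarrow> bool" where
  "proj d f \<longleftrightarrow> (\<exists>\<tau>. (\<forall>c. \<tau> = Inr c \<longrightarrow> c \<in> univ d) \<and> f = (\<lambda>e. val e \<tau>))"

lemma proj_var: "proj d (\<lambda>e. e n)"
  unfolding proj_def by (rule exI[of _ "Inl n"]) simp

lemma proj_const: "c \<in> univ d \<Longrightarrow> proj d (\<lambda>e. c)"
  unfolding proj_def by (rule exI[of _ "Inr c"]) simp

lemma expressibleI:
  assumes "finite J" "\<And>c. Inr c \<in> J \<Longrightarrow> c \<in> univ d"
    and "\<And>e e'. (\<And>n. Inl n \<in> J \<Longrightarrow> e n = e' n) \<Longrightarrow> P e = P e'"
    and "\<And>\<rho>. \<exists>p. realizes d J P \<rho> p"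
  shows "expressible d P"
  unfolding expressible_def expressible_on_def
  by (intro exI[of _ J] conjI allI impI assms) auto

lemma expressible_onD:
  assumes "expressible_on d P J"
  shows "finite J" "\<And>c. Inr c \<in> J \<Longrightarrow> c \<in> univ d"
    "\<And>e e'. (\<And>n. Inl n \<in> J \<Longrightarrow> e n = e' n) \<Longrightarrow> P e = P e'"
    "\<And>\<rho>. \<exists>p. realizes d J P \<rho> p"
  using assms unfolding expressible_on_def by simp_all

lemma realizesD:
  assumes "realizes d J P \<rho> p"
  shows "allowed d p"
    "range E \<subseteq> univ d \<Longrightarrow> (\<And>c. Inr c \<in> J \<Longrightarrow> E (\<rho> (Inr c)) = c) \<Longrightarrow> sat (univ d) E p = P (\<lambda>n. E (\<rho> (Inl n)))"
  using assms unfolding realizes_def by auto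

lemma val_rho:
  "(\<And>c. \<tau> = Inr c \<Longrightarrow> E (\<rho> (Inr c)) = c) \<Longrightarrow> val (\<lambda>n. E (\<rho> (Inl n))) \<tau> = E (\<rho> \<tau>)"
  by (cases \<tau>) auto

lemma val_cong: "(\<And>n. \<tau> = Inl n \<Longrightarrow> e n = e' n) \<Longrightarrow> val e \<tau> = val e' \<tau>"
  by (cases \<tau>) auto

lemma expr_atomic:
  assumes f: "proj d f" and g: "proj d g"
    and q: "\<And>i j. meta_Delta0 (q i j)" "\<And>D E i j. sat D E (q i j) = Q (E i) (E j)"
  shows "expressible d (\<lambda>e. Q (f e) (g e))"
proof -
  obtain \<sigma> \<tau> where s: "\<And>c. \<sigma> = Inr c \<Longrightarrow> c \<in> univ d" "f = (\<lambda>e. val e \<sigma>)"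
    and t: "\<And>c. \<tau> = Inr c \<Longrightarrow> c \<in> univ d" "g = (\<lambda>e. val e \<tau>)"
    using f g unfolding proj_def by blast
  show ?thesis
    unfolding s(2) t(2)
  proof (rule expressibleI[of "{\<sigma>, \<tau>}"], simp, use s t in blast)
    fix e e' :: "nat \<Rightarrow> 'v" assume e: "\<And>n. Inl n \<in> {\<sigma>, \<tau>} \<Longrightarrow> e n = e' n"
    have "val e \<sigma> = val e' \<sigma>" "val e \<tau> = val e' \<tau>"
      by (rule val_cong, use e in blast)+
    then show "Q (val e \<sigma>) (val e \<tau>) = Q (val e' \<sigma>) (val e' \<tau>)" by simp
  next
    fix \<rho> :: "nat + 'v \<Rightarrow> nat"
    have "val (\<lambda>n. E (\<rho> (Inl n))) \<sigma> = E (\<rho> \<sigma>)" "val (\<lambda>n. E (\<rho> (Inl n))) \<tau> = E (\<rho> \<tau>)"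
      if "\<forall>c. Inr c \<in> {\<sigma>, \<tau>} \<longrightarrow> E (\<rho> (Inr c)) = c" for E :: "nat \<Rightarrow> 'v"
      by (rule val_rho, use that in blast)+
    then show "\<exists>p. realizes d {\<sigma>, \<tau>} (\<lambda>e. Q (val e \<sigma>) (val e \<tau>)) \<rho> p"
      using q by (intro exI[of _ "q (\<rho> \<sigma>) (\<rho> \<tau>)"]) (auto simp: realizes_def allowed_def)
  qed
qed

lemma expr_mem: "proj d f \<Longrightarrow> proj d g \<Longrightarrow> expressible d (\<lambda>e. f e \<^bold>\<in> g e)"
  by (rule expr_atomic[where q = MMem]) (simp_all add: meta_Delta0.intros)

lemma expr_eq: "proj d f \<Longrightarrow> proj d g \<Longrightarrow> expressible d (\<lambda>e. f e = g e)"
  by (rule expr_atomic[where q = MEq]) (simp_all add: meta_Delta0.intros)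

lemma expr_inA: "expressible False (\<lambda>e. e n \<in> A)"
proof (rule expressibleI[of "{Inl n}"])
  fix \<rho> :: "nat + 'v \<Rightarrow> nat"
  show "\<exists>p. realizes False {Inl n} (\<lambda>e. e n \<in> A) \<rho> p"
    by (intro exI[of _ "MInA (\<rho> (Inl n))"]) (auto simp: realizes_def allowed_def)
qed auto

lemma expr_not:
  assumes "expressible d P"
  shows "expressible d (\<lambda>e. \<not> P e)"
proof -
  obtain J where J: "expressible_on d P J"
    using assms unfolding expressible_def by blast
  note J = expressible_onD[OF J]
  show ?thesis
  proof (rule expressibleI[OF J(1)])
    fix \<rho>
    obtain p where "realizes d J P \<rho> p" using J(4) by blast
    then show "\<exists>p. realizes d J (\<lambda>e. \<not> P e) \<rho> p"
      by (intro exI[of _ "MNeg p"]) (auto simp: realizes_def allowed_def intro: meta_Delta0.intros)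
  next
    fix e e' :: "nat \<Rightarrow> 'v" assume "\<And>n. Inl n \<in> J \<Longrightarrow> e n = e' n"
    then have "P e = P e'" by (rule J(3))
    then show "(\<not> P e) = (\<not> P e')" by simp
  qed (rule J(2))
qed

lemma expr_and:
  assumes "expressible d P" "expressible d Q"
  shows "expressible d (\<lambda>e. P e \<and> Q e)"
proof -
  obtain J where J: "expressible_on d P J"
    using assms(1) unfolding expressible_def by blast
  note J = expressible_onD[OF J]
  obtain K where K: "expressible_on d Q K"
    using assms(2) unfolding expressible_def by blast
  note K = expressible_onD[OF K]
  show ?thesis
  proof (rule expressibleI[of "J \<union> K"])
    fix \<rho>
    obtain p q where "realizes d J P \<rho> p" "realizes d K Q \<rho> q" using J(4) K(4) by blast
    then show "\<exists>p. realizes d (J \<union> K) (\<lambda>e. P e \<and> Q e) \<rho> p"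
      by (intro exI[of _ "MConj p q"]) (auto simp: realizes_def allowed_def intro: meta_Delta0.intros)
  next
    fix e e' :: "nat \<Rightarrow> 'v" assume "\<And>n. Inl n \<in> J \<union> K \<Longrightarrow> e n = e' n"
    then have "P e = P e'" "Q e = Q e'" by (intro J(3) K(3); simp)+
    then show "(P e \<and> Q e) = (P e' \<and> Q e')" by simp
  qed (use J(1,2) K(1,2) in auto)
qed

lemma expr_or:
  assumes "expressible d P" "expressible d Q"
  shows "expressible d (\<lambda>e. P e \<or> Q e)"
proof -
  have "expressible d (\<lambda>e. \<not> P e \<and> \<not> Q e)"
    by (intro expr_and expr_not assms)
  from expr_not[OF this] show ?thesis by simp
qed

lemma expr_imp:
  assumes "expressible d P" "expressible d Q"
  shows "expressible d (\<lambda>e. P e \<longrightarrow> Q e)"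
proof -
  have "expressible d (\<lambda>e. P e \<and> \<not> Q e)"
    by (intro expr_and expr_not assms)
  from expr_not[OF this] show ?thesis by simp
qed

text \<open>The formula for P, taken at the placement \<rho> after \<open>h\<close>, serves
  unchanged. Here it matters that formulas are demanded for all placements, including those that
  identify indices.\<close>

lemma expr_subst:
  assumes P: "expressible d P" and tau: "\<And>n c. \<tau> n = Inr c \<Longrightarrow> c \<in> univ d"
  shows "expressible d (\<lambda>e. P (\<lambda>n. val e (\<tau> n)))"
proof -
  obtain J where J: "expressible_on d P J"
    using P unfolding expressible_def by blast
  note J = expressible_onD[OF J]
  define h where "h = case_sum \<tau> Inr"
  have h: "Inl n \<in> J \<Longrightarrow> \<tau> n \<in> h ` J" "Inr c \<in> J \<Longrightarrow> Inr c \<in> h ` J" for n c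
    unfolding h_def by force+
  show ?thesis
  proof (rule expressibleI[of "h ` J"])
    show "finite (h ` J)" using J(1) by simp
    show "c \<in> univ d" if "Inr c \<in> h ` J" for c
      using that J(2) tau unfolding h_def by (auto split: sum.splits)
  next
    fix e e' :: "nat \<Rightarrow> 'v" assume a: "\<And>n. Inl n \<in> h ` J \<Longrightarrow> e n = e' n"
    have "val e (\<tau> n) = val e' (\<tau> n)" if "Inl n \<in> J" for n
      using a h(1)[OF that] by (intro val_cong) auto
    then show "P (\<lambda>n. val e (\<tau> n)) = P (\<lambda>n. val e' (\<tau> n))"
      by (rule J(3))
  next
    fix \<rho>
    obtain p where p: "realizes d J P (\<lambda>i. \<rho> (h i)) p" using J(4) by blast
    show "\<exists>p. realizes d (h ` J) (\<lambda>e. P (\<lambda>n. val e (\<tau> n))) \<rho> p"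
      unfolding realizes_def
    proof (intro exI[of _ p] conjI allI impI realizesD(1)[OF p])
      fix E :: "nat \<Rightarrow> 'v"
      assume E: "range E \<subseteq> univ d" "\<forall>c. Inr c \<in> h ` J \<longrightarrow> E (\<rho> (Inr c)) = c"
      have "sat (univ d) E p = P (\<lambda>n. E (\<rho> (\<tau> n)))"
        using realizesD(2)[OF p E(1)] E(2) h(2) by (simp add: h_def)
      also have "\<dots> = P (\<lambda>n. val (\<lambda>n. E (\<rho> (Inl n))) (\<tau> n))"
      proof (rule J(3))
        fix n assume "Inl n \<in> J"
        then show "E (\<rho> (\<tau> n)) = val (\<lambda>n. E (\<rho> (Inl n))) (\<tau> n)"
          using E(2) h(1) by (intro val_rho[symmetric]) force
      qed
      finally show "sat (univ d) E p = P (\<lambda>n. val (\<lambda>n. E (\<rho> (Inl n))) (\<tau> n))" .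
    qed
  qed
qed

lemma expr_rename: "expressible d P \<Longrightarrow> expressible d (\<lambda>e. P (\<lambda>n. e (r n)))"
  using expr_subst[of d P "\<lambda>n. Inl (r n)"] by simp

lemma expr_let:
  assumes "expressible d (\<lambda>e. R (e 0) (\<lambda>n. e (Suc n)))" "proj d f"
  shows "expressible d (\<lambda>e. R (f e) e)"
proof -
  obtain \<sigma> where s: "\<And>c. \<sigma> = Inr c \<Longrightarrow> c \<in> univ d" "f = (\<lambda>e. val e \<sigma>)"
    using assms(2) unfolding proj_def by blast
  have "expressible d (\<lambda>e. R (val e (case_nat \<sigma> Inl 0)) (\<lambda>n. val e (case_nat \<sigma> Inl (Suc n))))"
    by (rule expr_subst[OF assms(1)]) (auto split: nat.splits intro: s(1))
  then show ?thesis unfolding s(2) by simp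
qed

lemma mem_univ: "x \<in> univ d \<Longrightarrow> y \<^bold>\<in> x \<Longrightarrow> y \<in> univ d"
  using A_transitive by (auto simp: univ_def split: if_splits)

lemma expressible_on_fresh_variable:
  assumes J: "expressible_on d P J" and F: "finite F"
  shows "\<exists>i p. i \<notin> F \<and> allowed d p \<and> (\<forall>E. range E \<subseteq> univ d \<longrightarrow> (\<forall>c. Inr c \<in> J \<longrightarrow> E (\<rho> (Inr c)) = c) \<longrightarrow>
        (\<forall>a\<in>univ d. sat (univ d) (E(i := a)) p = P (case_nat a (\<lambda>n. E (\<rho> (Inl n))))))"
proof -
  note J = expressible_onD[OF J]
  \<comment> \<open>Index \<open>Inl 0\<close> of P becomes the bound variable and the other
    variables move down by one. The value of \<open>h\<close> at \<open>Inl 0\<close> is a dummy; at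
    most it makes \<open>i\<close> avoid one more position.\<close>
  define h where "h = case_sum (case_nat (Inr undefined) Inl) (Inr :: 'v \<Rightarrow> nat + 'v)"
  obtain i where i: "i \<notin> F \<union> (\<rho> \<circ> h) ` J"
    using J(1) F ex_new_if_finite[of "F \<union> (\<rho> \<circ> h) ` J"] by auto
  define \<rho>' where "\<rho>' = case_sum (case_nat i (\<lambda>n. \<rho> (Inl n))) (\<lambda>c. \<rho> (Inr c))"
  have i1: "\<rho> (Inl n) \<noteq> i" if "Inl (Suc n) \<in> J" for n
    using i imageI[OF that, of "\<rho> \<circ> h"] by (auto simp: h_def)
  have i2: "\<rho> (Inr c) \<noteq> i" if "Inr c \<in> J" for c
    using i imageI[OF that, of "\<rho> \<circ> h"] by (auto simp: h_def)
  obtain p where p: "realizes d J P \<rho>' p" using J(4) by blast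
  show ?thesis
  proof (intro exI[of _ i] exI[of _ p] conjI allI impI ballI)
    fix E :: "nat \<Rightarrow> 'v" and a
    assume E: "range E \<subseteq> univ d" "\<forall>c. Inr c \<in> J \<longrightarrow> E (\<rho> (Inr c)) = c" "a \<in> univ d"
    have "sat (univ d) (E(i := a)) p = P (\<lambda>n. (E(i := a)) (\<rho>' (Inl n)))"
      using E i2 by (intro realizesD(2)[OF p]) (auto simp: \<rho>'_def)
    also have "\<dots> = P (case_nat a (\<lambda>n. E (\<rho> (Inl n))))"
      by (rule J(3)) (use i1 in \<open>auto simp: \<rho>'_def split: nat.splits\<close>)
    finally show "sat (univ d) (E(i := a)) p = P (case_nat a (\<lambda>n. E (\<rho> (Inl n))))" .
  qed (use i realizesD(1)[OF p] in auto)
qed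

text \<open>For bounded formulas over \<open>A\<close> the quantifier ranges over \<open>A\<close>
  only, which is no loss because \<open>A\<close> is transitive. The bound variable is kept
  different from the position of the bound, as \<open>meta_Delta0\<close> requires.\<close>

lemma expr_bex:
  assumes P: "expressible d (\<lambda>e. R (e 0) (\<lambda>n. e (Suc n)))" and f: "proj d f"
  shows "expressible d (\<lambda>e. \<exists>x. x \<^bold>\<in> f e \<and> R x e)"
proof -
  obtain \<sigma> where s: "\<And>c. \<sigma> = Inr c \<Longrightarrow> c \<in> univ d" "f = (\<lambda>e. val e \<sigma>)"
    using f unfolding proj_def by blast
  let ?P = "\<lambda>e. R (e 0) (\<lambda>n. e (Suc n))"
  obtain J where J: "expressible_on d ?P J"
    using P unfolding expressible_def by blast
  note ex = expressible_on_fresh_variable[OF J] and J = expressible_onD[OF J]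
  define h where "h = case_sum (case_nat \<sigma> Inl) (Inr :: 'v \<Rightarrow> nat + 'v)"
  have hI: "Inl (Suc n) \<in> J \<Longrightarrow> Inl n \<in> h ` J" "Inr c \<in> J \<Longrightarrow> Inr c \<in> h ` J" for n c
    unfolding h_def by force+
  show ?thesis
    unfolding s(2)
  proof (rule expressibleI[of "insert \<sigma> (h ` J)"])
    show "finite (insert \<sigma> (h ` J))" using J(1) by simp
    show "c \<in> univ d" if "Inr c \<in> insert \<sigma> (h ` J)" for c
      using that J(2) s(1) unfolding h_def by (auto split: sum.splits nat.splits)
  next
    fix e e' :: "nat \<Rightarrow> 'v" assume a: "\<And>n. Inl n \<in> insert \<sigma> (h ` J) \<Longrightarrow> e n = e' n"
    have "val e \<sigma> = val e' \<sigma>" using a by (intro val_cong) auto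
    moreover have "R x e = R x e'" for x
      using J(3)[of "case_nat x e" "case_nat x e'"] a hI(1)
      by (fastforce split: nat.splits)
    ultimately show "(\<exists>x. x \<^bold>\<in> val e \<sigma> \<and> R x e) = (\<exists>x. x \<^bold>\<in> val e' \<sigma> \<and> R x e')" by simp
  next
    fix \<rho>
    obtain i p where p: "i \<noteq> \<rho> \<sigma>" "allowed d p"
      "\<forall>E. range E \<subseteq> univ d \<longrightarrow> (\<forall>c. Inr c \<in> J \<longrightarrow> E (\<rho> (Inr c)) = c) \<longrightarrow>
        (\<forall>a\<in>univ d. sat (univ d) (E(i := a)) p = ?P (case_nat a (\<lambda>n. E (\<rho> (Inl n)))))"
      using ex[of "{\<rho> \<sigma>}" \<rho>] by auto
    show "\<exists>p. realizes d (insert \<sigma> (h ` J)) (\<lambda>e. \<exists>x. x \<^bold>\<in> val e \<sigma> \<and> R x e) \<rho> p"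
      unfolding realizes_def
    proof (intro exI[of _ "MEx i (MConj (MMem i (\<rho> \<sigma>)) p)"] conjI allI impI)
      show "allowed d (MEx i (MConj (MMem i (\<rho> \<sigma>)) p))"
        using p(1,2) by (auto simp: allowed_def intro: meta_Delta0.intros)
      fix E :: "nat \<Rightarrow> 'v"
      assume E: "range E \<subseteq> univ d" "\<forall>c. Inr c \<in> insert \<sigma> (h ` J) \<longrightarrow> E (\<rho> (Inr c)) = c"
      have v: "val (\<lambda>n. E (\<rho> (Inl n))) \<sigma> = E (\<rho> \<sigma>)"
        using E(2) by (intro val_rho) auto
      have "E (\<rho> \<sigma>) \<in> univ d" using E(1) by auto
      then have "(\<exists>x. x \<^bold>\<in> E (\<rho> \<sigma>) \<and> R x (\<lambda>n. E (\<rho> (Inl n)))) =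
         (\<exists>x\<in>univ d. x \<^bold>\<in> E (\<rho> \<sigma>) \<and> R x (\<lambda>n. E (\<rho> (Inl n))))"
        using mem_univ by blast
      also have "\<dots> = sat (univ d) E (MEx i (MConj (MMem i (\<rho> \<sigma>)) p))"
        using p(1,3) E hI(2) by simp
      finally show "sat (univ d) E (MEx i (MConj (MMem i (\<rho> \<sigma>)) p)) =
          (\<exists>x. x \<^bold>\<in> val (\<lambda>n. E (\<rho> (Inl n))) \<sigma> \<and> R x (\<lambda>n. E (\<rho> (Inl n))))"
        by (simp add: v)
    qed
  qed
qed

lemma expr_ball:
  assumes P: "expressible d (\<lambda>e. R (e 0) (\<lambda>n. e (Suc n)))" and f: "proj d f"
  shows "expressible d (\<lambda>e. \<forall>x. x \<^bold>\<in> f e \<longrightarrow> R x e)"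
proof -
  have "expressible d (\<lambda>e. \<exists>x. x \<^bold>\<in> f e \<and> \<not> R x e)"
    by (rule expr_bex[OF expr_not[OF P] f])
  from expr_not[OF this] show ?thesis by simp
qed

lemma expr_ex:
  assumes P: "expressible False (\<lambda>e. R (e 0) (\<lambda>n. e (Suc n)))"
  shows "expressible False (\<lambda>e. \<exists>x. R x e)"
proof -
  let ?P = "\<lambda>e. R (e 0) (\<lambda>n. e (Suc n))"
  obtain J where J: "expressible_on False ?P J"
    using P unfolding expressible_def by blast
  note ex = expressible_on_fresh_variable[OF J] and J = expressible_onD[OF J]
  define h where "h = case_sum (case_nat (Inl 0) Inl) (Inr :: 'v \<Rightarrow> nat + 'v)"
  have hI: "Inl (Suc n) \<in> J \<Longrightarrow> Inl n \<in> h ` J" "Inr c \<in> J \<Longrightarrow> Inr c \<in> h ` J" for n c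
    unfolding h_def by force+
  show ?thesis
  proof (rule expressibleI[of "h ` J"])
    show "finite (h ` J)" using J(1) by simp
    show "c \<in> univ False" for c by (simp add: univ_def)
  next
    fix e e' :: "nat \<Rightarrow> 'v" assume a: "\<And>n. Inl n \<in> h ` J \<Longrightarrow> e n = e' n"
    have "R x e = R x e'" for x
      using J(3)[of "case_nat x e" "case_nat x e'"] a hI(1)
      by (fastforce split: nat.splits)
    then show "(\<exists>x. R x e) = (\<exists>x. R x e')" by simp
  next
    fix \<rho>
    obtain i p where p: "allowed False p"
      "\<forall>E. range E \<subseteq> univ False \<longrightarrow> (\<forall>c. Inr c \<in> J \<longrightarrow> E (\<rho> (Inr c)) = c) \<longrightarrow>
        (\<forall>a\<in>univ False. sat (univ False) (E(i := a)) p = ?P (case_nat a (\<lambda>n. E (\<rho> (Inl n)))))"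
      using ex[of "{}" \<rho>] by auto
    then show "\<exists>p. realizes False (h ` J) (\<lambda>e. \<exists>x. R x e) \<rho> p"
      using hI(2) by (intro exI[of _ "MEx i p"]) (auto simp: realizes_def allowed_def univ_def)
  qed
qed

lemma expr_all:
  assumes P: "expressible False (\<lambda>e. R (e 0) (\<lambda>n. e (Suc n)))"
  shows "expressible False (\<lambda>e. \<forall>x. R x e)"
proof -
  have "expressible False (\<lambda>e. \<exists>x. \<not> R x e)"
    by (rule expr_ex[OF expr_not[OF P]])
  from expr_not[OF this] show ?thesis by simp
qed

lemma expr_sat: "expressible False (\<lambda>e. sat UNIV e p)"
proof (induction p)
  case (MMem i j) then show ?case by (simp add: expr_mem proj_var)
next
  case (MEq i j) then show ?case by (simp add: expr_eq proj_var)
next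
  case (MInA i) then show ?case by (simp add: expr_inA)
next
  case (MNeg p) then show ?case by (simp add: expr_not)
next
  case (MConj p q) then show ?case by (simp add: expr_and)
next
  case (MDisj p q) then show ?case by (simp add: expr_or)
next
  case (MImp p q) then show ?case by (simp add: expr_imp)
next
  case (MAll i p)
  \<comment> \<open>The quantifier of \<open>sat\<close> overwrites position \<open>i\<close>, while
    \<open>expr_all\<close> puts the new value in front; the renaming of indices reconciles the
    two.\<close>
  have "(\<lambda>n. if n = i then e 0 else e (Suc n)) = (\<lambda>n. e (Suc n))(i := e 0)" for e :: "nat \<Rightarrow> 'v"
    by auto
  then show ?case
    using expr_all[of "\<lambda>a e. sat UNIV (e(i := a)) p"] expr_rename[OF MAll, of "\<lambda>n. if n = i then 0 else Suc n"]
    by (simp add: if_distrib cong: if_cong)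
next
  case (MEx i p)
  have "(\<lambda>n. if n = i then e 0 else e (Suc n)) = (\<lambda>n. e (Suc n))(i := e 0)" for e :: "nat \<Rightarrow> 'v"
    by auto
  then show ?case
    using expr_ex[of "\<lambda>a e. sat UNIV (e(i := a)) p"] expr_rename[OF MEx, of "\<lambda>n. if n = i then 0 else Suc n"]
    by (simp add: if_distrib cong: if_cong)
qed

text \<open>The environment \<open>e0\<close> offers infinitely many parameters, yet only finitely
  many enter, because the index set of an expressible predicate is finite.\<close>

lemma expr_class:
  assumes C: "definable_class C" and f: "proj False f"
  shows "expressible False (\<lambda>e. f e \<in> C)"
proof -
  obtain p e0 where C: "C = {x. sat UNIV (e0(0 := x)) p}"
    using C unfolding definable_class_def by (elim exE)
  have *: "(\<lambda>n. val e (case_nat (Inl 0) (\<lambda>m. Inr (e0 (Suc m))) n)) = e0(0 := e 0)" for e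
    by (rule ext) (simp split: nat.split)
  have "expressible False (\<lambda>e. sat UNIV (\<lambda>n. val e (case_nat (Inl 0) (\<lambda>m. Inr (e0 (Suc m))) n)) p)"
    by (rule expr_subst[OF expr_sat[of p]]) (simp add: univ_def)
  then have "expressible False (\<lambda>e. e 0 \<in> C)"
    unfolding * C mem_Collect_eq .
  then show ?thesis using f by (rule expr_let[of False "\<lambda>x e. x \<in> C"])
qed

lemma proj_shift: "proj d f \<Longrightarrow> proj d (\<lambda>e. f (\<lambda>n. e (Suc n)))"
proof -
  assume "proj d f"
  then obtain \<sigma> where s: "\<And>c. \<sigma> = Inr c \<Longrightarrow> c \<in> univ d" "f = (\<lambda>e. val e \<sigma>)"
    unfolding proj_def by blast
  then show ?thesis
    by (cases \<sigma>) (auto intro: proj_var proj_const)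
qed

lemma expr_let2:
  assumes "expressible d (\<lambda>e. R (e 0) (e 1))" "proj d f" "proj d g"
  shows "expressible d (\<lambda>e. R (f e) (g e))"
proof -
  have "expressible d (\<lambda>e. R (e (Suc 0)) (e 0))"
    using expr_rename[OF assms(1), of "\<lambda>n. if n = 0 then 1 else 0"] by simp
  then have "expressible d (\<lambda>e. R (e 0) (g (\<lambda>n. e (Suc n))))"
    by (rule expr_let[of d "\<lambda>y e. R (e 0) y", OF _ proj_shift[OF assms(3)]])
  then show ?thesis
    by (rule expr_let[of d "\<lambda>x e. R x (g e)", OF _ assms(2)])
qed

lemma expr_rel:
  assumes R: "definable_rel R" and f: "proj False f" and g: "proj False g"
  shows "expressible False (\<lambda>e. (f e, g e) \<in> R)"
proof (rule expr_let2[OF _ f g])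
  obtain p e0 where R: "R = {(x, y). sat UNIV (e0(0 := x, 1 := y)) p}"
    using R unfolding definable_rel_def by (elim exE)
  have *: "(\<lambda>n. val e (case_nat (Inl 0) (case_nat (Inl 1) (\<lambda>m. Inr (e0 (Suc (Suc m))))) n)) = e0(0 := e 0, 1 := e 1)"
    for e
    by (rule ext) (simp split: nat.split)
  have "expressible False (\<lambda>e. sat UNIV (\<lambda>n. val e (case_nat (Inl 0) (case_nat (Inl 1) (\<lambda>m. Inr (e0 (Suc (Suc m))))) n)) p)"
    by (rule expr_subst[OF expr_sat[of p]]) (simp add: univ_def split: nat.splits)
  then show "expressible False (\<lambda>e. (e 0, e 1) \<in> R)"
    unfolding * R mem_Collect_eq prod.case .
qed

lemma expr_in_A:
  assumes f: "proj False f"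
  shows "expressible False (\<lambda>e. f e \<in> A)"
  by (rule expr_let[of False "\<lambda>x e. x \<in> A", OF expr_inA f])

section \<open>Induction, separation and collection for expressible predicates\<close>

lemma expressible_witness:
  assumes "expressible d P" "univ d \<noteq> {}"
  shows "\<exists>p e. allowed d p \<and> range e \<subseteq> univ d \<and> (\<forall>x\<in>univ d. \<forall>y\<in>univ d.
       sat (univ d) (e(0 := x, 1 := y)) p = P (\<lambda>n. if n = 0 then x else y))"
proof -
  obtain J where J: "expressible_on d P J"
    using assms(1) unfolding expressible_def by blast
  note J = expressible_onD[OF J]
  obtain a0 where a0: "a0 \<in> univ d" using assms(2) by blast
  define K where "K = {c. Inr c \<in> J}"
  have "finite K" unfolding K_def using J(1) by (rule finite_vimageI[where h=Inr, unfolded vimage_def]) simp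
  then obtain g :: "'v \<Rightarrow> nat" where g: "inj_on g K"
    using finite_imp_inj_to_nat_seg by blast
  \<comment> \<open>Variable 0 goes to position 0 and all other variables to 1; parameters are
    numbered by \<open>g\<close> and start at 2. In \<open>e\<close>, the remaining positions hold
    an arbitrary element of \<open>univ d\<close>, so that its range stays inside.\<close>
  define \<rho> :: "nat + 'v \<Rightarrow> nat" where "\<rho> = case_sum (\<lambda>n. if n = 0 then 0 else 1) (\<lambda>c. Suc (Suc (g c)))"
  define e where "e = case_nat a0 (case_nat a0 (\<lambda>m. if m \<in> g ` K then inv_into K g m else a0))"
  obtain p where p: "realizes d J P \<rho> p" using J(4) by blast
  have re: "range e \<subseteq> univ d"
    using a0 J(2) inv_into_into[of _ g K] unfolding e_def K_def by (auto split: nat.splits)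
  show ?thesis
  proof (intro exI[of _ p] exI[of _ e] conjI ballI realizesD(1)[OF p] re)
    fix x y assume xy: "x \<in> univ d" "y \<in> univ d"
    have "sat (univ d) (e(0 := x, 1 := y)) p = P (\<lambda>n. (e(0 := x, 1 := y)) (\<rho> (Inl n)))"
    proof (rule realizesD(2)[OF p])
      show "range (e(0 := x, 1 := y)) \<subseteq> univ d" using re xy by auto
      fix c assume "Inr c \<in> J"
      then have "c \<in> K" by (simp add: K_def)
      then show "(e(0 := x, 1 := y)) (\<rho> (Inr c)) = c"
        using g by (simp add: \<rho>_def e_def)
    qed
    also have "(\<lambda>n. (e(0 := x, 1 := y)) (\<rho> (Inl n))) = (\<lambda>n. if n = 0 then x else y)"
      by (auto simp: \<rho>_def)
    finally show "sat (univ d) (e(0 := x, 1 := y)) p = P (\<lambda>n. if n = 0 then x else y)" .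
  qed
qed

lemma definable_classI:
  assumes "expressible False (\<lambda>e. P (e 0))"
  shows "definable_class {x. P x}"
proof -
  obtain p e where p: "\<forall>x y. sat UNIV (e(0 := x, 1 := y)) p = P x"
    using expressible_witness[OF assms] by (auto simp: univ_def)
  have "sat UNIV (e(0 := x)) p = P x" for x
    using p[rule_format, of x "e 1"] by (simp add: fun_upd_idem)
  then show ?thesis unfolding definable_class_def by blast
qed

lemma definable_relI:
  assumes "expressible False (\<lambda>e. P (e 0) (e 1))"
  shows "definable_rel {(x, y). P x y}"
proof -
  obtain p e where p: "\<forall>x y. sat UNIV (e(0 := x, 1 := y)) p = P x y"
    using expressible_witness[OF assms] by (auto simp: univ_def)
  then show ?thesis unfolding definable_rel_def by blast
qed

text \<open>Foundation is available for the expanded language, so P may refer to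
  \<open>A\<close>.\<close>

lemma mem_induct:
  assumes "expressible False (\<lambda>e. P (e 0))"
    and step: "\<And>x. (\<And>y. y \<^bold>\<in> x \<Longrightarrow> P y) \<Longrightarrow> P x"
  shows "P x"
proof (rule ccontr)
  assume "\<not> P x"
  obtain p e where p: "\<forall>x y. sat UNIV (e(0 := x, 1 := y)) p = (\<not> P x)"
    using expressible_witness[OF expr_not[OF assms(1)]] by (auto simp: univ_def)
  have p: "sat UNIV (e(0 := x)) p = (\<not> P x)" for x
    using p[rule_format, of x "e 1"] by (simp add: fun_upd_idem)
  show False using foundation[of e p] \<open>\<not> P x\<close> step unfolding p by blast
qed

lemma separation_A:
  assumes P: "expressible True (\<lambda>e. P (e 0))" and a: "a \<in> A"
  obtains b where "b \<in> A" "\<And>x. x \<^bold>\<in> b \<longleftrightarrow> x \<^bold>\<in> a \<and> P x"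
proof -
  have ne: "univ True \<noteq> {}" using a by (auto simp: univ_def)
  obtain p e where p: "meta_Delta0 p" "range e \<subseteq> A"
     "\<forall>x\<in>A. \<forall>y\<in>A. sat A (e(0 := x, 1 := y)) p = P x"
    using expressible_witness[OF P ne] by (auto simp: univ_def allowed_def)
  have p3: "sat A (e(0 := x)) p = P x" if "x \<in> A" for x
    using p(3)[rule_format, OF that, of "e 1"] p(2) by (simp add: fun_upd_idem image_subset_iff)
  obtain b where b: "b \<in> A" "\<forall>x\<in>A. x \<^bold>\<in> b \<longleftrightarrow> x \<^bold>\<in> a \<and> sat A (e(0 := x)) p"
    using KP_relativized[unfolded KP_in_def, THEN conjunct22, THEN conjunct22, THEN conjunct1, rule_format, OF p(1,2) a] by (elim bexE)
  \<comment> \<open>Transitivity of \<open>A\<close> extends the description of b from the elements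
    of \<open>A\<close> to all of V.\<close>
  then have "x \<^bold>\<in> b \<longleftrightarrow> x \<^bold>\<in> a \<and> P x" for x
    using p3 A_transitive[of _ x] a by blast
  then show ?thesis using b that by blast
qed

lemma collection_A:
  assumes P: "expressible True (\<lambda>e. P (e 0) (e 1))" and a: "a \<in> A"
    and ex: "\<And>x. x \<^bold>\<in> a \<Longrightarrow> \<exists>y\<in>A. P x y"
  obtains b where "b \<in> A" "\<And>x. x \<^bold>\<in> a \<Longrightarrow> \<exists>y. y \<^bold>\<in> b \<and> P x y"
proof -
  have ne: "univ True \<noteq> {}" using a by (auto simp: univ_def)
  obtain p e where p: "meta_Delta0 p" "range e \<subseteq> A"
     "\<forall>x\<in>A. \<forall>y\<in>A. sat A (e(0 := x, 1 := y)) p = P x y"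
    using expressible_witness[OF P ne] by (auto simp: univ_def allowed_def)
  have col: "(\<forall>x\<in>A. x \<^bold>\<in> a \<longrightarrow> (\<exists>y\<in>A. sat A (e(0 := x, 1 := y)) p)) \<Longrightarrow>
         (\<exists>b\<in>A. \<forall>x\<in>A. x \<^bold>\<in> a \<longrightarrow> (\<exists>y\<in>A. y \<^bold>\<in> b \<and> sat A (e(0 := x, 1 := y)) p))"
    by (rule KP_relativized[unfolded KP_in_def, THEN conjunct22, THEN conjunct22, THEN conjunct2, THEN spec, THEN spec, THEN mp, THEN mp, THEN bspec, THEN mp, OF p(1,2) a])
  have "\<exists>b\<in>A. \<forall>x\<in>A. x \<^bold>\<in> a \<longrightarrow> (\<exists>y\<in>A. y \<^bold>\<in> b \<and> sat A (e(0 := x, 1 := y)) p)"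
    by (rule col) (use ex p(3) in blast)
  then obtain b where b: "b \<in> A" "\<forall>x\<in>A. x \<^bold>\<in> a \<longrightarrow> (\<exists>y\<in>A. y \<^bold>\<in> b \<and> sat A (e(0 := x, 1 := y)) p)"
    by blast
  then have "\<exists>y. y \<^bold>\<in> b \<and> P x y" if "x \<^bold>\<in> a" for x
    using that a A_transitive[of a x] p(3) by blast
  then show ?thesis using b that by blast
qed

section \<open>Sets in an admissible class\<close>

lemma ext_V: "(\<And>w. w \<^bold>\<in> x \<longleftrightarrow> w \<^bold>\<in> y) \<Longrightarrow> x = y"
  using KP_V[unfolded KP_in_def, THEN conjunct1] by blast

lemma separation_V:
  assumes "meta_Delta0 p"
  shows "\<exists>b. \<forall>x. x \<^bold>\<in> b \<longleftrightarrow> x \<^bold>\<in> a \<and> sat UNIV (e(0 := x)) p"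
  using KP_V[unfolded KP_in_def, THEN conjunct22, THEN conjunct22, THEN conjunct1, rule_format, OF assms subset_UNIV, of a] by simp

text \<open>The Pair axiom only yields some set containing x and y; Separation cuts out the exact
  pair, and Extensionality makes the definite description proper.\<close>

lemma mem_vupair [simp]: "w \<^bold>\<in> vupair x y \<longleftrightarrow> w = x \<or> w = y"
proof -
  obtain a where a: "x \<^bold>\<in> a" "y \<^bold>\<in> a"
    using KP_V[unfolded KP_in_def, THEN conjunct2, THEN conjunct1] by blast
  obtain b where b: "\<forall>w. w \<^bold>\<in> b \<longleftrightarrow> w \<^bold>\<in> a \<and>
      sat UNIV (((\<lambda>_. y)(1 := x))(0 := w)) (MDisj (MEq 0 1) (MEq 0 2))"
    using separation_V[of "MDisj (MEq 0 1) (MEq 0 2)" a "(\<lambda>_. y)(1 := x)"]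
    by (blast intro: meta_Delta0.intros)
  have "\<forall>w. w \<^bold>\<in> vupair x y \<longleftrightarrow> w = x \<or> w = y"
    unfolding vupair_def
  proof (rule theI)
    show *: "\<forall>w. w \<^bold>\<in> b \<longleftrightarrow> w = x \<or> w = y" using a b by auto
    show "z = b" if "\<forall>w. w \<^bold>\<in> z \<longleftrightarrow> w = x \<or> w = y" for z
      using that * by (intro ext_V) simp
  qed
  then show ?thesis by blast
qed

lemma not_mem_vempty [simp]: "\<not> w \<^bold>\<in> vempty"
proof -
  obtain b where b: "\<forall>w. w \<^bold>\<in> b \<longleftrightarrow> w \<^bold>\<in> undefined \<and> sat UNIV (undefined(0 := w)) (MNeg (MEq 0 0))"
    using separation_V[of "MNeg (MEq 0 0)" undefined undefined] by (blast intro: meta_Delta0.intros)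
  have "\<forall>w. \<not> w \<^bold>\<in> vempty"
    unfolding vempty_def
  proof (rule theI)
    show *: "\<forall>w. \<not> w \<^bold>\<in> b" using b by auto
    show "z = b" if "\<forall>w. \<not> w \<^bold>\<in> z" for z
      using that * by (intro ext_V) simp
  qed
  then show ?thesis by blast
qed

lemma vupair_commute: "vupair x y = vupair y x"
  by (rule ext_V) auto

lemma vupair_eq_iff: "vupair a b = vupair c d \<longleftrightarrow> a = c \<and> b = d \<or> a = d \<and> b = c"
  by (metis mem_vupair vupair_commute)

lemma vpair_eq_iff [simp]: "vpair a b = vpair c d \<longleftrightarrow> a = c \<and> b = d"
  unfolding vpair_def vupair_eq_iff by auto

lemma tag_eq_iff [simp]: "tag m = tag n \<longleftrightarrow> m = n"
proof (induction m arbitrary: n)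
  case 0 show ?case by (cases n) (auto, metis mem_vupair not_mem_vempty)
next
  case (Suc m) show ?case
    by (cases n) (auto simp: Suc.IH vupair_eq_iff, metis mem_vupair not_mem_vempty)
qed

lemma vupair_A [simp]: "vupair x y \<in> A \<longleftrightarrow> x \<in> A \<and> y \<in> A"
proof
  assume "vupair x y \<in> A" then show "x \<in> A \<and> y \<in> A" using A_transitive[of "vupair x y"] by simp
next
  assume xy: "x \<in> A \<and> y \<in> A"
  then obtain a where a: "a \<in> A" "x \<^bold>\<in> a" "y \<^bold>\<in> a"
    using KP_relativized[unfolded KP_in_def, THEN conjunct2, THEN conjunct1] by blast
  have "expressible True (\<lambda>e. e 0 = x \<or> e 0 = y)"
    using xy by (intro expr_or expr_eq proj_var proj_const) (auto simp: univ_def)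
  then obtain b where "b \<in> A" and b: "\<And>w. w \<^bold>\<in> b \<longleftrightarrow> w \<^bold>\<in> a \<and> (w = x \<or> w = y)"
    using separation_A[OF _ a(1), of "\<lambda>w. w = x \<or> w = y"] by blast
  have "vupair x y = b" using a by (intro ext_V) (auto simp: b)
  then show "vupair x y \<in> A" using \<open>b \<in> A\<close> by simp
qed

lemma vpair_A [simp]: "vpair x y \<in> A \<longleftrightarrow> x \<in> A \<and> y \<in> A"
  unfolding vpair_def by auto

text \<open>The axioms hold vacuously for empty \<open>A\<close>, hence the appeal to some element
  of \<open>A\<close>.\<close>

lemma vempty_A: "a \<in> A \<Longrightarrow> vempty \<in> A"
proof -
  assume a: "a \<in> A"
  have "expressible True (\<lambda>e. e 0 \<noteq> e 0)"
    by (intro expr_not expr_eq proj_var)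
  then obtain b where "b \<in> A" and b: "\<And>w. w \<^bold>\<in> b \<longleftrightarrow> w \<^bold>\<in> a \<and> w \<noteq> w"
    using separation_A[OF _ a, of "\<lambda>w. w \<noteq> w"] by blast
  have "vempty = b" by (intro ext_V) (auto simp: b)
  then show "vempty \<in> A" using \<open>b \<in> A\<close> by simp
qed

lemma tag_A: "a \<in> A \<Longrightarrow> tag n \<in> A"
  by (induction n) (auto simp: vempty_A)

section \<open>Bounded definability of pairs\<close>

lemma expr_vupair:
  assumes f: "proj d f" and g: "proj d g" and h: "proj d h"
  shows "expressible d (\<lambda>e. f e = vupair (g e) (h e))"
proof -
  have "f e = vupair (g e) (h e) \<longleftrightarrow> g e \<^bold>\<in> f e \<and> h e \<^bold>\<in> f e \<and> (\<forall>c. c \<^bold>\<in> f e \<longrightarrow> c = g e \<or> c = h e)" for e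
    by (metis ext_V mem_vupair)
  moreover have "expressible d (\<lambda>e. g e \<^bold>\<in> f e \<and> h e \<^bold>\<in> f e \<and> (\<forall>c. c \<^bold>\<in> f e \<longrightarrow> c = g e \<or> c = h e))"
    by (intro expr_and expr_mem expr_ball expr_or expr_eq proj_shift proj_var f g h)
  ultimately show ?thesis by simp
qed

text \<open>The singleton and the doubleton that make up a Kuratowski pair are elements of it, which
  bounds both quantifiers.\<close>

lemma expr_vpair:
  assumes f: "proj d f" and g: "proj d g" and h: "proj d h"
  shows "expressible d (\<lambda>e. f e = vpair (g e) (h e))"
proof -
  have "f e = vpair (g e) (h e) \<longleftrightarrow>
     (\<exists>a. a \<^bold>\<in> f e \<and> (\<exists>b. b \<^bold>\<in> f e \<and> a = vupair (g e) (g e) \<and> b = vupair (g e) (h e) \<and> f e = vupair a b))" for e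
    by (auto simp: vpair_def)
  moreover have "expressible d (\<lambda>e. \<exists>a. a \<^bold>\<in> f e \<and> (\<exists>b. b \<^bold>\<in> f e \<and> a = vupair (g e) (g e) \<and> b = vupair (g e) (h e) \<and> f e = vupair a b))"
    by (intro expr_bex expr_and expr_vupair proj_shift proj_var f g h)
  ultimately show ?thesis by simp
qed

lemma expr_vpair_mem:
  assumes f: "proj d f" and g: "proj d g" and h: "proj d h"
  shows "expressible d (\<lambda>e. vpair (f e) (g e) \<^bold>\<in> h e)"
proof -
  have "expressible d (\<lambda>e. \<exists>q. q \<^bold>\<in> h e \<and> q = vpair (f e) (g e))"
    by (intro expr_bex expr_vpair proj_shift proj_var f g h)
  then show ?thesis by simp
qed

lemma expr_ex_vpair:
  assumes R: "expressible d (\<lambda>e. R (e 0) (e 1) (\<lambda>n. e (Suc (Suc n))))" and f: "proj d f"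
  shows "expressible d (\<lambda>e. \<exists>x y. f e = vpair x y \<and> R x y e)"
proof -
  have eq: "(\<exists>x y. f e = vpair x y \<and> R x y e) \<longleftrightarrow>
     (\<exists>a. a \<^bold>\<in> f e \<and> (\<exists>x. x \<^bold>\<in> a \<and> (\<exists>b. b \<^bold>\<in> f e \<and> (\<exists>y. y \<^bold>\<in> b \<and> f e = vpair x y \<and> R x y e))))" (is "?l \<longleftrightarrow> ?r") for e
  proof
    assume ?l
    then obtain x y where xy: "f e = vpair x y" "R x y e" by blast
    have "vupair x y \<^bold>\<in> f e" "x \<^bold>\<in> vupair x y" "y \<^bold>\<in> vupair x y" by (simp_all add: xy(1), simp add: vpair_def)
    then show ?r using xy by blast
  qed blast
  \<comment> \<open>Inside the four bounded quantifiers over a, x, b, y the variable y has index 0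
    and x has index 2; the outer environment starts at 4.\<close>
  have "expressible d (\<lambda>e. R (e (Suc (Suc 0))) (e 0) (\<lambda>n. e (Suc (Suc (Suc (Suc n))))))"
    using expr_rename[OF R, of "case_nat (Suc (Suc 0)) (case_nat 0 (\<lambda>n. (Suc (Suc (Suc (Suc n))))))"] by simp
  then have "expressible d (\<lambda>e. \<exists>a. a \<^bold>\<in> f e \<and> (\<exists>x. x \<^bold>\<in> a \<and> (\<exists>b. b \<^bold>\<in> f e \<and> (\<exists>y. y \<^bold>\<in> b \<and> f e = vpair x y \<and> R x y e))))"
    by (intro expr_bex expr_and expr_vpair proj_shift proj_var f)
  then show ?thesis unfolding eq .
qed

lemma univ_A: "c \<in> A \<Longrightarrow> c \<in> univ d"
  by (simp add: univ_def)

lemma univ_False: "c \<in> univ False"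
  by (simp add: univ_def)

lemmas expr_intros =
  expr_ex_vpair expr_bex expr_ball expr_not expr_and expr_or expr_imp
  expr_vpair expr_vpair_mem expr_mem expr_eq proj_var proj_const univ_False

section \<open>Induction along the constituents of a code\<close>

primrec below :: "('v \<Rightarrow> bool) \<Rightarrow> nat \<Rightarrow> 'v \<Rightarrow> bool" where
  "below P 0 x = P x"
| "below P (Suc n) x = (P x \<and> (\<forall>y. y \<^bold>\<in> x \<longrightarrow> below P n y))"

lemma below_Suc: "below P (Suc n) x \<Longrightarrow> below P n x"
  by (induction n arbitrary: x) auto

lemma expr_below: "expressible False (\<lambda>e. P (e 0)) \<Longrightarrow> expressible False (\<lambda>e. below P n (e 0))"
  by (induction n) (auto intro!: expr_and expr_ball proj_var)

definition subcode :: "'v \<Rightarrow> 'v \<Rightarrow> bool" where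
  "subcode y x \<longleftrightarrow> (\<exists>k. x = vpair k y) \<or> (\<exists>k z. x = vpair k (vpair y z)) \<or>
     (\<exists>k z. x = vpair k (vpair z y)) \<or> (\<exists>k z. x = vpair k z \<and> y \<^bold>\<in> z)"

text \<open>A constituent of a code lies at most four membership steps below it, two for each nested
  pair. Membership induction on \<open>below P 4\<close> reaches that far; the depth is an external
  number, so this predicate is again definable.\<close>

lemma subcode_induct:
  assumes P: "expressible False (\<lambda>e. P (e 0))"
    and step: "\<And>x. (\<And>y. subcode y x \<Longrightarrow> P y) \<Longrightarrow> P x"
  shows "P x"
proof -
  have "below P 4 x"
  proof (rule mem_induct[OF expr_below[OF P]])
    fix x assume IH: "\<And>y. y \<^bold>\<in> x \<Longrightarrow> below P 4 y"
    have 1: "below P 3 y" if "x = vpair k y" for k y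
      using IH[of "vupair k y"] that by (simp add: vpair_def numeral_eq_Suc)
    have 2: "below P 1 y \<and> below P 1 z" if "x = vpair k (vpair y z)" for k y z
      using 1[OF that] by (simp add: vpair_def numeral_eq_Suc)
    have 3: "P y" if "x = vpair k z" "y \<^bold>\<in> z" for k y z
      using 1[OF that(1)] that(2) by (simp add: numeral_eq_Suc)
    have 4: "P y" if "x = vpair k y" for k y using 1[OF that] by (simp add: numeral_eq_Suc)
    have 5: "P y \<and> P z" if "x = vpair k (vpair y z)" for k y z using 2[OF that] by simp
    have "P x"
    proof (rule step)
      show "P y" if "subcode y x" for y
        using that 3 4 5 unfolding subcode_def by blast
    qed
    moreover have "below P 3 y" if "y \<^bold>\<in> x" for y
      using IH[OF that] below_Suc[of P 3 y] by (simp add: numeral_eq_Suc)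
    ultimately show "below P 4 x" by (simp add: numeral_eq_Suc)
  qed
  then show ?thesis by (simp add: numeral_eq_Suc)
qed

lemma mem_irrefl: "\<not> x \<^bold>\<in> x"
  by (rule mem_induct[of "\<lambda>x. \<not> x \<^bold>\<in> x"]) (intro expr_not expr_mem proj_var, blast)

lemma union_A:
  assumes x: "x \<in> A"
  obtains z where "z \<in> A" "\<And>w. w \<^bold>\<in> z \<longleftrightarrow> (\<exists>y. y \<^bold>\<in> x \<and> w \<^bold>\<in> y)"
proof -
  obtain u where u: "u \<in> A" "\<forall>y\<in>A. y \<^bold>\<in> x \<longrightarrow> (\<forall>w\<in>A. w \<^bold>\<in> y \<longrightarrow> w \<^bold>\<in> u)"
    using KP_relativized[unfolded KP_in_def, THEN conjunct22, THEN conjunct1] x by blast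
  have "expressible True (\<lambda>e. \<exists>y. y \<^bold>\<in> x \<and> e 0 \<^bold>\<in> y)"
    by (rule expr_intros univ_A x)+
  then obtain z where z: "z \<in> A" "\<And>w. w \<^bold>\<in> z \<longleftrightarrow> w \<^bold>\<in> u \<and> (\<exists>y. y \<^bold>\<in> x \<and> w \<^bold>\<in> y)"
    using separation_A[OF _ u(1), of "\<lambda>w. \<exists>y. y \<^bold>\<in> x \<and> w \<^bold>\<in> y"] by blast
  show ?thesis by (rule that[OF z(1)]) (use z(2) u(2) x A_transitive in blast)
qed

lemma insert_A:
  assumes "w \<in> A" "x \<in> A"
  obtains z where "z \<in> A" "\<And>y. y \<^bold>\<in> z \<longleftrightarrow> y \<^bold>\<in> w \<or> y = x"
proof -
  have "vupair w (vupair x x) \<in> A" using assms by simp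
  from union_A[OF this] obtain z where "z \<in> A"
    "\<And>y. y \<^bold>\<in> z \<longleftrightarrow> (\<exists>v. v \<^bold>\<in> vupair w (vupair x x) \<and> y \<^bold>\<in> v)" by blast
  then show ?thesis by (intro that[of z]) auto
qed

lemma vpair_field_A:
  assumes w: "w \<in> A"
  obtains u where "u \<in> A" "\<And>x y. vpair x y \<^bold>\<in> w \<Longrightarrow> x \<^bold>\<in> u \<and> y \<^bold>\<in> u"
proof -
  obtain c where c: "c \<in> A" "\<And>x. x \<^bold>\<in> c \<longleftrightarrow> (\<exists>y. y \<^bold>\<in> w \<and> x \<^bold>\<in> y)" using union_A[OF w] by blast
  obtain u where u: "u \<in> A" "\<And>x. x \<^bold>\<in> u \<longleftrightarrow> (\<exists>y. y \<^bold>\<in> c \<and> x \<^bold>\<in> y)" using union_A[OF c(1)] by blast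
  have "x \<^bold>\<in> u \<and> y \<^bold>\<in> u" if "vpair x y \<^bold>\<in> w" for x y
  proof -
    have "vupair x y \<^bold>\<in> c" unfolding c(2) using that by (intro exI[of _ "vpair x y"]) (simp add: vpair_def)
    then show ?thesis unfolding u(2) by (intro conjI exI[of _ "vupair x y"]) simp_all
  qed
  then show ?thesis using that u(1) by blast
qed

definition transitive :: "'v \<Rightarrow> bool" where
  "transitive u \<longleftrightarrow> (\<forall>y. y \<^bold>\<in> u \<longrightarrow> (\<forall>z. z \<^bold>\<in> y \<longrightarrow> z \<^bold>\<in> u))"

lemma transitiveD: "transitive u \<Longrightarrow> y \<^bold>\<in> u \<Longrightarrow> z \<^bold>\<in> y \<Longrightarrow> z \<^bold>\<in> u"
  unfolding transitive_def by blast

lemma transitive_vpair: "transitive u \<Longrightarrow> vpair x y \<^bold>\<in> u \<Longrightarrow> x \<^bold>\<in> u \<and> y \<^bold>\<in> u"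
  unfolding vpair_def by (metis transitiveD mem_vupair)

text \<open>Such sets supply fresh variables: every index occurring in a formula that belongs to
  \<open>u\<close> is an element of \<open>u\<close>, while \<open>u\<close> itself is not.\<close>

lemma transitive_superset:
  assumes "x \<in> A"
  shows "\<exists>u\<in>A. transitive u \<and> x \<^bold>\<in> u"
proof -
  have tr: "expressible True (\<lambda>e. transitive (e (Suc 0)) \<and> e 0 \<^bold>\<in> e (Suc 0))"
    unfolding transitive_def by (rule expr_intros)+
  have "x \<in> A \<longrightarrow> (\<exists>u. u \<in> A \<and> transitive u \<and> x \<^bold>\<in> u)"
  proof (rule mem_induct[of "\<lambda>x. x \<in> A \<longrightarrow> (\<exists>u. u \<in> A \<and> transitive u \<and> x \<^bold>\<in> u)"])
    show "expressible False (\<lambda>e. e 0 \<in> A \<longrightarrow> (\<exists>u. u \<in> A \<and> transitive u \<and> e 0 \<^bold>\<in> u))"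
      unfolding transitive_def by (rule expr_intros expr_in_A expr_ex)+
    fix x assume IH: "\<And>y. y \<^bold>\<in> x \<Longrightarrow> y \<in> A \<longrightarrow> (\<exists>u. u \<in> A \<and> transitive u \<and> y \<^bold>\<in> u)"
    show "x \<in> A \<longrightarrow> (\<exists>u. u \<in> A \<and> transitive u \<and> x \<^bold>\<in> u)"
    proof
      assume x: "x \<in> A"
      obtain b where b: "b \<in> A" "\<And>y. y \<^bold>\<in> x \<Longrightarrow> \<exists>u. u \<^bold>\<in> b \<and> (transitive u \<and> y \<^bold>\<in> u)"
      proof (rule collection_A[of "\<lambda>y u. transitive u \<and> y \<^bold>\<in> u" x])
        show "expressible True (\<lambda>e. transitive (e 1) \<and> e 0 \<^bold>\<in> e 1)" using tr by simp
        show "\<exists>u\<in>A. transitive u \<and> y \<^bold>\<in> u" if "y \<^bold>\<in> x" for y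
          using IH[OF that] A_transitive[OF x that] by blast
      qed (use x in blast)+
      obtain c where c: "c \<in> A" "\<And>w. w \<^bold>\<in> c \<longleftrightarrow> (\<exists>y. y \<^bold>\<in> b \<and> w \<^bold>\<in> y)"
        using union_A[OF b(1)] by blast
      \<comment> \<open>Collection may have put other sets into \<open>b\<close>; the union is taken
        over its transitive members only.\<close>
      have "expressible True (\<lambda>e. \<exists>u. u \<^bold>\<in> b \<and> transitive u \<and> e 0 \<^bold>\<in> u)"
        unfolding transitive_def by (rule expr_intros univ_A b)+
      then obtain f where f: "f \<in> A" "\<And>z. z \<^bold>\<in> f \<longleftrightarrow> z \<^bold>\<in> c \<and> (\<exists>u. u \<^bold>\<in> b \<and> transitive u \<and> z \<^bold>\<in> u)"
        using separation_A[OF _ c(1), of "\<lambda>z. \<exists>u. u \<^bold>\<in> b \<and> transitive u \<and> z \<^bold>\<in> u"] by blast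
      obtain g where g: "g \<in> A" "\<And>y. y \<^bold>\<in> g \<longleftrightarrow> y \<^bold>\<in> f \<or> y = x"
        using insert_A[OF f(1) x] by blast
      have "transitive g"
        unfolding transitive_def g(2) f(2) c(2) using transitiveD b(2) by blast
      then show "\<exists>u. u \<in> A \<and> transitive u \<and> x \<^bold>\<in> u" using g by blast
    qed
  qed
  then show ?thesis using assms by blast
qed

section \<open>Syntax\<close>

declare tag.simps [simp del]

lemmas code_defs = Var_def Const_def EQ_def IN_def NOT_def IMP_def ALL'_def EX'_def AND_def OR_def

lemma code_inject [simp]:
  "Var a = Var b \<longleftrightarrow> a = b" "Const a = Const b \<longleftrightarrow> a = b" "Const a \<noteq> Var b" "Var b \<noteq> Const a"
  "EQ s t = EQ s' t' \<longleftrightarrow> s = s' \<and> t = t'" "IN s t = IN s' t' \<longleftrightarrow> s = s' \<and> t = t'"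
  "NOT \<phi> = NOT \<phi>' \<longleftrightarrow> \<phi> = \<phi>'" "IMP \<phi> \<psi> = IMP \<phi>' \<psi>' \<longleftrightarrow> \<phi> = \<phi>' \<and> \<psi> = \<psi>'"
  "ALL' a \<phi> = ALL' b \<psi> \<longleftrightarrow> a = b \<and> \<phi> = \<psi>" "EX' a \<phi> = EX' b \<psi> \<longleftrightarrow> a = b \<and> \<phi> = \<psi>"
  "AND \<Phi> = AND \<Psi> \<longleftrightarrow> \<Phi> = \<Psi>" "OR \<Phi> = OR \<Psi> \<longleftrightarrow> \<Phi> = \<Psi>"
  by (simp_all add: code_defs)

lemma code_A [simp]:
  "Var a \<in> A \<longleftrightarrow> a \<in> A" "Const a \<in> A \<longleftrightarrow> a \<in> A"
  "EQ s t \<in> A \<longleftrightarrow> s \<in> A \<and> t \<in> A" "IN s t \<in> A \<longleftrightarrow> s \<in> A \<and> t \<in> A"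
  "NOT \<phi> \<in> A \<longleftrightarrow> \<phi> \<in> A" "IMP \<phi> \<psi> \<in> A \<longleftrightarrow> \<phi> \<in> A \<and> \<psi> \<in> A"
  "ALL' a \<phi> \<in> A \<longleftrightarrow> a \<in> A \<and> \<phi> \<in> A" "EX' a \<phi> \<in> A \<longleftrightarrow> a \<in> A \<and> \<phi> \<in> A"
  "AND \<Phi> \<in> A \<longleftrightarrow> \<Phi> \<in> A" "OR \<Phi> \<in> A \<longleftrightarrow> \<Phi> \<in> A"
  by (auto simp add: code_defs tag_A)

lemma Terms_A: "t \<in> Terms \<Longrightarrow> t \<in> A"
  by (auto simp: Terms_def)

lemma Var_Terms [simp]: "Var a \<in> Terms \<longleftrightarrow> a \<in> A"
  by (auto simp: Terms_def)

lemma Const_Terms [simp]: "Const a \<in> Terms \<longleftrightarrow> a \<in> A"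
  by (auto simp: Terms_def)

definition fm_closed :: "'v set \<Rightarrow> bool" where
  "fm_closed C \<longleftrightarrow> Atomic \<subseteq> C \<and>
     (\<forall>\<phi>\<in>C. NOT \<phi> \<in> C) \<and>
     (\<forall>\<phi>\<in>C. \<forall>\<psi>\<in>C. IMP \<phi> \<psi> \<in> C) \<and>
     (\<forall>a\<in>A. \<forall>\<phi>\<in>C. ALL' a \<phi> \<in> C \<and> EX' a \<phi> \<in> C) \<and>
     (\<forall>\<Phi>\<in>A. (\<forall>\<phi>. \<phi> \<^bold>\<in> \<Phi> \<longrightarrow> \<phi> \<in> C) \<longrightarrow> AND \<Phi> \<in> C \<and> OR \<Phi> \<in> C)"

lemma Formulas_iff: "\<phi> \<in> Formulas \<longleftrightarrow> (\<forall>C. definable_class C \<longrightarrow> fm_closed C \<longrightarrow> \<phi> \<in> C)"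
  unfolding Formulas_def least_class_def fm_closed_def by blast

lemma Formulas_closed: "fm_closed Formulas"
  unfolding fm_closed_def[of Formulas] subset_iff Ball_def Formulas_iff
  by (simp add: fm_closed_def subset_iff)

lemma Formulas_intros:
  "s \<in> Terms \<Longrightarrow> t \<in> Terms \<Longrightarrow> EQ s t \<in> Formulas"
  "s \<in> Terms \<Longrightarrow> t \<in> Terms \<Longrightarrow> IN s t \<in> Formulas"
  "\<phi> \<in> Formulas \<Longrightarrow> NOT \<phi> \<in> Formulas"
  "\<phi> \<in> Formulas \<Longrightarrow> \<psi> \<in> Formulas \<Longrightarrow> IMP \<phi> \<psi> \<in> Formulas"
  "a \<in> A \<Longrightarrow> \<phi> \<in> Formulas \<Longrightarrow> ALL' a \<phi> \<in> Formulas"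
  "a \<in> A \<Longrightarrow> \<phi> \<in> Formulas \<Longrightarrow> EX' a \<phi> \<in> Formulas"
  "\<Phi> \<in> A \<Longrightarrow> (\<And>\<phi>. \<phi> \<^bold>\<in> \<Phi> \<Longrightarrow> \<phi> \<in> Formulas) \<Longrightarrow> AND \<Phi> \<in> Formulas"
  "\<Phi> \<in> A \<Longrightarrow> (\<And>\<phi>. \<phi> \<^bold>\<in> \<Phi> \<Longrightarrow> \<phi> \<in> Formulas) \<Longrightarrow> OR \<Phi> \<in> Formulas"
  using Formulas_closed unfolding fm_closed_def Atomic_def by blast+

lemma Formulas_induct:
  assumes "\<phi> \<in> Formulas" "expressible False (\<lambda>e. P (e 0))"
    and "\<And>s t. s \<in> Terms \<Longrightarrow> t \<in> Terms \<Longrightarrow> P (EQ s t) \<and> P (IN s t)"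
    and "\<And>\<phi>. P \<phi> \<Longrightarrow> P (NOT \<phi>)"
    and "\<And>\<phi> \<psi>. P \<phi> \<Longrightarrow> P \<psi> \<Longrightarrow> P (IMP \<phi> \<psi>)"
    and "\<And>a \<phi>. a \<in> A \<Longrightarrow> P \<phi> \<Longrightarrow> P (ALL' a \<phi>) \<and> P (EX' a \<phi>)"
    and "\<And>\<Phi>. \<Phi> \<in> A \<Longrightarrow> (\<And>\<phi>. \<phi> \<^bold>\<in> \<Phi> \<Longrightarrow> P \<phi>) \<Longrightarrow> P (AND \<Phi>) \<and> P (OR \<Phi>)"
  shows "P \<phi>"
proof -
  have "fm_closed {x. P x}"
    unfolding fm_closed_def Atomic_def using assms(3-) by auto
  then show ?thesis
    using assms(1) definable_classI[OF assms(2)] unfolding Formulas_iff by blast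
qed

lemma Formulas_A: "\<phi> \<in> Formulas \<Longrightarrow> \<phi> \<in> A"
  by (erule Formulas_induct[where P = "\<lambda>x. x \<in> A"]) (auto simp: expr_inA Terms_A)

lemma Formulas_more:
  assumes "\<phi> \<in> Formulas" "\<psi> \<in> Formulas"
  shows "AND2 \<phi> \<psi> \<in> Formulas" "OR2 \<phi> \<psi> \<in> Formulas" "IFF \<phi> \<psi> \<in> Formulas"
  using assms Formulas_A unfolding AND2_def OR2_def IFF_def
  by (auto intro!: Formulas_intros)

lemma BALL_Formulas:
  "\<phi> \<in> Formulas \<Longrightarrow> a \<in> A \<Longrightarrow> t \<in> Terms \<Longrightarrow> BALL a t \<phi> \<in> Formulas"
  unfolding BALL_def by (intro Formulas_intros) auto

lemmas Formulas_rules = Formulas_intros(1-6) Formulas_more BALL_Formulas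

lemma Sigma_intros:
  "s \<in> Terms \<Longrightarrow> t \<in> Terms \<Longrightarrow> EQ s t \<in> Sigma_formulas"
  "s \<in> Terms \<Longrightarrow> t \<in> Terms \<Longrightarrow> IN s t \<in> Sigma_formulas"
  "\<phi> \<in> Sigma_formulas \<Longrightarrow> \<psi> \<in> Sigma_formulas \<Longrightarrow> \<phi> \<in> A \<Longrightarrow> \<psi> \<in> A \<Longrightarrow> AND2 \<phi> \<psi> \<in> Sigma_formulas"
  "\<phi> \<in> Sigma_formulas \<Longrightarrow> \<psi> \<in> Sigma_formulas \<Longrightarrow> \<phi> \<in> A \<Longrightarrow> \<psi> \<in> A \<Longrightarrow> OR2 \<phi> \<psi> \<in> Sigma_formulas"
  "a \<in> A \<Longrightarrow> t \<in> Terms \<Longrightarrow> t \<noteq> Var a \<Longrightarrow> \<phi> \<in> Sigma_formulas \<Longrightarrow> BALL a t \<phi> \<in> Sigma_formulas"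
  "a \<in> A \<Longrightarrow> \<phi> \<in> Sigma_formulas \<Longrightarrow> EX' a \<phi> \<in> Sigma_formulas"
  unfolding Sigma_formulas_def least_class_def AND2_def OR2_def Atomic_def
  by (auto simp: subset_iff)

section \<open>Free variables\<close>

definition hf_closed :: "'v \<Rightarrow> 'v set \<Rightarrow> bool" where
  "hf_closed a C \<longleftrightarrow>
     (\<forall>s\<in>Terms. \<forall>t\<in>Terms. s = Var a \<or> t = Var a \<longrightarrow> EQ s t \<in> C \<and> IN s t \<in> C) \<and>
     (\<forall>\<phi>\<in>C. NOT \<phi> \<in> C) \<and>
     (\<forall>\<phi>\<in>Formulas. \<forall>\<psi>\<in>Formulas. \<phi> \<in> C \<or> \<psi> \<in> C \<longrightarrow> IMP \<phi> \<psi> \<in> C) \<and>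
     (\<forall>b\<in>A. \<forall>\<phi>\<in>C. b \<noteq> a \<longrightarrow> ALL' b \<phi> \<in> C \<and> EX' b \<phi> \<in> C) \<and>
     (\<forall>\<Phi>\<in>A. (\<forall>\<phi>. \<phi> \<^bold>\<in> \<Phi> \<longrightarrow> \<phi> \<in> Formulas) \<and> (\<exists>\<phi>\<in>C. \<phi> \<^bold>\<in> \<Phi>) \<longrightarrow> AND \<Phi> \<in> C \<and> OR \<Phi> \<in> C)"

lemma hf_closedD:
  assumes "hf_closed a C"
  shows "s \<in> Terms \<Longrightarrow> t \<in> Terms \<Longrightarrow> s = Var a \<or> t = Var a \<Longrightarrow> EQ s t \<in> C"
    "s \<in> Terms \<Longrightarrow> t \<in> Terms \<Longrightarrow> s = Var a \<or> t = Var a \<Longrightarrow> IN s t \<in> C"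
    "\<phi> \<in> C \<Longrightarrow> NOT \<phi> \<in> C"
    "\<phi> \<in> Formulas \<Longrightarrow> \<psi> \<in> Formulas \<Longrightarrow> \<phi> \<in> C \<or> \<psi> \<in> C \<Longrightarrow> IMP \<phi> \<psi> \<in> C"
    "b \<in> A \<Longrightarrow> \<phi> \<in> C \<Longrightarrow> b \<noteq> a \<Longrightarrow> ALL' b \<phi> \<in> C"
    "b \<in> A \<Longrightarrow> \<phi> \<in> C \<Longrightarrow> b \<noteq> a \<Longrightarrow> EX' b \<phi> \<in> C"
    "\<Phi> \<in> A \<Longrightarrow> (\<And>\<phi>. \<phi> \<^bold>\<in> \<Phi> \<Longrightarrow> \<phi> \<in> Formulas) \<Longrightarrow> \<phi> \<in> C \<Longrightarrow> \<phi> \<^bold>\<in> \<Phi> \<Longrightarrow> AND \<Phi> \<in> C"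
    "\<Phi> \<in> A \<Longrightarrow> (\<And>\<phi>. \<phi> \<^bold>\<in> \<Phi> \<Longrightarrow> \<phi> \<in> Formulas) \<Longrightarrow> \<phi> \<in> C \<Longrightarrow> \<phi> \<^bold>\<in> \<Phi> \<Longrightarrow> OR \<Phi> \<in> C"
  using assms unfolding hf_closed_def by auto

lemma not_free_iff:
  "\<phi> \<notin> Has_free a \<longleftrightarrow> (\<exists>C. definable_class C \<and> hf_closed a C \<and> \<phi> \<notin> C)"
  unfolding Has_free_def least_class_def hf_closed_def by blast

text \<open>\<open>N\<close> plays the role of the complement of a class closed under the clauses for \<open>Has_free a\<close>.\<close>

lemma not_freeI:
  assumes N: "N \<phi>" "expressible False (\<lambda>e. N (e 0))"
    and "\<And>s t. s \<in> Terms \<Longrightarrow> t \<in> Terms \<Longrightarrow> N (EQ s t) \<or> N (IN s t) \<Longrightarrow> s \<noteq> Var a \<and> t \<noteq> Var a"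
    and "\<And>\<phi>. N (NOT \<phi>) \<Longrightarrow> N \<phi>"
    and "\<And>\<phi> \<psi>. \<phi> \<in> Formulas \<Longrightarrow> \<psi> \<in> Formulas \<Longrightarrow> N (IMP \<phi> \<psi>) \<Longrightarrow> N \<phi> \<and> N \<psi>"
    and "\<And>b \<phi>. b \<in> A \<Longrightarrow> b \<noteq> a \<Longrightarrow> N (ALL' b \<phi>) \<or> N (EX' b \<phi>) \<Longrightarrow> N \<phi>"
    and "\<And>\<Phi> \<phi>. \<Phi> \<in> A \<Longrightarrow> (\<And>\<phi>. \<phi> \<^bold>\<in> \<Phi> \<Longrightarrow> \<phi> \<in> Formulas) \<Longrightarrow> N (AND \<Phi>) \<or> N (OR \<Phi>) \<Longrightarrow> \<phi> \<^bold>\<in> \<Phi> \<Longrightarrow> N \<phi>"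
  shows "\<phi> \<notin> Has_free a"
  unfolding not_free_iff
proof (intro exI conjI)
  show "definable_class {x. \<not> N x}" by (rule definable_classI[OF expr_not[OF N(2)]])
  show "hf_closed a {x. \<not> N x}"
    unfolding hf_closed_def mem_Collect_eq Ball_def Bex_def using assms(3-) by blast
qed (use N in simp)

text \<open>One argument for all constructors. The complements of two closed classes that avoid
  \<phi> and \<psi> are inherited by subformulas; adding the single code x keeps this true, since
  the immediate subformulas of x are among \<phi> and \<psi>.\<close>

lemma not_free_compound:
  assumes nf: "\<phi> \<notin> Has_free a" "\<psi> \<notin> Has_free a"
    and x: "\<And>s t. x = EQ s t \<or> x = IN s t \<Longrightarrow> s \<noteq> Var a \<and> t \<noteq> Var a"
      "\<And>\<theta>. x = NOT \<theta> \<Longrightarrow> \<theta> = \<phi> \<or> \<theta> = \<psi>"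
      "\<And>\<theta> \<eta>. x = IMP \<theta> \<eta> \<Longrightarrow> (\<theta> = \<phi> \<or> \<theta> = \<psi>) \<and> (\<eta> = \<phi> \<or> \<eta> = \<psi>)"
      "\<And>b \<theta>. b \<noteq> a \<Longrightarrow> x = ALL' b \<theta> \<or> x = EX' b \<theta> \<Longrightarrow> \<theta> = \<phi> \<or> \<theta> = \<psi>"
      "\<And>\<Phi> \<theta>. x = AND \<Phi> \<or> x = OR \<Phi> \<Longrightarrow> \<theta> \<^bold>\<in> \<Phi> \<Longrightarrow> \<theta> = \<phi> \<or> \<theta> = \<psi>"
  shows "x \<notin> Has_free a"
proof -
  obtain C where C: "definable_class C" "hf_closed a C" "\<phi> \<notin> C"
    using nf(1) unfolding not_free_iff by blast
  obtain D where D: "definable_class D" "hf_closed a D" "\<psi> \<notin> D"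
    using nf(2) unfolding not_free_iff by blast
  note c = hf_closedD[OF C(2)] and d = hf_closedD[OF D(2)]
  let ?N = "\<lambda>y. y \<notin> C \<or> y \<notin> D \<or> y = x"
  have N: "?N \<phi>" "?N \<psi>" using C(3) D(3) by simp_all
  show ?thesis
  proof (rule not_freeI[of ?N])
    show "expressible False (\<lambda>e. e 0 \<notin> C \<or> e 0 \<notin> D \<or> e 0 = x)"
      by (rule expr_class[OF C(1)] expr_class[OF D(1)] expr_intros)+
    show "s \<noteq> Var a \<and> t \<noteq> Var a" if "s \<in> Terms" "t \<in> Terms" "?N (EQ s t) \<or> ?N (IN s t)" for s t
      using that x(1)[of s t] c(1,2)[of s t] d(1,2)[of s t] by blast
    show "?N \<theta>" if "?N (NOT \<theta>)" for \<theta>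
      using that x(2)[of \<theta>] c(3)[of \<theta>] d(3)[of \<theta>] N by blast
    show "?N \<theta> \<and> ?N \<eta>" if "\<theta> \<in> Formulas" "\<eta> \<in> Formulas" "?N (IMP \<theta> \<eta>)" for \<theta> \<eta>
      using that x(3)[of \<theta> \<eta>] c(4)[of \<theta> \<eta>] d(4)[of \<theta> \<eta>] N by blast
    show "?N \<theta>" if "b \<in> A" "b \<noteq> a" "?N (ALL' b \<theta>) \<or> ?N (EX' b \<theta>)" for b \<theta>
      using that x(4)[of b \<theta>] c(5,6)[of b \<theta>] d(5,6)[of b \<theta>] N by blast
    show "?N \<theta>" if "\<Phi> \<in> A" "\<And>\<phi>. \<phi> \<^bold>\<in> \<Phi> \<Longrightarrow> \<phi> \<in> Formulas" "?N (AND \<Phi>) \<or> ?N (OR \<Phi>)" "\<theta> \<^bold>\<in> \<Phi>" for \<Phi> \<theta>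
      using that(3,4) x(5)[of \<Phi> \<theta>] c(7,8)[OF that(1,2), of \<theta>] d(7,8)[OF that(1,2), of \<theta>] N by blast
  qed simp
qed

lemma not_free_atomic:
  assumes "s \<noteq> Var a" "t \<noteq> Var a"
  shows "EQ s t \<notin> Has_free a" "IN s t \<notin> Has_free a"
proof -
  show "EQ s t \<notin> Has_free a"
    by (rule not_freeI[of "\<lambda>y. y = EQ s t"], simp, (rule expr_intros)+) (use assms in \<open>auto simp: code_defs\<close>)
  show "IN s t \<notin> Has_free a"
    by (rule not_freeI[of "\<lambda>y. y = IN s t"], simp, (rule expr_intros)+) (use assms in \<open>auto simp: code_defs\<close>)
qed

lemma not_free_bound: "ALL' a \<phi> \<notin> Has_free a" "EX' a \<phi> \<notin> Has_free a"
proof -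
  show "ALL' a \<phi> \<notin> Has_free a"
    by (rule not_freeI[of "\<lambda>y. y = ALL' a \<phi>"], simp, (rule expr_intros)+) (auto simp: code_defs)
  show "EX' a \<phi> \<notin> Has_free a"
    by (rule not_freeI[of "\<lambda>y. y = EX' a \<phi>"], simp, (rule expr_intros)+) (auto simp: code_defs)
qed

lemma not_free_intros:
  assumes "\<phi> \<notin> Has_free a"
  shows "NOT \<phi> \<notin> Has_free a" "ALL' b \<phi> \<notin> Has_free a" "EX' b \<phi> \<notin> Has_free a"
    "\<psi> \<notin> Has_free a \<Longrightarrow> IMP \<phi> \<psi> \<notin> Has_free a"
    "\<psi> \<notin> Has_free a \<Longrightarrow> AND2 \<phi> \<psi> \<notin> Has_free a"
    "\<psi> \<notin> Has_free a \<Longrightarrow> OR2 \<phi> \<psi> \<notin> Has_free a"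
proof -
  show "NOT \<phi> \<notin> Has_free a" "ALL' b \<phi> \<notin> Has_free a" "EX' b \<phi> \<notin> Has_free a"
    by (rule not_free_compound[OF assms assms]; auto simp: code_defs)+
  show "IMP \<phi> \<psi> \<notin> Has_free a" "AND2 \<phi> \<psi> \<notin> Has_free a" "OR2 \<phi> \<psi> \<notin> Has_free a" if "\<psi> \<notin> Has_free a"
    by (rule not_free_compound[OF assms that]; auto simp: code_defs AND2_def OR2_def)+
qed

lemma not_free_IFF:
  "\<phi> \<notin> Has_free a \<Longrightarrow> \<psi> \<notin> Has_free a \<Longrightarrow> IFF \<phi> \<psi> \<notin> Has_free a"
  unfolding IFF_def by (intro not_free_intros)

text \<open>Membership in \<open>u\<close> is inherited by all constituents of a code, including the
  indices of its variables, so \<open>Var a\<close> cannot occur in \<phi> at all.\<close>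

lemma not_free_fresh:
  assumes "transitive u" "\<phi> \<^bold>\<in> u" "\<not> a \<^bold>\<in> u"
  shows "\<phi> \<notin> Has_free a"
proof (rule not_freeI[of "\<lambda>y. y \<^bold>\<in> u", OF assms(2)])
  show "expressible False (\<lambda>e. e 0 \<^bold>\<in> u)" by (rule expr_intros)+
next
  note pair = transitive_vpair[OF assms(1)]
  show "s \<noteq> Var a \<and> t \<noteq> Var a" if "EQ s t \<^bold>\<in> u \<or> IN s t \<^bold>\<in> u" for s t
    using that pair assms(3) unfolding code_defs by blast
  show "\<theta> \<^bold>\<in> u" if "NOT \<theta> \<^bold>\<in> u" for \<theta>
    using that pair unfolding code_defs by blast
  show "\<theta> \<^bold>\<in> u \<and> \<eta> \<^bold>\<in> u" if "IMP \<theta> \<eta> \<^bold>\<in> u" for \<theta> \<eta>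
    using that pair unfolding code_defs by blast
  show "\<theta> \<^bold>\<in> u" if "ALL' b \<theta> \<^bold>\<in> u \<or> EX' b \<theta> \<^bold>\<in> u" for b \<theta>
    using that pair unfolding code_defs by blast
  show "\<theta> \<^bold>\<in> u" if "AND \<Phi> \<^bold>\<in> u \<or> OR \<Phi> \<^bold>\<in> u" "\<theta> \<^bold>\<in> \<Phi>" for \<Phi> \<theta>
    using that pair transitiveD[OF assms(1)] unfolding code_defs by blast
qed

section \<open>The substitution relation\<close>

definition sbt :: "'v \<Rightarrow> 'v \<Rightarrow> 'v \<Rightarrow> 'v" where
  "sbt a t s = (if s = Var a then t else s)"

lemma sbt_simps [simp]: "sbt a t (Var a) = t" "b \<noteq> a \<Longrightarrow> sbt a t (Var b) = Var b"
  "sbt a t (Const c) = Const c" "s \<noteq> Var a \<Longrightarrow> sbt a t s = s" "sbt a (Var a) s = s"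
  by (auto simp: sbt_def)

definition subst_closed :: "'v \<Rightarrow> 'v \<Rightarrow> ('v \<times> 'v) set \<Rightarrow> bool" where
  "subst_closed a t R \<longleftrightarrow>
     (\<forall>s\<in>Terms. \<forall>s'\<in>Terms.
        (EQ s s', EQ (sbt a t s) (sbt a t s')) \<in> R \<and> (IN s s', IN (sbt a t s) (sbt a t s')) \<in> R) \<and>
     (\<forall>\<phi> \<phi>'. (\<phi>, \<phi>') \<in> R \<longrightarrow> (NOT \<phi>, NOT \<phi>') \<in> R) \<and>
     (\<forall>\<phi> \<phi>' \<psi> \<psi>'. (\<phi>, \<phi>') \<in> R \<longrightarrow> (\<psi>, \<psi>') \<in> R \<longrightarrow> (IMP \<phi> \<psi>, IMP \<phi>' \<psi>') \<in> R) \<and>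
     (\<forall>\<phi>\<in>Formulas. (ALL' a \<phi>, ALL' a \<phi>) \<in> R \<and> (EX' a \<phi>, EX' a \<phi>) \<in> R) \<and>
     (\<forall>b\<in>A. \<forall>\<phi> \<phi>'. (\<phi>, \<phi>') \<in> R \<longrightarrow> b \<noteq> a \<and> (t \<noteq> Var b \<or> \<phi> \<notin> Has_free a) \<longrightarrow>
        (ALL' b \<phi>, ALL' b \<phi>') \<in> R \<and> (EX' b \<phi>, EX' b \<phi>') \<in> R) \<and>
     (\<forall>\<Phi>\<in>A. \<forall>\<Phi>'\<in>A.
        (\<forall>\<phi>. \<phi> \<^bold>\<in> \<Phi> \<longrightarrow> (\<exists>\<phi>'. \<phi>' \<^bold>\<in> \<Phi>' \<and> (\<phi>, \<phi>') \<in> R)) \<and>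
        (\<forall>\<phi>'. \<phi>' \<^bold>\<in> \<Phi>' \<longrightarrow> (\<exists>\<phi>. \<phi> \<^bold>\<in> \<Phi> \<and> (\<phi>, \<phi>') \<in> R)) \<longrightarrow>
        (AND \<Phi>, AND \<Phi>') \<in> R \<and> (OR \<Phi>, OR \<Phi>') \<in> R)"

lemma Subst_eq: "Subst a t = \<Inter>{R. definable_rel R \<and> subst_closed a t R}"
  by (simp add: Subst_def least_rel_def subst_closed_def Let_def sbt_def Ball_def)

lemma Subst_iff:
  "p \<in> Subst a t \<longleftrightarrow> (\<forall>R. definable_rel R \<longrightarrow> subst_closed a t R \<longrightarrow> p \<in> R)"
  unfolding Subst_eq by blast

lemma subst_closedD:
  assumes "subst_closed a t R"
  shows
  "s \<in> Terms \<Longrightarrow> s' \<in> Terms \<Longrightarrow> (EQ s s', EQ (sbt a t s) (sbt a t s')) \<in> R"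
  "s \<in> Terms \<Longrightarrow> s' \<in> Terms \<Longrightarrow> (IN s s', IN (sbt a t s) (sbt a t s')) \<in> R"
  "(\<phi>, \<phi>') \<in> R \<Longrightarrow> (NOT \<phi>, NOT \<phi>') \<in> R"
  "(\<phi>, \<phi>') \<in> R \<Longrightarrow> (\<psi>, \<psi>') \<in> R \<Longrightarrow> (IMP \<phi> \<psi>, IMP \<phi>' \<psi>') \<in> R"
  "\<phi> \<in> Formulas \<Longrightarrow> (ALL' a \<phi>, ALL' a \<phi>) \<in> R"
  "\<phi> \<in> Formulas \<Longrightarrow> (EX' a \<phi>, EX' a \<phi>) \<in> R"
  "(\<phi>, \<phi>') \<in> R \<Longrightarrow> b \<in> A \<Longrightarrow> b \<noteq> a \<Longrightarrow> t \<noteq> Var b \<Longrightarrow> (ALL' b \<phi>, ALL' b \<phi>') \<in> R"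
  "(\<phi>, \<phi>') \<in> R \<Longrightarrow> b \<in> A \<Longrightarrow> b \<noteq> a \<Longrightarrow> t \<noteq> Var b \<Longrightarrow> (EX' b \<phi>, EX' b \<phi>') \<in> R"
  "\<Phi> \<in> A \<Longrightarrow> \<Phi>' \<in> A \<Longrightarrow> (\<And>\<phi>. \<phi> \<^bold>\<in> \<Phi> \<Longrightarrow> \<exists>\<phi>'. \<phi>' \<^bold>\<in> \<Phi>' \<and> (\<phi>, \<phi>') \<in> R) \<Longrightarrow>
     (\<And>\<phi>'. \<phi>' \<^bold>\<in> \<Phi>' \<Longrightarrow> \<exists>\<phi>. \<phi> \<^bold>\<in> \<Phi> \<and> (\<phi>, \<phi>') \<in> R) \<Longrightarrow> (AND \<Phi>, AND \<Phi>') \<in> R"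
  "\<Phi> \<in> A \<Longrightarrow> \<Phi>' \<in> A \<Longrightarrow> (\<And>\<phi>. \<phi> \<^bold>\<in> \<Phi> \<Longrightarrow> \<exists>\<phi>'. \<phi>' \<^bold>\<in> \<Phi>' \<and> (\<phi>, \<phi>') \<in> R) \<Longrightarrow>
     (\<And>\<phi>'. \<phi>' \<^bold>\<in> \<Phi>' \<Longrightarrow> \<exists>\<phi>. \<phi> \<^bold>\<in> \<Phi> \<and> (\<phi>, \<phi>') \<in> R) \<Longrightarrow> (OR \<Phi>, OR \<Phi>') \<in> R"
  by (use assms[unfolded subst_closed_def, THEN conjunct1, rule_format] in blast,
    use assms[unfolded subst_closed_def, THEN conjunct1, rule_format] in blast,
    use assms[unfolded subst_closed_def, THEN conjunct2, THEN conjunct1, rule_format] in blast,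
    use assms[unfolded subst_closed_def, THEN conjunct22, THEN conjunct1, rule_format] in blast,
    use assms[unfolded subst_closed_def, THEN conjunct22, THEN conjunct2, THEN conjunct1, rule_format] in blast,
    use assms[unfolded subst_closed_def, THEN conjunct22, THEN conjunct2, THEN conjunct1, rule_format] in blast,
    use assms[unfolded subst_closed_def, THEN conjunct22, THEN conjunct22, THEN conjunct1, rule_format] in blast,
    use assms[unfolded subst_closed_def, THEN conjunct22, THEN conjunct22, THEN conjunct1, rule_format] in blast,
    use assms[unfolded subst_closed_def, THEN conjunct22, THEN conjunct22, THEN conjunct2, rule_format] in blast,
    use assms[unfolded subst_closed_def, THEN conjunct22, THEN conjunct22, THEN conjunct2, rule_format] in blast)

text \<open>The inclusion granted to the premise allows pairs of \<open>Subst a t\<close> to be fed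
  into the closure rules of R, although \<open>Subst a t\<close> itself is not among the relations R
  quantifies over.\<close>

lemma Subst_I:
  assumes "\<And>R. definable_rel R \<Longrightarrow> subst_closed a t R \<Longrightarrow> Subst a t \<subseteq> R \<Longrightarrow> p \<in> R"
  shows "p \<in> Subst a t"
proof -
  have "Subst a t \<subseteq> R" if "definable_rel R" "subst_closed a t R" for R
    unfolding Subst_eq using that by (intro Inter_lower) simp
  then show ?thesis using assms by (subst Subst_iff) simp
qed

lemma Subst_intros:
  "s \<in> Terms \<Longrightarrow> s' \<in> Terms \<Longrightarrow> (EQ s s', EQ (sbt a t s) (sbt a t s')) \<in> Subst a t"
  "s \<in> Terms \<Longrightarrow> s' \<in> Terms \<Longrightarrow> (IN s s', IN (sbt a t s) (sbt a t s')) \<in> Subst a t"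
  "(\<phi>, \<phi>') \<in> Subst a t \<Longrightarrow> (NOT \<phi>, NOT \<phi>') \<in> Subst a t"
  "(\<phi>, \<phi>') \<in> Subst a t \<Longrightarrow> (\<psi>, \<psi>') \<in> Subst a t \<Longrightarrow> (IMP \<phi> \<psi>, IMP \<phi>' \<psi>') \<in> Subst a t"
  "\<phi> \<in> Formulas \<Longrightarrow> (ALL' a \<phi>, ALL' a \<phi>) \<in> Subst a t"
  "\<phi> \<in> Formulas \<Longrightarrow> (EX' a \<phi>, EX' a \<phi>) \<in> Subst a t"
  "(\<phi>, \<phi>') \<in> Subst a t \<Longrightarrow> b \<in> A \<Longrightarrow> b \<noteq> a \<Longrightarrow> t \<noteq> Var b \<Longrightarrow> (ALL' b \<phi>, ALL' b \<phi>') \<in> Subst a t"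
  "(\<phi>, \<phi>') \<in> Subst a t \<Longrightarrow> b \<in> A \<Longrightarrow> b \<noteq> a \<Longrightarrow> t \<noteq> Var b \<Longrightarrow> (EX' b \<phi>, EX' b \<phi>') \<in> Subst a t"
  "\<Phi> \<in> A \<Longrightarrow> \<Phi>' \<in> A \<Longrightarrow> (\<And>\<phi>. \<phi> \<^bold>\<in> \<Phi> \<Longrightarrow> \<exists>\<phi>'. \<phi>' \<^bold>\<in> \<Phi>' \<and> (\<phi>, \<phi>') \<in> Subst a t) \<Longrightarrow>
     (\<And>\<phi>'. \<phi>' \<^bold>\<in> \<Phi>' \<Longrightarrow> \<exists>\<phi>. \<phi> \<^bold>\<in> \<Phi> \<and> (\<phi>, \<phi>') \<in> Subst a t) \<Longrightarrow> (AND \<Phi>, AND \<Phi>') \<in> Subst a t"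
  "\<Phi> \<in> A \<Longrightarrow> \<Phi>' \<in> A \<Longrightarrow> (\<And>\<phi>. \<phi> \<^bold>\<in> \<Phi> \<Longrightarrow> \<exists>\<phi>'. \<phi>' \<^bold>\<in> \<Phi>' \<and> (\<phi>, \<phi>') \<in> Subst a t) \<Longrightarrow>
     (\<And>\<phi>'. \<phi>' \<^bold>\<in> \<Phi>' \<Longrightarrow> \<exists>\<phi>. \<phi> \<^bold>\<in> \<Phi> \<and> (\<phi>, \<phi>') \<in> Subst a t) \<Longrightarrow> (OR \<Phi>, OR \<Phi>') \<in> Subst a t"
  by (rule Subst_I, rule subst_closedD; blast)+

text \<open>For each definable class C closed under the formation rules, the relation holding
  between any two elements of C is closed under the clauses of substitution; matrices left unchanged
  are covered because C contains \<open>Formulas\<close>.\<close>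

lemma Subst_Formulas:
  assumes "(\<phi>, \<phi>') \<in> Subst a t" "a \<in> A" "t \<in> Terms"
  shows "\<phi> \<in> Formulas" "\<phi>' \<in> Formulas"
proof -
  have "\<phi> \<in> C \<and> \<phi>' \<in> C" if C: "definable_class C" "fm_closed C" for C
  proof -
    have FC: "Formulas \<subseteq> C" using C unfolding subset_iff Formulas_iff by blast
    have st: "sbt a t s \<in> Terms" if "s \<in> Terms" for s
      using that assms by (simp add: sbt_def)
    have "definable_rel {(x, y). x \<in> C \<and> y \<in> C}"
      by (rule definable_relI, (rule expr_class[OF C(1)] expr_intros)+)
    moreover have "subst_closed a t {(x, y). x \<in> C \<and> y \<in> C}"
      unfolding subst_closed_def
      using C(2)[unfolded fm_closed_def Atomic_def] FC Formulas_intros(5,6) assms(2) st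
      by (simp add: subset_iff Ball_def) (meson)
    ultimately show ?thesis using assms(1) unfolding Subst_iff by blast
  qed
  then show "\<phi> \<in> Formulas" "\<phi>' \<in> Formulas" unfolding Formulas_iff by blast+
qed

lemma Subst_AND2_OR2:
  assumes "(\<phi>, \<phi>') \<in> Subst a t" "(\<psi>, \<psi>') \<in> Subst a t" "a \<in> A" "t \<in> Terms"
  shows "(AND2 \<phi> \<psi>, AND2 \<phi>' \<psi>') \<in> Subst a t" "(OR2 \<phi> \<psi>, OR2 \<phi>' \<psi>') \<in> Subst a t"
proof -
  have "\<phi> \<in> A" "\<psi> \<in> A" "\<phi>' \<in> A" "\<psi>' \<in> A"
    using Subst_Formulas[OF assms(1,3,4)] Subst_Formulas[OF assms(2,3,4)] Formulas_A by blast+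
  then show "(AND2 \<phi> \<psi>, AND2 \<phi>' \<psi>') \<in> Subst a t" "(OR2 \<phi> \<psi>, OR2 \<phi>' \<psi>') \<in> Subst a t"
    unfolding AND2_def OR2_def using assms(1,2) by (auto intro!: Subst_intros(9,10))
qed

section \<open>Totality of substitution\<close>

text \<open>
  \<open>step v t S f W \<alpha> \<beta>\<close> is one clause of the substitution of \<open>t\<close> for \<open>Var v\<close>, with immediate subformulas
  related by \<open>W\<close>. Formulas quantified over a variable in \<open>S\<close> are left unchanged, provided that their matrix belongs
  to \<open>f\<close>, a set of formulas; this avoids referring to the class \<open>Formulas\<close>, which need not be \<open>\<Delta>\<^sub>0\<close>. The existential
  quantifiers are arranged to bind the components of a pair, which makes the formula visibly bounded.
\<close>

definition term_step :: "'v \<Rightarrow> 'v \<Rightarrow> 'v \<Rightarrow> 'v \<Rightarrow> bool" where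
  "term_step v t s r \<longleftrightarrow> (\<exists>k a. s = vpair k a \<and> (k = tag 0 \<or> k = tag 1) \<and>
     (s = Var v \<and> r = t \<or> s \<noteq> Var v \<and> r = s))"

definition step_core ::
    "'v \<Rightarrow> 'v \<Rightarrow> 'v \<Rightarrow> 'v \<Rightarrow> ('v \<Rightarrow> 'v \<Rightarrow> bool) \<Rightarrow> 'v \<Rightarrow> 'v \<Rightarrow> 'v \<Rightarrow> bool" where
  "step_core v t S f W k x x' \<longleftrightarrow>
     (k = tag 2 \<or> k = tag 3) \<and> (\<exists>s s'. x = vpair s s' \<and> (\<exists>r r'. x' = vpair r r' \<and>
          term_step v t s r \<and> term_step v t s' r')) \<or>
     k = tag 4 \<and> W x x' \<or>
     k = tag 5 \<and> (\<exists>\<theta> \<eta>. x = vpair \<theta> \<eta> \<and> (\<exists>\<theta>' \<eta>'. x' = vpair \<theta>' \<eta>' \<and> W \<theta> \<theta>' \<and> W \<eta> \<eta>')) \<or>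
     (k = tag 6 \<or> k = tag 7) \<and> (\<exists>b \<theta>. x = vpair b \<theta> \<and> (\<exists>b' \<theta>'. x' = vpair b' \<theta>' \<and> b' = b \<and>
          (b \<^bold>\<in> S \<and> \<theta>' = \<theta> \<and> \<theta> \<^bold>\<in> f \<or> \<not> b \<^bold>\<in> S \<and> t \<noteq> vpair (tag 0) b \<and> W \<theta> \<theta>'))) \<or>
     (k = tag 8 \<or> k = tag 9) \<and>
          (\<forall>\<phi>. \<phi> \<^bold>\<in> x \<longrightarrow> (\<exists>\<phi>'. \<phi>' \<^bold>\<in> x' \<and> W \<phi> \<phi>')) \<and>
          (\<forall>\<phi>'. \<phi>' \<^bold>\<in> x' \<longrightarrow> (\<exists>\<phi>. \<phi> \<^bold>\<in> x \<and> W \<phi> \<phi>'))"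

definition step :: "'v \<Rightarrow> 'v \<Rightarrow> 'v \<Rightarrow> 'v \<Rightarrow> ('v \<Rightarrow> 'v \<Rightarrow> bool) \<Rightarrow> 'v \<Rightarrow> 'v \<Rightarrow> bool" where
  "step v t S f W \<alpha> \<beta> \<longleftrightarrow> (\<exists>k x. \<alpha> = vpair k x \<and>
     (\<exists>k' x'. \<beta> = vpair k' x' \<and> k' = k \<and> step_core v t S f W k x x'))"

definition wit :: "'v \<Rightarrow> 'v \<Rightarrow> 'v \<Rightarrow> 'v \<Rightarrow> 'v \<Rightarrow> bool" where
  "wit v t S f w \<longleftrightarrow> (\<forall>p. p \<^bold>\<in> w \<longrightarrow>
     (\<exists>\<alpha> \<beta>. p = vpair \<alpha> \<beta> \<and> step v t S f (\<lambda>x y. vpair x y \<^bold>\<in> w) \<alpha> \<beta>))"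

text \<open>The quantifier runs over the elements of \<open>w\<close> rather than over second
  components, which makes the condition visibly bounded.\<close>

definition indom :: "'v \<Rightarrow> 'v \<Rightarrow> bool" where
  "indom x w \<longleftrightarrow> (\<exists>p. p \<^bold>\<in> w \<and> (\<exists>x' y. p = vpair x' y \<and> x' = x))"

lemma indom_iff: "indom x w \<longleftrightarrow> (\<exists>y. vpair x y \<^bold>\<in> w)"
  unfolding indom_def by blast

lemma expr_wit:
  assumes "v \<in> A" "t \<in> A" "S \<in> A" "f \<in> A"
  shows "expressible d (\<lambda>e. wit v t S f (e n))"
proof -
  have "Var v \<in> A" "\<And>n. tag n \<in> A" using assms by (simp_all add: tag_A)
  note A = this assms
  show ?thesis
    unfolding wit_def step_def step_core_def term_step_def
    by (rule expr_intros univ_A A)+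
qed

lemma expr_indom: "expressible d (\<lambda>e. indom (e n) (e m))"
  unfolding indom_def by (rule expr_intros)+

lemma step_intros:
  "s \<in> Terms \<Longrightarrow> s' \<in> Terms \<Longrightarrow> step v t S f W (EQ s s') (EQ (sbt v t s) (sbt v t s'))"
  "s \<in> Terms \<Longrightarrow> s' \<in> Terms \<Longrightarrow> step v t S f W (IN s s') (IN (sbt v t s) (sbt v t s'))"
  "W \<phi> \<phi>' \<Longrightarrow> step v t S f W (NOT \<phi>) (NOT \<phi>')"
  "W \<phi> \<phi>' \<Longrightarrow> W \<psi> \<psi>' \<Longrightarrow> step v t S f W (IMP \<phi> \<psi>) (IMP \<phi>' \<psi>')"
  "b \<^bold>\<in> S \<Longrightarrow> \<phi> \<^bold>\<in> f \<Longrightarrow> step v t S f W (ALL' b \<phi>) (ALL' b \<phi>)"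
  "b \<^bold>\<in> S \<Longrightarrow> \<phi> \<^bold>\<in> f \<Longrightarrow> step v t S f W (EX' b \<phi>) (EX' b \<phi>)"
  "\<not> b \<^bold>\<in> S \<Longrightarrow> t \<noteq> Var b \<Longrightarrow> W \<phi> \<phi>' \<Longrightarrow> step v t S f W (ALL' b \<phi>) (ALL' b \<phi>')"
  "\<not> b \<^bold>\<in> S \<Longrightarrow> t \<noteq> Var b \<Longrightarrow> W \<phi> \<phi>' \<Longrightarrow> step v t S f W (EX' b \<phi>) (EX' b \<phi>')"
  "(\<And>\<phi>. \<phi> \<^bold>\<in> \<Phi> \<Longrightarrow> \<exists>\<phi>'. \<phi>' \<^bold>\<in> \<Phi>' \<and> W \<phi> \<phi>') \<Longrightarrow> (\<And>\<phi>'. \<phi>' \<^bold>\<in> \<Phi>' \<Longrightarrow> \<exists>\<phi>. \<phi> \<^bold>\<in> \<Phi> \<and> W \<phi> \<phi>') \<Longrightarrow>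
     step v t S f W (AND \<Phi>) (AND \<Phi>')"
  "(\<And>\<phi>. \<phi> \<^bold>\<in> \<Phi> \<Longrightarrow> \<exists>\<phi>'. \<phi>' \<^bold>\<in> \<Phi>' \<and> W \<phi> \<phi>') \<Longrightarrow> (\<And>\<phi>'. \<phi>' \<^bold>\<in> \<Phi>' \<Longrightarrow> \<exists>\<phi>. \<phi> \<^bold>\<in> \<Phi> \<and> W \<phi> \<phi>') \<Longrightarrow>
     step v t S f W (OR \<Phi>) (OR \<Phi>')"
  unfolding step_def step_core_def term_step_def Terms_def sbt_def code_defs by auto

text \<open>The tags tell the constructors apart. Membership of \<alpha> in \<open>A\<close> turns
  the tagged components of an atomic formula into elements of \<open>Terms\<close>.\<close>

lemma step_cases:
  assumes "step v t S f W \<alpha> \<beta>" "\<alpha> \<in> A"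
  obtains
    (atomic) s s' where "s \<in> Terms" "s' \<in> Terms"
      "\<alpha> = EQ s s' \<and> \<beta> = EQ (sbt v t s) (sbt v t s') \<or> \<alpha> = IN s s' \<and> \<beta> = IN (sbt v t s) (sbt v t s')"
  | (neg) \<phi> \<phi>' where "\<alpha> = NOT \<phi>" "\<beta> = NOT \<phi>'" "W \<phi> \<phi>'"
  | (imp) \<phi> \<phi>' \<psi> \<psi>' where "\<alpha> = IMP \<phi> \<psi>" "\<beta> = IMP \<phi>' \<psi>'" "W \<phi> \<phi>'" "W \<psi> \<psi>'"
  | (stop) b \<phi> where "b \<in> A" "\<alpha> = ALL' b \<phi> \<or> \<alpha> = EX' b \<phi>" "\<beta> = \<alpha>" "b \<^bold>\<in> S" "\<phi> \<^bold>\<in> f"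
  | (quant) b \<phi> \<phi>' where "b \<in> A" "\<alpha> = ALL' b \<phi> \<and> \<beta> = ALL' b \<phi>' \<or> \<alpha> = EX' b \<phi> \<and> \<beta> = EX' b \<phi>'"
      "\<not> b \<^bold>\<in> S" "t \<noteq> Var b" "W \<phi> \<phi>'"
  | (junction) \<Phi> \<Phi>' where "\<Phi> \<in> A" "\<alpha> = AND \<Phi> \<and> \<beta> = AND \<Phi>' \<or> \<alpha> = OR \<Phi> \<and> \<beta> = OR \<Phi>'"
      "\<And>\<phi>. \<phi> \<^bold>\<in> \<Phi> \<Longrightarrow> \<exists>\<phi>'. \<phi>' \<^bold>\<in> \<Phi>' \<and> W \<phi> \<phi>'" "\<And>\<phi>'. \<phi>' \<^bold>\<in> \<Phi>' \<Longrightarrow> \<exists>\<phi>. \<phi> \<^bold>\<in> \<Phi> \<and> W \<phi> \<phi>'"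
proof -
  obtain k x x' where \<alpha>: "\<alpha> = vpair k x" and \<beta>: "\<beta> = vpair k x'" and
    D: "step_core v t S f W k x x'"
    using assms(1) unfolding step_def by (elim exE conjE) simp
  have ts: "s \<in> Terms \<and> r = sbt v t s" if "term_step v t s r" "s \<in> A" for s r
    using that unfolding term_step_def sbt_def Terms_def code_defs by auto
  have xA: "x \<in> A" using assms(2) \<alpha> by simp
  from D[unfolded step_core_def] show ?thesis
  proof (elim disjE, goal_cases)
    case 1
    then obtain s s' r r' where *: "k = tag 2 \<or> k = tag 3" "x = vpair s s'" "x' = vpair r r'"
      "term_step v t s r" "term_step v t s' r'" by blast
    then have "s \<in> Terms" "s' \<in> Terms" "r = sbt v t s" "r' = sbt v t s'"
      using ts[OF *(4)] ts[OF *(5)] xA by simp_all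
    then show ?thesis using * \<alpha> \<beta> by (intro atomic[of s s']) (simp_all add: EQ_def IN_def)
  next
    case 2
    then show ?thesis using \<alpha> \<beta> by (intro neg[of x x']) (simp_all add: NOT_def)
  next
    case 3
    then obtain \<theta> \<eta> \<theta>' \<eta>' where "k = tag 5" "x = vpair \<theta> \<eta>" "x' = vpair \<theta>' \<eta>'" "W \<theta> \<theta>'" "W \<eta> \<eta>'" by blast
    then show ?thesis using \<alpha> \<beta> by (intro imp[of \<theta> \<eta> \<theta>' \<eta>']) (simp_all add: IMP_def)
  next
    case 4
    then obtain b \<theta> \<theta>' where *: "k = tag 6 \<or> k = tag 7" "x = vpair b \<theta>" "x' = vpair b \<theta>'"
      "b \<^bold>\<in> S \<and> \<theta>' = \<theta> \<and> \<theta> \<^bold>\<in> f \<or> \<not> b \<^bold>\<in> S \<and> t \<noteq> vpair (tag 0) b \<and> W \<theta> \<theta>'" by blast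
    from *(4) show ?thesis
    proof (elim disjE, goal_cases)
      case 1
      then show ?thesis using *(1-3) \<alpha> \<beta> xA by (intro stop[of b \<theta>]) (simp_all add: ALL'_def EX'_def)
    next
      case 2
      then show ?thesis using *(1-3) \<alpha> \<beta> xA
        by (intro quant[of b \<theta> \<theta>']) (simp_all add: ALL'_def EX'_def Var_def)
    qed
  next
    case 5
    then show ?thesis using \<alpha> \<beta> xA by (intro junction[of x x']) (simp_all add: AND_def OR_def)
  qed
qed

text \<open>A clause consults \<open>W\<close> only positively and only at immediate subformulas of
  \<alpha>. This allows certificates to be enlarged, and a certificate to be replaced by an
  induction predicate.\<close>

lemma step_mono:
  assumes "step v t S f W \<alpha> \<beta>" "\<alpha> \<in> A" and W: "\<And>y y'. subcode y \<alpha> \<Longrightarrow> W y y' \<Longrightarrow> W' y y'"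
  shows "step v t S f W' \<alpha> \<beta>"
  using assms(1,2)
proof (cases rule: step_cases)
  case (atomic s s')
  then show ?thesis by (elim disjE conjE) (simp_all add: step_intros(1,2))
next
  case (neg \<phi> \<phi>')
  have "subcode \<phi> \<alpha>" using neg by (simp add: subcode_def NOT_def)
  from W[OF this neg(3)] show ?thesis unfolding neg(1,2) by (rule step_intros)
next
  case (imp \<phi> \<phi>' \<psi> \<psi>')
  have "subcode \<phi> \<alpha>" "subcode \<psi> \<alpha>" using imp by (simp_all add: subcode_def IMP_def)
  from W[OF this(1) imp(3)] W[OF this(2) imp(4)] show ?thesis
    unfolding imp(1,2) by (rule step_intros)
next
  case (stop b \<phi>)
  from stop(2) show ?thesis unfolding stop(3)
    by (elim disjE) (simp_all add: step_intros(5,6) stop(4,5))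
next
  case (quant b \<phi> \<phi>')
  have "subcode \<phi> \<alpha>" using quant by (auto simp: subcode_def ALL'_def EX'_def)
  from W[OF this quant(5)] quant(2) show ?thesis
    by (elim disjE) (simp_all add: step_intros(7,8) quant(3,4))
next
  case (junction \<Phi> \<Phi>')
  have sub: "subcode \<phi> \<alpha>" if "\<phi> \<^bold>\<in> \<Phi>" for \<phi>
    using junction(2) that by (auto simp: subcode_def AND_def OR_def)
  have 1: "\<exists>\<phi>'. \<phi>' \<^bold>\<in> \<Phi>' \<and> W' \<phi> \<phi>'" if \<phi>: "\<phi> \<^bold>\<in> \<Phi>" for \<phi>
  proof -
    obtain \<phi>' where "\<phi>' \<^bold>\<in> \<Phi>'" "W \<phi> \<phi>'" using junction(3)[OF \<phi>] by blast
    then show ?thesis using W[OF sub[OF \<phi>]] by blast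
  qed
  have 2: "\<exists>\<phi>. \<phi> \<^bold>\<in> \<Phi> \<and> W' \<phi> \<phi>'" if \<phi>': "\<phi>' \<^bold>\<in> \<Phi>'" for \<phi>'
  proof -
    obtain \<phi> where \<phi>: "\<phi> \<^bold>\<in> \<Phi>" "W \<phi> \<phi>'" using junction(4)[OF \<phi>'] by blast
    then show ?thesis using W[OF sub[OF \<phi>(1)]] by blast
  qed
  have "step v t S f W' (AND \<Phi>) (AND \<Phi>')" by (rule step_intros(9)[OF 1 2])
  moreover have "step v t S f W' (OR \<Phi>) (OR \<Phi>')" by (rule step_intros(10)[OF 1 2])
  ultimately show ?thesis using junction(2) by (elim disjE conjE) simp_all
qed

lemma wit_step:
  assumes "wit v t S f w" "vpair \<alpha> \<beta> \<^bold>\<in> w"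
  shows "step v t S f (\<lambda>x y. vpair x y \<^bold>\<in> w) \<alpha> \<beta>"
  using assms unfolding wit_def by fastforce

lemma wit_A: "w \<in> A \<Longrightarrow> vpair \<alpha> \<beta> \<^bold>\<in> w \<Longrightarrow> \<alpha> \<in> A \<and> \<beta> \<in> A"
  using A_transitive[of w "vpair \<alpha> \<beta>"] by simp

text \<open>A certificate could a priori justify its pairs in a circle. Foundation excludes this:
  each clause leads to pairs whose left components are constituents of the given one, so
  \<open>subcode_induct\<close> applies.\<close>

lemma wit_induct:
  assumes w: "wit v t S f w" "w \<in> A" "vpair \<alpha> \<beta> \<^bold>\<in> w"
    and R: "expressible False (\<lambda>e. R (e 0) (e 1))"
    and step: "\<And>\<alpha> \<beta>. \<alpha> \<in> A \<Longrightarrow> \<beta> \<in> A \<Longrightarrow> step v t S f R \<alpha> \<beta> \<Longrightarrow> R \<alpha> \<beta>"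
  shows "R \<alpha> \<beta>"
proof -
  have "\<forall>\<beta>. vpair \<alpha> \<beta> \<^bold>\<in> w \<longrightarrow> R \<alpha> \<beta>"
  proof (rule subcode_induct[where P = "\<lambda>\<alpha>. \<forall>\<beta>. vpair \<alpha> \<beta> \<^bold>\<in> w \<longrightarrow> R \<alpha> \<beta>"])
    have R': "expressible False (\<lambda>e. R (e (Suc 0)) (e 0))"
      by (rule expr_let2[OF R proj_var proj_var])
    show "expressible False (\<lambda>e. \<forall>\<beta>. vpair (e 0) \<beta> \<^bold>\<in> w \<longrightarrow> R (e 0) \<beta>)"
      by (rule R' expr_all expr_imp expr_vpair_mem proj_var proj_const univ_False)+
  next
    fix x assume IH: "\<And>y. subcode y x \<Longrightarrow> \<forall>\<beta>. vpair y \<beta> \<^bold>\<in> w \<longrightarrow> R y \<beta>"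
    show "\<forall>\<beta>. vpair x \<beta> \<^bold>\<in> w \<longrightarrow> R x \<beta>"
    proof (intro allI impI)
      fix \<beta> assume x: "vpair x \<beta> \<^bold>\<in> w"
      show "R x \<beta>"
      proof (rule step)
        show A: "x \<in> A" "\<beta> \<in> A" using wit_A[OF w(2) x] by auto
        show "step v t S f R x \<beta>"
          by (rule step_mono[OF wit_step[OF w(1) x] A(1)]) (use IH in blast)
      qed
    qed
  qed
  then show ?thesis using w(3) by blast
qed

text \<open>The set of stopping variables is the singleton of v, so substitution halts exactly at
  the quantifiers that bind \<open>Var v\<close>.\<close>

lemma wit_Subst:
  assumes w: "wit v t (vupair v v) f w" "w \<in> A" "vpair \<phi> \<phi>' \<^bold>\<in> w"
    and f: "\<And>\<theta>. \<theta> \<^bold>\<in> f \<Longrightarrow> \<theta> \<in> Formulas"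
  shows "(\<phi>, \<phi>') \<in> Subst v t"
  unfolding Subst_iff
proof (intro allI impI)
  fix R assume R: "definable_rel R" "subst_closed v t R"
  note r = subst_closedD[OF R(2)]
  show "(\<phi>, \<phi>') \<in> R"
  proof (rule wit_induct[OF w, of "\<lambda>x y. (x, y) \<in> R"])
    show "expressible False (\<lambda>e. (e 0, e 1) \<in> R)"
      by (rule expr_rel[OF R(1) proj_var proj_var])
    fix \<alpha> \<beta> assume A: "\<alpha> \<in> A" "\<beta> \<in> A"
    assume "step v t (vupair v v) f (\<lambda>x y. (x, y) \<in> R) \<alpha> \<beta>"
    then show "(\<alpha>, \<beta>) \<in> R" using A(1)
    proof (cases rule: step_cases)
      case (atomic s s') then show ?thesis using r(1,2) by blast
    next
      case (neg \<phi> \<phi>') then show ?thesis using r(3) by blast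
    next
      case (imp \<phi> \<phi>' \<psi> \<psi>') then show ?thesis using r(4) by blast
    next
      case (stop b \<phi>) then show ?thesis using r(5,6)[OF f, of \<phi>] by auto
    next
      case (quant b \<phi> \<phi>') then show ?thesis using r(7,8)[of \<phi> \<phi>' b] by auto
    next
      case (junction \<Phi> \<Phi>')
      have "\<Phi>' \<in> A" using A(2) junction(2) by auto
      then show ?thesis using junction(2) r(9,10)[OF junction(1) _ junction(3,4)] by blast
    qed
  qed
qed

text \<open>The right components of \<open>w\<close> serve as the class \<open>N\<close> of
  \<open>not_freeI\<close>: except below quantifiers over v, subformulas of a right component are
  right components again, and in atomic ones \<open>Var v\<close> has given way to t.\<close>

lemma wit_not_free:
  assumes w: "wit v t (vupair v v) f w" "w \<in> A" "vpair \<phi> \<phi>' \<^bold>\<in> w" and t: "t \<noteq> Var v"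
  shows "\<phi>' \<notin> Has_free v"
proof (rule not_freeI[of "\<lambda>y. \<exists>x. vpair x y \<^bold>\<in> w"])
  let ?st = "step v t (vupair v v) f (\<lambda>x y. vpair x y \<^bold>\<in> w)"
  show "\<exists>x. vpair x \<phi>' \<^bold>\<in> w" using w(3) by blast
  show "expressible False (\<lambda>e. \<exists>x. vpair x (e 0) \<^bold>\<in> w)"
    by (rule expr_ex expr_intros)+
  have st: "?st x y \<and> x \<in> A" if "vpair x y \<^bold>\<in> w" for x y
    using wit_step[OF w(1) that] wit_A[OF w(2) that] by blast
  show "s \<noteq> Var v \<and> s' \<noteq> Var v" if h: "(\<exists>x. vpair x (EQ s s') \<^bold>\<in> w) \<or> (\<exists>x. vpair x (IN s s') \<^bold>\<in> w)" for s s'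
  proof -
    obtain x y where xy: "vpair x y \<^bold>\<in> w" "y = EQ s s' \<or> y = IN s s'" using h by blast
    have "?st x y" "x \<in> A" using st[OF xy(1)] by auto
    then show ?thesis
      by (cases rule: step_cases) (use xy(2) t in \<open>auto simp: code_defs sbt_def split: if_splits\<close>)
  qed
  show "\<exists>x. vpair x \<theta> \<^bold>\<in> w" if h: "\<exists>x. vpair x (NOT \<theta>) \<^bold>\<in> w" for \<theta>
  proof -
    obtain x where x: "vpair x (NOT \<theta>) \<^bold>\<in> w" using h by blast
    have "?st x (NOT \<theta>)" "x \<in> A" using st[OF x] by auto
    then show ?thesis
      by (cases rule: step_cases) (auto simp: code_defs)
  qed
  show "(\<exists>x. vpair x \<theta> \<^bold>\<in> w) \<and> (\<exists>x. vpair x \<eta> \<^bold>\<in> w)" if h: "\<exists>x. vpair x (IMP \<theta> \<eta>) \<^bold>\<in> w" for \<theta> \<eta>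
  proof -
    obtain x where x: "vpair x (IMP \<theta> \<eta>) \<^bold>\<in> w" using h by blast
    have "?st x (IMP \<theta> \<eta>)" "x \<in> A" using st[OF x] by auto
    then show ?thesis
      by (cases rule: step_cases) (auto simp: code_defs)
  qed
  show "\<exists>x. vpair x \<theta> \<^bold>\<in> w"
    if b: "b \<noteq> v" and h: "(\<exists>x. vpair x (ALL' b \<theta>) \<^bold>\<in> w) \<or> (\<exists>x. vpair x (EX' b \<theta>) \<^bold>\<in> w)" for b \<theta>
  proof -
    obtain x y where xy: "vpair x y \<^bold>\<in> w" "y = ALL' b \<theta> \<or> y = EX' b \<theta>" using h by blast
    have "?st x y" "x \<in> A" using st[OF xy(1)] by auto
    then show ?thesis
      by (cases rule: step_cases) (use xy(2) b in \<open>auto simp: code_defs\<close>)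
  qed
  show "\<exists>x. vpair x \<theta> \<^bold>\<in> w"
    if h: "(\<exists>x. vpair x (AND \<Phi>) \<^bold>\<in> w) \<or> (\<exists>x. vpair x (OR \<Phi>) \<^bold>\<in> w)" and \<theta>: "\<theta> \<^bold>\<in> \<Phi>" for \<Phi> \<theta>
  proof -
    obtain x y where xy: "vpair x y \<^bold>\<in> w" "y = AND \<Phi> \<or> y = OR \<Phi>" using h by blast
    have "?st x y" "x \<in> A" using st[OF xy(1)] by auto
    then show ?thesis
    proof (cases rule: step_cases)
      case (junction \<Psi> \<Psi>')
      then have "\<Psi>' = \<Phi>" using xy(2) by (auto simp: code_defs)
      then show ?thesis using junction(4) \<theta> by blast
    qed (use xy(2) in \<open>auto simp: code_defs\<close>)
  qed
qed

lemma wit_insert: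
  assumes w: "wit v t S f w" "w \<in> A" and ab: "\<alpha> \<in> A" "\<beta> \<in> A"
    and st: "step v t S f (\<lambda>x y. vpair x y \<^bold>\<in> w) \<alpha> \<beta>"
  shows "\<exists>w. w \<in> A \<and> wit v t S f w \<and> indom \<alpha> w"
proof -
  obtain w' where w': "w' \<in> A" "\<And>y. y \<^bold>\<in> w' \<longleftrightarrow> y \<^bold>\<in> w \<or> y = vpair \<alpha> \<beta>"
    using insert_A[OF w(2), of "vpair \<alpha> \<beta>"] ab by auto
  have "wit v t S f w'"
    unfolding wit_def
  proof (intro allI impI)
    fix p assume "p \<^bold>\<in> w'"
    then obtain x y where p: "p = vpair x y" "step v t S f (\<lambda>x y. vpair x y \<^bold>\<in> w) x y" "x \<in> A"
      using w st ab wit_A[OF w(2)] unfolding w'(2) wit_def by blast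
    have "step v t S f (\<lambda>x y. vpair x y \<^bold>\<in> w') x y"
      by (rule step_mono[OF p(2,3)]) (simp add: w'(2))
    then show "\<exists>x y. p = vpair x y \<and> step v t S f (\<lambda>x y. vpair x y \<^bold>\<in> w') x y" using p(1) by blast
  qed
  then show ?thesis using w' unfolding indom_iff by blast
qed

text \<open>In the application to infinite junctions b comes from Collection and may contain sets
  that certify nothing, so only the certificates in b are united; \<open>step_mono\<close> transfers
  their clauses to the union.\<close>

lemma wit_Union:
  assumes par: "v \<in> A" "t \<in> A" "S \<in> A" "f \<in> A" and b: "b \<in> A"
  obtains w where "w \<in> A" "wit v t S f w" "\<And>p. p \<^bold>\<in> w \<longleftrightarrow> (\<exists>u. u \<^bold>\<in> b \<and> wit v t S f u \<and> p \<^bold>\<in> u)"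
proof -
  obtain c where c: "c \<in> A" "\<And>p. p \<^bold>\<in> c \<longleftrightarrow> (\<exists>u. u \<^bold>\<in> b \<and> p \<^bold>\<in> u)" using union_A[OF b] by blast
  have "expressible True (\<lambda>e. \<exists>u. u \<^bold>\<in> b \<and> wit v t S f u \<and> e 0 \<^bold>\<in> u)"
    by (rule expr_wit[OF par] expr_intros univ_A b)+
  then obtain w where w: "w \<in> A" "\<And>p. p \<^bold>\<in> w \<longleftrightarrow> p \<^bold>\<in> c \<and> (\<exists>u. u \<^bold>\<in> b \<and> wit v t S f u \<and> p \<^bold>\<in> u)"
    using separation_A[OF _ c(1), of "\<lambda>p. \<exists>u. u \<^bold>\<in> b \<and> wit v t S f u \<and> p \<^bold>\<in> u"] by blast
  have w2: "p \<^bold>\<in> w \<longleftrightarrow> (\<exists>u. u \<^bold>\<in> b \<and> wit v t S f u \<and> p \<^bold>\<in> u)" for p unfolding w(2) c(2) by blast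
  have "wit v t S f w"
    unfolding wit_def
  proof (intro allI impI)
    fix p assume "p \<^bold>\<in> w"
    then obtain u where u: "u \<^bold>\<in> b" "wit v t S f u" "p \<^bold>\<in> u" unfolding w2 by blast
    then obtain x y where p: "p = vpair x y" "step v t S f (\<lambda>x y. vpair x y \<^bold>\<in> u) x y"
      unfolding wit_def by blast
    have "u \<in> A" using b u(1) A_transitive by blast
    then have "x \<in> A" using wit_A u(3) p(1) by blast
    have "step v t S f (\<lambda>x y. vpair x y \<^bold>\<in> w) x y"
      by (rule step_mono[OF p(2) \<open>x \<in> A\<close>]) (use u w2 in blast)
    then show "\<exists>x y. p = vpair x y \<and> step v t S f (\<lambda>x y. vpair x y \<^bold>\<in> w) x y" using p(1) by blast
  qed
  then show ?thesis using that w(1) w2 by blast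
qed

text \<open>Here \<open>K\<close> is a definable condition inherited by subformulas that grants the
  side conditions at quantifiers. It is taken to be always true, with S empty, in order to collect
  subformulas, and to be membership in \<open>f\<close> in order to substitute.\<close>

lemma wit_total:
  assumes par: "v \<in> A" "t \<in> A" "S \<in> A" "f \<in> A"
    and K: "expressible False (\<lambda>e. K (e 0))"
      "\<And>\<phi>. K (NOT \<phi>) \<Longrightarrow> K \<phi>" "\<And>\<phi> \<psi>. K (IMP \<phi> \<psi>) \<Longrightarrow> K \<phi> \<and> K \<psi>"
      "\<And>b \<phi>. K (ALL' b \<phi>) \<or> K (EX' b \<phi>) \<Longrightarrow> K \<phi> \<and> (b \<^bold>\<in> S \<longrightarrow> \<phi> \<^bold>\<in> f) \<and> (\<not> b \<^bold>\<in> S \<longrightarrow> t \<noteq> Var b)"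
      "\<And>\<Phi> \<phi>. K (AND \<Phi>) \<or> K (OR \<Phi>) \<Longrightarrow> \<phi> \<^bold>\<in> \<Phi> \<Longrightarrow> K \<phi>"
    and t: "t \<in> Terms"
    and \<phi>: "\<phi> \<in> Formulas" "K \<phi>"
  shows "\<exists>w. w \<in> A \<and> wit v t S f w \<and> indom \<phi> w"
proof -
  let ?Q = "\<lambda>x. \<exists>w. w \<in> A \<and> wit v t S f w \<and> indom x w"
  have exQ: "expressible False (\<lambda>e. K (e 0) \<longrightarrow> ?Q (e 0))"
    by (rule K(1) expr_imp expr_wit[OF par] expr_indom expr_in_A expr_ex expr_intros)+
  have sbt_A: "sbt v t s \<in> A" if "s \<in> Terms" for s
    using that par by (simp add: sbt_def Terms_A)
  \<comment> \<open>The empty set is a certificate; it supports atomic formulas and quantifiers at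
    which substitution stops.\<close>
  obtain e where e: "e \<in> A" "\<And>y. \<not> y \<^bold>\<in> e" using vempty_A[OF par(1)] by auto
  have e_wit: "wit v t S f e" unfolding wit_def using e(2) by blast
  have "\<phi> \<in> A \<and> (K \<phi> \<longrightarrow> ?Q \<phi>)"
  proof (rule Formulas_induct[OF \<phi>(1), of "\<lambda>x. x \<in> A \<and> (K x \<longrightarrow> ?Q x)"])
    show "expressible False (\<lambda>e. e 0 \<in> A \<and> (K (e 0) \<longrightarrow> ?Q (e 0)))"
      by (rule expr_and[OF expr_inA exQ])
  next
    fix s s' assume s: "s \<in> Terms" "s' \<in> Terms"
    note wit_insert[OF e_wit e(1)]
    then have "?Q (EQ s s')" "?Q (IN s s')"
      using step_intros(1,2)[OF s] s Terms_A sbt_A by (metis code_A(3), metis code_A(4))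
    then show "(EQ s s' \<in> A \<and> (K (EQ s s') \<longrightarrow> ?Q (EQ s s'))) \<and> (IN s s' \<in> A \<and> (K (IN s s') \<longrightarrow> ?Q (IN s s')))"
      using s Terms_A by auto
  next
    fix \<phi> assume IH: "\<phi> \<in> A \<and> (K \<phi> \<longrightarrow> ?Q \<phi>)"
    have "?Q (NOT \<phi>)" if k: "K (NOT \<phi>)"
    proof -
      obtain w \<phi>' where w: "w \<in> A" "wit v t S f w" "vpair \<phi> \<phi>' \<^bold>\<in> w"
        using IH K(2)[OF k] unfolding indom_iff by blast
      show ?thesis
        by (rule wit_insert[OF w(2,1) _ _ step_intros(3)[where W = "\<lambda>x y. vpair x y \<^bold>\<in> w", OF w(3)]]) (use wit_A[OF w(1,3)] in simp_all)
    qed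
    then show "NOT \<phi> \<in> A \<and> (K (NOT \<phi>) \<longrightarrow> ?Q (NOT \<phi>))" using IH by simp
  next
    fix \<phi> \<psi> assume IH: "\<phi> \<in> A \<and> (K \<phi> \<longrightarrow> ?Q \<phi>)" "\<psi> \<in> A \<and> (K \<psi> \<longrightarrow> ?Q \<psi>)"
    have "?Q (IMP \<phi> \<psi>)" if k: "K (IMP \<phi> \<psi>)"
    proof -
      obtain w1 \<phi>' where w1: "w1 \<in> A" "wit v t S f w1" "vpair \<phi> \<phi>' \<^bold>\<in> w1"
        using IH K(3)[OF k] unfolding indom_iff by blast
      obtain w2 \<psi>' where w2: "w2 \<in> A" "wit v t S f w2" "vpair \<psi> \<psi>' \<^bold>\<in> w2"
        using IH K(3)[OF k] unfolding indom_iff by blast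
      have "vupair w1 w2 \<in> A" using w1 w2 by simp
      then obtain w where w: "w \<in> A" "wit v t S f w"
        "\<And>p. p \<^bold>\<in> w \<longleftrightarrow> (\<exists>u. u \<^bold>\<in> vupair w1 w2 \<and> wit v t S f u \<and> p \<^bold>\<in> u)"
        using wit_Union[OF par] by blast
      have m: "vpair \<phi> \<phi>' \<^bold>\<in> w" "vpair \<psi> \<psi>' \<^bold>\<in> w" unfolding w(3) using w1 w2 by auto
      show ?thesis
        by (rule wit_insert[OF w(2,1) _ _ step_intros(4)[where W = "\<lambda>x y. vpair x y \<^bold>\<in> w", OF m]])
          (use wit_A[OF w(1) m(1)] wit_A[OF w(1) m(2)] in simp_all)
    qed
    then show "IMP \<phi> \<psi> \<in> A \<and> (K (IMP \<phi> \<psi>) \<longrightarrow> ?Q (IMP \<phi> \<psi>))" using IH by simp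
  next
    fix b \<phi> assume b: "b \<in> A" and IH: "\<phi> \<in> A \<and> (K \<phi> \<longrightarrow> ?Q \<phi>)"
    have "?Q (ALL' b \<phi>) \<and> ?Q (EX' b \<phi>)" if h: "K (ALL' b \<phi>) \<or> K (EX' b \<phi>)"
    proof (cases "b \<^bold>\<in> S")
      case True
      then have "\<phi> \<^bold>\<in> f" using K(4)[OF h] by blast
      then show ?thesis
        using wit_insert[OF e_wit e(1) _ _ step_intros(5)[OF True]]
          wit_insert[OF e_wit e(1) _ _ step_intros(6)[OF True]] b IH by simp
    next
      case False
      obtain w \<phi>' where w: "w \<in> A" "wit v t S f w" "vpair \<phi> \<phi>' \<^bold>\<in> w" and tb: "t \<noteq> Var b"
        using IH K(4)[OF h] False unfolding indom_iff by blast
      show ?thesis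
        using wit_insert[OF w(2,1) _ _ step_intros(7)[where W = "\<lambda>x y. vpair x y \<^bold>\<in> w", OF False tb w(3)]]
          wit_insert[OF w(2,1) _ _ step_intros(8)[where W = "\<lambda>x y. vpair x y \<^bold>\<in> w", OF False tb w(3)]]
          wit_A[OF w(1,3)] b by simp
    qed
    then show "(ALL' b \<phi> \<in> A \<and> (K (ALL' b \<phi>) \<longrightarrow> ?Q (ALL' b \<phi>))) \<and> (EX' b \<phi> \<in> A \<and> (K (EX' b \<phi>) \<longrightarrow> ?Q (EX' b \<phi>)))"
      using IH b by auto
  next
    fix \<Phi> assume \<Phi>: "\<Phi> \<in> A" and IH: "\<And>\<phi>. \<phi> \<^bold>\<in> \<Phi> \<Longrightarrow> \<phi> \<in> A \<and> (K \<phi> \<longrightarrow> ?Q \<phi>)"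
    have "?Q (AND \<Phi>) \<and> ?Q (OR \<Phi>)" if h: "K (AND \<Phi>) \<or> K (OR \<Phi>)"
    proof -
      have ex: "\<exists>w\<in>A. wit v t S f w \<and> indom \<phi> w" if "\<phi> \<^bold>\<in> \<Phi>" for \<phi>
        using IH[OF that] K(5)[OF h that] by blast
      have "expressible True (\<lambda>e. wit v t S f (e 1) \<and> indom (e 0) (e 1))"
        by (rule expr_and[OF expr_wit[OF par] expr_indom])
      then obtain b where b: "b \<in> A" "\<And>\<phi>. \<phi> \<^bold>\<in> \<Phi> \<Longrightarrow> \<exists>w. w \<^bold>\<in> b \<and> (wit v t S f w \<and> indom \<phi> w)"
        using collection_A[of "\<lambda>\<phi> w. wit v t S f w \<and> indom \<phi> w", OF _ \<Phi> ex] by auto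
      obtain w where w: "w \<in> A" "wit v t S f w" "\<And>p. p \<^bold>\<in> w \<longleftrightarrow> (\<exists>u. u \<^bold>\<in> b \<and> wit v t S f u \<and> p \<^bold>\<in> u)"
        using wit_Union[OF par b(1)] by blast
      obtain w2 where w2: "w2 \<in> A" "\<And>x y. vpair x y \<^bold>\<in> w \<Longrightarrow> x \<^bold>\<in> w2 \<and> y \<^bold>\<in> w2"
        using vpair_field_A[OF w(1)] by blast
      have "expressible True (\<lambda>e. \<exists>\<phi>. \<phi> \<^bold>\<in> \<Phi> \<and> vpair \<phi> (e 0) \<^bold>\<in> w)"
        by (rule expr_intros univ_A \<Phi> w(1))+
      then obtain \<Phi>' where \<Phi>': "\<Phi>' \<in> A" "\<And>x. x \<^bold>\<in> \<Phi>' \<longleftrightarrow> x \<^bold>\<in> w2 \<and> (\<exists>\<phi>. \<phi> \<^bold>\<in> \<Phi> \<and> vpair \<phi> x \<^bold>\<in> w)"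
        using separation_A[OF _ w2(1), of "\<lambda>x. \<exists>\<phi>. \<phi> \<^bold>\<in> \<Phi> \<and> vpair \<phi> x \<^bold>\<in> w"] by blast
      have 1: "\<exists>\<phi>'. \<phi>' \<^bold>\<in> \<Phi>' \<and> vpair \<phi> \<phi>' \<^bold>\<in> w" if \<phi>: "\<phi> \<^bold>\<in> \<Phi>" for \<phi>
      proof -
        obtain u \<phi>' where "u \<^bold>\<in> b" "wit v t S f u" "vpair \<phi> \<phi>' \<^bold>\<in> u"
          using b(2)[OF \<phi>] unfolding indom_iff by blast
        then have m: "vpair \<phi> \<phi>' \<^bold>\<in> w" unfolding w(3) by blast
        then have "\<phi>' \<^bold>\<in> \<Phi>'" using w2(2)[OF m] \<phi> unfolding \<Phi>'(2) by blast
        then show ?thesis using m by blast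
      qed
      have 2: "\<exists>\<phi>. \<phi> \<^bold>\<in> \<Phi> \<and> vpair \<phi> \<phi>' \<^bold>\<in> w" if "\<phi>' \<^bold>\<in> \<Phi>'" for \<phi>'
        using that unfolding \<Phi>'(2) by blast
      show ?thesis
        using wit_insert[OF w(2,1) _ _ step_intros(9)[where W = "\<lambda>x y. vpair x y \<^bold>\<in> w", OF 1 2]]
          wit_insert[OF w(2,1) _ _ step_intros(10)[where W = "\<lambda>x y. vpair x y \<^bold>\<in> w", OF 1 2]] \<Phi> \<Phi>'(1) by simp
    qed
    then show "(AND \<Phi> \<in> A \<and> (K (AND \<Phi>) \<longrightarrow> ?Q (AND \<Phi>))) \<and> (OR \<Phi> \<in> A \<and> (K (OR \<Phi>) \<longrightarrow> ?Q (OR \<Phi>)))"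
      using \<Phi> by auto
  qed
  then show ?thesis using \<phi>(2) by blast
qed

text \<open>An element of \<open>A\<close> with this property stands in for the class
  \<open>Formulas\<close> in induction predicates and bounded formulas.\<close>

definition subformula_closed :: "'v \<Rightarrow> bool" where
  "subformula_closed f \<longleftrightarrow> (\<forall>\<phi>. \<phi> \<^bold>\<in> f \<longrightarrow> \<phi> \<in> Formulas) \<and>
     (\<forall>\<phi>. NOT \<phi> \<^bold>\<in> f \<longrightarrow> \<phi> \<^bold>\<in> f) \<and>
     (\<forall>\<phi> \<psi>. IMP \<phi> \<psi> \<^bold>\<in> f \<longrightarrow> \<phi> \<^bold>\<in> f \<and> \<psi> \<^bold>\<in> f) \<and>
     (\<forall>b \<phi>. ALL' b \<phi> \<^bold>\<in> f \<or> EX' b \<phi> \<^bold>\<in> f \<longrightarrow> \<phi> \<^bold>\<in> f) \<and>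
     (\<forall>\<Phi> \<phi>. AND \<Phi> \<^bold>\<in> f \<or> OR \<Phi> \<^bold>\<in> f \<longrightarrow> \<phi> \<^bold>\<in> \<Phi> \<longrightarrow> \<phi> \<^bold>\<in> f)"

lemma subformula_closedD:
  assumes "subformula_closed f"
  shows "\<phi> \<^bold>\<in> f \<Longrightarrow> \<phi> \<in> Formulas" "NOT \<phi> \<^bold>\<in> f \<Longrightarrow> \<phi> \<^bold>\<in> f"
    "IMP \<phi> \<psi> \<^bold>\<in> f \<Longrightarrow> \<phi> \<^bold>\<in> f \<and> \<psi> \<^bold>\<in> f" "ALL' b \<phi> \<^bold>\<in> f \<or> EX' b \<phi> \<^bold>\<in> f \<Longrightarrow> \<phi> \<^bold>\<in> f"
    "AND \<Phi> \<^bold>\<in> f \<or> OR \<Phi> \<^bold>\<in> f \<Longrightarrow> \<phi> \<^bold>\<in> \<Phi> \<Longrightarrow> \<phi> \<^bold>\<in> f"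
  using assms unfolding subformula_closed_def by blast+

text \<open>With \<open>S\<close> empty, substitution never stops at a quantifier and visits all subformulas.\<close>

lemma subformula_closed_superset:
  assumes \<phi>: "\<phi> \<in> Formulas"
  shows "\<exists>f\<in>A. subformula_closed f \<and> \<phi> \<^bold>\<in> f"
proof -
  have a: "\<phi> \<in> A" using \<phi> Formulas_A by blast
  \<comment> \<open>Any constant would do: it differs from every variable, so no quantifier can
    capture it.\<close>
  define t where "t = Const vempty"
  have E: "vempty \<in> A" using a by (rule vempty_A)
  have t: "t \<in> Terms" "t \<in> A" "\<And>b. t \<noteq> Var b" using E by (simp_all add: t_def)
  have "\<exists>w. w \<in> A \<and> wit vempty t vempty vempty w \<and> indom \<phi> w"
    by (rule wit_total[where K = "\<lambda>_. True"]) (use \<phi> E t expr_eq[OF proj_var proj_var, of False 0 0] in auto)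
  then obtain w where w: "w \<in> A" "wit vempty t vempty vempty w" "indom \<phi> w" by blast
  obtain w2 where w2: "w2 \<in> A" "\<And>x y. vpair x y \<^bold>\<in> w \<Longrightarrow> x \<^bold>\<in> w2 \<and> y \<^bold>\<in> w2"
    using vpair_field_A[OF w(1)] by blast
  have "expressible True (\<lambda>e. indom (e 0) w)"
    unfolding indom_def by (rule expr_intros univ_A w(1))+
  then obtain f where f: "f \<in> A" "\<And>x. x \<^bold>\<in> f \<longleftrightarrow> x \<^bold>\<in> w2 \<and> indom x w"
    using separation_A[OF _ w2(1), of "\<lambda>x. indom x w"] by blast
  have f2: "x \<^bold>\<in> f \<longleftrightarrow> (\<exists>y. vpair x y \<^bold>\<in> w)" for x
    unfolding f(2) indom_iff using w2(2) by blast
  have Fm: "x \<in> Formulas" if "vpair x y \<^bold>\<in> w" for x y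
    unfolding Formulas_iff
  proof (intro allI impI)
    fix C assume C: "definable_class C" "fm_closed C"
    note c = C(2)[unfolded fm_closed_def Atomic_def]
    show "x \<in> C"
    proof (rule wit_induct[OF w(2,1) that, of "\<lambda>x _. x \<in> C"])
      show "expressible False (\<lambda>e. e 0 \<in> C)" by (rule expr_class[OF C(1) proj_var])
      fix \<alpha> \<beta> assume "\<alpha> \<in> A" "step vempty t vempty vempty (\<lambda>x _. x \<in> C) \<alpha> \<beta>"
      from this(2,1) show "\<alpha> \<in> C"
        by (cases rule: step_cases) (use c in \<open>auto\<close>)
    qed
  qed
  let ?st = "step vempty t vempty vempty (\<lambda>x y. vpair x y \<^bold>\<in> w)"
  have st: "?st x y \<and> x \<in> A" if "vpair x y \<^bold>\<in> w" for x y
    using wit_step[OF w(2) that] wit_A[OF w(1) that] by blast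
  have "subformula_closed f"
    unfolding subformula_closed_def
  proof (intro conjI allI impI)
    show "\<theta> \<in> Formulas" if "\<theta> \<^bold>\<in> f" for \<theta> using that Fm unfolding f2 by blast
    show "\<theta> \<^bold>\<in> f" if h: "NOT \<theta> \<^bold>\<in> f" for \<theta>
    proof -
      obtain y where "vpair (NOT \<theta>) y \<^bold>\<in> w" using h unfolding f2 by blast
      from st[OF this] have "?st (NOT \<theta>) y" "NOT \<theta> \<in> A" by auto
      then show ?thesis by (cases rule: step_cases) (auto simp: code_defs f2)
    qed
    have imp: "\<theta> \<^bold>\<in> f \<and> \<eta> \<^bold>\<in> f" if h: "IMP \<theta> \<eta> \<^bold>\<in> f" for \<theta> \<eta>
    proof -
      obtain y where "vpair (IMP \<theta> \<eta>) y \<^bold>\<in> w" using h unfolding f2 by blast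
      from st[OF this] have "?st (IMP \<theta> \<eta>) y" "IMP \<theta> \<eta> \<in> A" by auto
      then show ?thesis by (cases rule: step_cases) (auto simp: code_defs f2)
    qed
    show "\<theta> \<^bold>\<in> f" if "IMP \<theta> \<eta> \<^bold>\<in> f" for \<theta> \<eta> using imp[OF that] by blast
    show "\<eta> \<^bold>\<in> f" if "IMP \<theta> \<eta> \<^bold>\<in> f" for \<theta> \<eta> using imp[OF that] by blast
    show "\<theta> \<^bold>\<in> f" if h: "ALL' b \<theta> \<^bold>\<in> f \<or> EX' b \<theta> \<^bold>\<in> f" for b \<theta>
    proof -
      obtain x y where x: "vpair x y \<^bold>\<in> w" "x = ALL' b \<theta> \<or> x = EX' b \<theta>" using h unfolding f2 by blast
      from st[OF x(1)] have "?st x y" "x \<in> A" by auto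
      then show ?thesis by (cases rule: step_cases) (use x(2) in \<open>auto simp: code_defs f2\<close>)
    qed
    show "\<theta> \<^bold>\<in> f" if h: "AND \<Phi> \<^bold>\<in> f \<or> OR \<Phi> \<^bold>\<in> f" and \<theta>: "\<theta> \<^bold>\<in> \<Phi>" for \<Phi> \<theta>
    proof -
      obtain x y where x: "vpair x y \<^bold>\<in> w" "x = AND \<Phi> \<or> x = OR \<Phi>" using h unfolding f2 by blast
      from st[OF x(1)] have "?st x y" "x \<in> A" by auto
      then show ?thesis
      proof (cases rule: step_cases)
        case (junction \<Psi> \<Psi>')
        then have "\<Psi> = \<Phi>" using x(2) by (auto simp: code_defs)
        then show ?thesis using junction(3) \<theta> f2 by blast
      qed (use x(2) in \<open>auto simp: code_defs\<close>)
    qed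
  qed
  moreover have "\<phi> \<^bold>\<in> f" unfolding f2 using w(3) unfolding indom_iff .
  ultimately show ?thesis using f(1) by blast
qed

text \<open>At a quantifier over \<open>Var a\<close> the clause asks for a matrix in
  \<open>Formulas\<close>, which an induction over definable classes cannot carry along; membership
  in the set \<open>f\<close> carries it instead.\<close>

lemma Subst_identity:
  assumes "\<phi> \<in> Formulas"
  shows "(\<phi>, \<phi>) \<in> Subst a (Var a)"
proof -
  obtain f where f: "f \<in> A" "subformula_closed f" "\<phi> \<^bold>\<in> f"
    using subformula_closed_superset[OF assms] by blast
  note sf = subformula_closedD[OF f(2)]
  show ?thesis
    unfolding Subst_iff
  proof (intro allI impI)
    fix R assume R: "definable_rel R" "subst_closed a (Var a) R"
    note r = subst_closedD[OF R(2), unfolded sbt_simps]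
    have "\<phi> \<^bold>\<in> f \<longrightarrow> (\<phi>, \<phi>) \<in> R"
    proof (rule Formulas_induct[OF assms, of "\<lambda>x. x \<^bold>\<in> f \<longrightarrow> (x, x) \<in> R"])
      show "expressible False (\<lambda>e. e 0 \<^bold>\<in> f \<longrightarrow> (e 0, e 0) \<in> R)"
        by (rule expr_rel[OF R(1)] expr_intros)+
      show "(EQ s t \<^bold>\<in> f \<longrightarrow> (EQ s t, EQ s t) \<in> R) \<and> (IN s t \<^bold>\<in> f \<longrightarrow> (IN s t, IN s t) \<in> R)"
        if "s \<in> Terms" "t \<in> Terms" for s t using r(1,2) that by blast
      show "NOT \<theta> \<^bold>\<in> f \<longrightarrow> (NOT \<theta>, NOT \<theta>) \<in> R" if "\<theta> \<^bold>\<in> f \<longrightarrow> (\<theta>, \<theta>) \<in> R" for \<theta>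
        using r(3) sf(2) that by blast
      show "IMP \<theta> \<eta> \<^bold>\<in> f \<longrightarrow> (IMP \<theta> \<eta>, IMP \<theta> \<eta>) \<in> R"
        if "\<theta> \<^bold>\<in> f \<longrightarrow> (\<theta>, \<theta>) \<in> R" "\<eta> \<^bold>\<in> f \<longrightarrow> (\<eta>, \<eta>) \<in> R" for \<theta> \<eta>
        using r(4)[of \<theta> \<theta> \<eta> \<eta>] sf(3)[of \<theta> \<eta>] that by blast
      show "(ALL' b \<theta> \<^bold>\<in> f \<longrightarrow> (ALL' b \<theta>, ALL' b \<theta>) \<in> R) \<and> (EX' b \<theta> \<^bold>\<in> f \<longrightarrow> (EX' b \<theta>, EX' b \<theta>) \<in> R)"
        if b: "b \<in> A" and IH: "\<theta> \<^bold>\<in> f \<longrightarrow> (\<theta>, \<theta>) \<in> R" for b \<theta>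
      proof (cases "b = a")
        case True
        then show ?thesis using r(5,6)[of \<theta>] sf(1)[of \<theta>] sf(4)[of b \<theta>] by blast
      next
        case False
        then have "Var a \<noteq> Var b" by simp
        with False show ?thesis using r(7,8)[OF _ b] IH sf(4)[of b \<theta>] by blast
      qed
      show "(AND \<Phi> \<^bold>\<in> f \<longrightarrow> (AND \<Phi>, AND \<Phi>) \<in> R) \<and> (OR \<Phi> \<^bold>\<in> f \<longrightarrow> (OR \<Phi>, OR \<Phi>) \<in> R)"
        if \<Phi>: "\<Phi> \<in> A" and IH: "\<And>\<theta>. \<theta> \<^bold>\<in> \<Phi> \<Longrightarrow> \<theta> \<^bold>\<in> f \<longrightarrow> (\<theta>, \<theta>) \<in> R" for \<Phi>
      proof -
        have "(\<theta>, \<theta>) \<in> R" if "AND \<Phi> \<^bold>\<in> f \<or> OR \<Phi> \<^bold>\<in> f" "\<theta> \<^bold>\<in> \<Phi>" for \<theta>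
          using sf(5)[OF that] IH[OF that(2)] by blast
        then show ?thesis using r(9,10)[OF \<Phi> \<Phi>] by blast
      qed
    qed
    then show "(\<phi>, \<phi>) \<in> R" using f(3) by blast
  qed
qed

text \<open>Forbidding every quantifier over t inside \<open>f\<close> is a crude but bounded way to
  rule out capture. It is met by constants and by fresh variables, the two kinds of terms to which
  totality is applied.\<close>

lemma Subst_total:
  assumes "\<phi> \<in> Formulas" "v \<in> A" "t \<in> Terms" and f: "f \<in> A" "subformula_closed f" "\<phi> \<^bold>\<in> f"
    and free: "\<And>b \<theta>. ALL' b \<theta> \<^bold>\<in> f \<or> EX' b \<theta> \<^bold>\<in> f \<Longrightarrow> t \<noteq> Var b"
  shows "\<exists>\<phi>'. (\<phi>, \<phi>') \<in> Subst v t \<and> (t \<noteq> Var v \<longrightarrow> \<phi>' \<notin> Has_free v)"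
proof -
  note sf = subformula_closedD[OF f(2)]
  have "\<exists>w. w \<in> A \<and> wit v t (vupair v v) f w \<and> indom \<phi> w"
  proof (rule wit_total[where K = "\<lambda>x. x \<^bold>\<in> f"])
    show "expressible False (\<lambda>e. e 0 \<^bold>\<in> f)" by (rule expr_intros)+
    show "\<theta> \<^bold>\<in> f \<and> (b \<^bold>\<in> vupair v v \<longrightarrow> \<theta> \<^bold>\<in> f) \<and> (\<not> b \<^bold>\<in> vupair v v \<longrightarrow> t \<noteq> Var b)"
      if "ALL' b \<theta> \<^bold>\<in> f \<or> EX' b \<theta> \<^bold>\<in> f" for b \<theta>
      using sf(4)[OF that] free[OF that] by simp
    show "\<theta> \<^bold>\<in> f" if "NOT \<theta> \<^bold>\<in> f" for \<theta> using sf(2)[OF that] .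
    show "\<theta> \<^bold>\<in> f \<and> \<eta> \<^bold>\<in> f" if "IMP \<theta> \<eta> \<^bold>\<in> f" for \<theta> \<eta> using sf(3)[OF that] .
    show "\<theta> \<^bold>\<in> f" if "AND \<Phi> \<^bold>\<in> f \<or> OR \<Phi> \<^bold>\<in> f" "\<theta> \<^bold>\<in> \<Phi>" for \<Phi> \<theta> using sf(5)[OF that] .
    show "t \<in> A" using assms(3) by (rule Terms_A)
  qed (use assms(1-3) f in simp_all)
  then obtain w \<phi>' where w: "wit v t (vupair v v) f w" "w \<in> A" "vpair \<phi> \<phi>' \<^bold>\<in> w"
    unfolding indom_iff by blast
  show ?thesis using wit_Subst[OF w sf(1)] wit_not_free[OF w] by blast
qed

lemma Subst_Const:
  assumes "\<phi> \<in> Formulas" "v \<in> A" "c \<in> A"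
  obtains \<phi>' where "(\<phi>, \<phi>') \<in> Subst v (Const c)"
proof -
  obtain f where f: "f \<in> A" "subformula_closed f" "\<phi> \<^bold>\<in> f"
    using subformula_closed_superset[OF assms(1)] by blast
  have "\<exists>\<phi>'. (\<phi>, \<phi>') \<in> Subst v (Const c) \<and> (Const c \<noteq> Var v \<longrightarrow> \<phi>' \<notin> Has_free v)"
    by (rule Subst_total[OF assms(1,2) _ f]) (use assms(3) in auto)
  then show ?thesis using that by blast
qed

text \<open>The index of the new variable is a transitive set containing \<open>f\<close> and
  \<open>v\<close>: whatever occurs in a formula of \<open>f\<close> is an element of this set,
  whereas the set is not an element of itself.\<close>

lemma Subst_fresh:
  assumes "\<phi> \<in> Formulas" "v \<in> A"
  obtains u \<phi>' where "u \<in> A" "u \<noteq> v" "\<phi> \<notin> Has_free u" "(\<phi>, \<phi>') \<in> Subst v (Var u)" "\<phi>' \<notin> Has_free v"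
proof -
  obtain f where f: "f \<in> A" "subformula_closed f" "\<phi> \<^bold>\<in> f"
    using subformula_closed_superset[OF assms(1)] by blast
  have "vpair f v \<in> A" using f assms by simp
  then obtain u where u: "u \<in> A" "transitive u" "vpair f v \<^bold>\<in> u"
    using transitive_superset by blast
  have fv: "f \<^bold>\<in> u" "v \<^bold>\<in> u" using transitive_vpair[OF u(2,3)] by auto
  have uv: "u \<noteq> v" using fv mem_irrefl by blast
  have in_u: "x \<^bold>\<in> u" if "x \<^bold>\<in> f" for x using transitiveD[OF u(2) fv(1) that] .
  have nf: "\<phi> \<notin> Has_free u"
    by (rule not_free_fresh[OF u(2) in_u[OF f(3)] mem_irrefl])
  have "\<not> ALL' u \<theta> \<^bold>\<in> f" "\<not> EX' u \<theta> \<^bold>\<in> f" for \<theta>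
    using in_u[of "ALL' u \<theta>"] in_u[of "EX' u \<theta>"] mem_irrefl[of u] transitive_vpair[OF u(2)]
    unfolding ALL'_def EX'_def by blast+
  then have free: "Var u \<noteq> Var b" if "ALL' b \<theta> \<^bold>\<in> f \<or> EX' b \<theta> \<^bold>\<in> f" for b \<theta>
    using that by (metis code_inject(1))
  have "\<exists>\<phi>'. (\<phi>, \<phi>') \<in> Subst v (Var u) \<and> (Var u \<noteq> Var v \<longrightarrow> \<phi>' \<notin> Has_free v)"
    by (rule Subst_total[OF assms _ f]) (use u(1) free in auto)
  then show ?thesis using that[OF u(1) uv nf] uv by auto
qed

section \<open>Derivability\<close>

declare Formulas_rules [simp]

definition der_closed :: "'v set \<Rightarrow> 'v set \<Rightarrow> bool" where
  "der_closed T C \<longleftrightarrow>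
     T \<subseteq> C \<and> Logical_axioms \<subseteq> C \<and> Equality_axioms \<subseteq> C \<and>
     (\<forall>\<phi>\<in>Formulas. \<forall>\<psi>\<in>Formulas. \<phi> \<in> C \<and> IMP \<phi> \<psi> \<in> C \<longrightarrow> \<psi> \<in> C) \<and>
     (\<forall>\<phi>\<in>Formulas. \<forall>\<Psi>\<in>A. AND \<Psi> \<in> Formulas \<and> (\<forall>\<psi>. \<psi> \<^bold>\<in> \<Psi> \<longrightarrow> IMP \<phi> \<psi> \<in> C) \<longrightarrow>
        IMP \<phi> (AND \<Psi>) \<in> C) \<and>
     (\<forall>\<Phi>\<in>A. \<forall>\<psi>\<in>Formulas. OR \<Phi> \<in> Formulas \<and> (\<forall>\<phi>. \<phi> \<^bold>\<in> \<Phi> \<longrightarrow> IMP \<phi> \<psi> \<in> C) \<longrightarrow>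
        IMP (OR \<Phi>) \<psi> \<in> C) \<and>
     (\<forall>a\<in>A. \<forall>\<phi>\<in>Formulas. \<forall>\<psi>\<in>Formulas. \<phi> \<notin> Has_free a \<and> IMP \<phi> \<psi> \<in> C \<longrightarrow>
        IMP \<phi> (ALL' a \<psi>) \<in> C) \<and>
     (\<forall>a\<in>A. \<forall>\<phi>\<in>Formulas. \<forall>\<psi>\<in>Formulas. \<psi> \<notin> Has_free a \<and> IMP \<phi> \<psi> \<in> C \<longrightarrow>
        IMP (EX' a \<phi>) \<psi> \<in> C)"

lemma Derivable_iff: "T \<turnstile> \<phi> \<longleftrightarrow> (\<forall>C. definable_class C \<longrightarrow> der_closed T C \<longrightarrow> \<phi> \<in> C)"
proof -
  have "Derivable T = \<Inter>{C. definable_class C \<and> der_closed T C}"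
    by (simp only: Derivable_def least_class_def der_closed_def)
  then show ?thesis by blast
qed

lemma der_closedD:
  assumes "der_closed T C"
  shows "\<phi> \<in> Logical_axioms \<Longrightarrow> \<phi> \<in> C" "\<phi> \<in> Equality_axioms \<Longrightarrow> \<phi> \<in> C"
    "\<phi> \<in> C \<Longrightarrow> IMP \<phi> \<psi> \<in> C \<Longrightarrow> \<phi> \<in> Formulas \<Longrightarrow> \<psi> \<in> Formulas \<Longrightarrow> \<psi> \<in> C"
    "(\<And>\<psi>. \<psi> \<^bold>\<in> \<Psi> \<Longrightarrow> IMP \<phi> \<psi> \<in> C) \<Longrightarrow> \<phi> \<in> Formulas \<Longrightarrow> AND \<Psi> \<in> Formulas \<Longrightarrow> IMP \<phi> (AND \<Psi>) \<in> C"
    "(\<And>\<psi>. \<psi> \<^bold>\<in> \<Psi> \<Longrightarrow> IMP \<psi> \<phi> \<in> C) \<Longrightarrow> \<phi> \<in> Formulas \<Longrightarrow> OR \<Psi> \<in> Formulas \<Longrightarrow> IMP (OR \<Psi>) \<phi> \<in> C"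
    "IMP \<phi> \<psi> \<in> C \<Longrightarrow> \<phi> \<notin> Has_free a \<Longrightarrow> a \<in> A \<Longrightarrow> \<phi> \<in> Formulas \<Longrightarrow> \<psi> \<in> Formulas \<Longrightarrow> IMP \<phi> (ALL' a \<psi>) \<in> C"
    "IMP \<phi> \<psi> \<in> C \<Longrightarrow> \<psi> \<notin> Has_free a \<Longrightarrow> a \<in> A \<Longrightarrow> \<phi> \<in> Formulas \<Longrightarrow> \<psi> \<in> Formulas \<Longrightarrow> IMP (EX' a \<phi>) \<psi> \<in> C"
  by (use assms[unfolded der_closed_def, THEN conjunct2, THEN conjunct1] in blast,
    use assms[unfolded der_closed_def, THEN conjunct22, THEN conjunct1] in blast,
    use assms[unfolded der_closed_def, THEN conjunct22, THEN conjunct2, THEN conjunct1] in blast,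
    use assms[unfolded der_closed_def, THEN conjunct22, THEN conjunct22, THEN conjunct1] Formulas_A[of "AND \<Psi>"] in simp,
    use assms[unfolded der_closed_def, THEN conjunct22, THEN conjunct22, THEN conjunct2, THEN conjunct1] Formulas_A[of "OR \<Psi>"] in simp,
    use assms[unfolded der_closed_def, THEN conjunct22, THEN conjunct22, THEN conjunct22, THEN conjunct1] in blast,
    use assms[unfolded der_closed_def, THEN conjunct22, THEN conjunct22, THEN conjunct22, THEN conjunct2] in blast)

lemma der_axiom:
  "\<phi> \<in> Logical_axioms \<Longrightarrow> T \<turnstile> \<phi>" "\<phi> \<in> Equality_axioms \<Longrightarrow> T \<turnstile> \<phi>"
  unfolding Derivable_iff by (intro allI impI, erule der_closedD, assumption)+

lemma der_mp:
  assumes "T \<turnstile> \<phi>" "T \<turnstile> IMP \<phi> \<psi>" "\<phi> \<in> Formulas" "\<psi> \<in> Formulas"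
  shows "T \<turnstile> \<psi>"
  unfolding Derivable_iff
proof (intro allI impI)
  fix C assume C: "definable_class C" "der_closed T C"
  show "\<psi> \<in> C"
    by (rule der_closedD(3)[OF C(2) _ _ assms(3,4)]) (use assms(1,2) C in \<open>simp_all add: Derivable_iff\<close>)
qed

lemma der_AND2:
  assumes "\<theta> \<in> Formulas" "\<phi> \<in> Formulas" "\<psi> \<in> Formulas" "T \<turnstile> IMP \<theta> \<phi>" "T \<turnstile> IMP \<theta> \<psi>"
  shows "T \<turnstile> IMP \<theta> (AND2 \<phi> \<psi>)"
  unfolding Derivable_iff AND2_def
proof (intro allI impI)
  fix C assume C: "definable_class C" "der_closed T C"
  have "IMP \<theta> \<phi> \<in> C" "IMP \<theta> \<psi> \<in> C" using assms(4,5) C by (simp_all add: Derivable_iff)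
  then show "IMP \<theta> (AND (vupair \<phi> \<psi>)) \<in> C"
    by (intro der_closedD(4)[OF C(2) _ assms(1)])
      (use Formulas_more(1)[OF assms(2,3)] in \<open>auto simp: AND2_def\<close>)
qed

lemma der_OR2:
  assumes "\<theta> \<in> Formulas" "\<phi> \<in> Formulas" "\<psi> \<in> Formulas" "T \<turnstile> IMP \<phi> \<theta>" "T \<turnstile> IMP \<psi> \<theta>"
  shows "T \<turnstile> IMP (OR2 \<phi> \<psi>) \<theta>"
  unfolding Derivable_iff OR2_def
proof (intro allI impI)
  fix C assume C: "definable_class C" "der_closed T C"
  have "IMP \<phi> \<theta> \<in> C" "IMP \<psi> \<theta> \<in> C" using assms(4,5) C by (simp_all add: Derivable_iff)
  then show "IMP (OR (vupair \<phi> \<psi>)) \<theta> \<in> C"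
    by (intro der_closedD(5)[OF C(2) _ assms(1)])
      (use Formulas_more(2)[OF assms(2,3)] in \<open>auto simp: OR2_def\<close>)
qed

lemma der_ALL:
  assumes "T \<turnstile> IMP \<phi> \<psi>" "\<phi> \<notin> Has_free a" "a \<in> A" "\<phi> \<in> Formulas" "\<psi> \<in> Formulas"
  shows "T \<turnstile> IMP \<phi> (ALL' a \<psi>)"
  unfolding Derivable_iff
proof (intro allI impI)
  fix C assume C: "definable_class C" "der_closed T C"
  then show "IMP \<phi> (ALL' a \<psi>) \<in> C"
    using der_closedD(6)[OF C(2) _ assms(2-5)] assms(1) by (simp add: Derivable_iff)
qed

lemma der_EX:
  assumes "T \<turnstile> IMP \<phi> \<psi>" "\<psi> \<notin> Has_free a" "a \<in> A" "\<phi> \<in> Formulas" "\<psi> \<in> Formulas"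
  shows "T \<turnstile> IMP (EX' a \<phi>) \<psi>"
  unfolding Derivable_iff
proof (intro allI impI)
  fix C assume C: "definable_class C" "der_closed T C"
  then show "IMP (EX' a \<phi>) \<psi> \<in> C"
    using der_closedD(7)[OF C(2) _ assms(2-5)] assms(1) by (simp add: Derivable_iff)
qed

lemma der_logical:
  assumes "\<theta> \<in> Formulas" "\<psi> \<in> Formulas"
  shows "T \<turnstile> IMP \<theta> (IMP \<psi> \<theta>)"
    "T \<turnstile> IMP (IMP \<theta> (IMP \<theta> \<psi>)) (IMP \<theta> \<psi>)"
    "\<eta> \<in> Formulas \<Longrightarrow> T \<turnstile> IMP (IMP \<theta> \<psi>) (IMP (IMP \<psi> \<eta>) (IMP \<theta> \<eta>))"
    "T \<turnstile> IMP (IMP \<theta> \<psi>) (IMP (NOT \<psi>) (NOT \<theta>))"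
    "T \<turnstile> IMP \<theta> (NOT (NOT \<theta>))" "T \<turnstile> IMP (NOT (NOT \<theta>)) \<theta>"
  by (rule der_axiom(1), unfold Logical_axioms_def, rule UnI1, rule UnI1, rule UnI1, rule UnI1, rule UnI1, rule UnI1, rule UnI1, rule UnI1, rule UnI1, use assms in blast,
    rule der_axiom(1), unfold Logical_axioms_def, rule UnI1, rule UnI1, rule UnI1, rule UnI1, rule UnI1, rule UnI1, rule UnI1, rule UnI1, rule UnI2, use assms in blast,
    rule der_axiom(1), unfold Logical_axioms_def, rule UnI1, rule UnI1, rule UnI1, rule UnI1, rule UnI1, rule UnI1, rule UnI1, rule UnI2, use assms in blast,
    rule der_axiom(1), unfold Logical_axioms_def, rule UnI1, rule UnI1, rule UnI1, rule UnI1, rule UnI1, rule UnI1, rule UnI2, use assms in blast,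
    rule der_axiom(1), unfold Logical_axioms_def, rule UnI1, rule UnI1, rule UnI1, rule UnI1, rule UnI1, rule UnI2, use assms in blast,
    rule der_axiom(1), unfold Logical_axioms_def, rule UnI1, rule UnI1, rule UnI1, rule UnI1, rule UnI2, use assms in blast)

lemma der_junction:
  assumes "\<theta> \<in> Formulas" "\<psi> \<in> Formulas"
  shows "T \<turnstile> IMP (AND2 \<theta> \<psi>) \<theta>" "T \<turnstile> IMP (AND2 \<theta> \<psi>) \<psi>"
    "T \<turnstile> IMP \<theta> (OR2 \<theta> \<psi>)" "T \<turnstile> IMP \<psi> (OR2 \<theta> \<psi>)"
proof -
  have "vupair \<theta> \<psi> \<in> A" "AND (vupair \<theta> \<psi>) \<in> Formulas" "OR (vupair \<theta> \<psi>) \<in> Formulas"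
    "\<theta> \<^bold>\<in> vupair \<theta> \<psi>" "\<psi> \<^bold>\<in> vupair \<theta> \<psi>"
    using assms Formulas_A Formulas_more(1,2)[of \<theta> \<psi>] by (simp_all add: AND2_def OR2_def)
  then show "T \<turnstile> IMP (AND2 \<theta> \<psi>) \<theta>" "T \<turnstile> IMP (AND2 \<theta> \<psi>) \<psi>"
    "T \<turnstile> IMP \<theta> (OR2 \<theta> \<psi>)" "T \<turnstile> IMP \<psi> (OR2 \<theta> \<psi>)"
    unfolding AND2_def OR2_def
    by - (rule der_axiom(1), unfold Logical_axioms_def, rule UnI1, rule UnI1, rule UnI1, rule UnI2, blast,
      rule der_axiom(1), unfold Logical_axioms_def, rule UnI1, rule UnI1, rule UnI1, rule UnI2, blast,
      rule der_axiom(1), unfold Logical_axioms_def, rule UnI1, rule UnI1, rule UnI2, blast,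
      rule der_axiom(1), unfold Logical_axioms_def, rule UnI1, rule UnI1, rule UnI2, blast)
qed

lemma der_quantifier:
  assumes "(\<phi>, \<phi>') \<in> Subst a t" "a \<in> A" "t \<in> Terms"
  shows "T \<turnstile> IMP (ALL' a \<phi>) \<phi>'" "T \<turnstile> IMP \<phi>' (EX' a \<phi>)"
proof -
  have "\<phi> \<in> Formulas" using Subst_Formulas(1)[OF assms] .
  then show "T \<turnstile> IMP (ALL' a \<phi>) \<phi>'" "T \<turnstile> IMP \<phi>' (EX' a \<phi>)"
    by - (rule der_axiom(1), unfold Logical_axioms_def, rule UnI1, rule UnI2, use assms in blast,
      rule der_axiom(1), unfold Logical_axioms_def, rule UnI2, use assms in blast)
qed

section \<open>Maximal consistent sets for the finitary connectives\<close>

definition deductive :: "'v set \<Rightarrow> 'v set \<Rightarrow> bool" where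
  "deductive T S \<longleftrightarrow> S \<subseteq> Formulas \<and> (\<forall>\<phi>\<in>Formulas. T \<turnstile> \<phi> \<longrightarrow> \<phi> \<in> S) \<and>
     (\<forall>\<phi>\<in>Formulas. \<forall>\<psi>\<in>Formulas. \<phi> \<in> S \<longrightarrow> IMP \<phi> \<psi> \<in> S \<longrightarrow> \<psi> \<in> S)"

lemma deductiveD:
  assumes "deductive T S"
  shows "S \<subseteq> Formulas" "T \<turnstile> \<phi> \<Longrightarrow> \<phi> \<in> Formulas \<Longrightarrow> \<phi> \<in> S"
    "\<phi> \<in> S \<Longrightarrow> IMP \<phi> \<psi> \<in> S \<Longrightarrow> \<phi> \<in> Formulas \<Longrightarrow> \<psi> \<in> Formulas \<Longrightarrow> \<psi> \<in> S"
  by (rule assms[unfolded deductive_def, THEN conjunct1])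
    (rule assms[unfolded deductive_def, THEN conjunct2, THEN conjunct1, rule_format]
      assms[unfolded deductive_def, THEN conjunct22, rule_format]; assumption)+

lemma deductiveI:
  assumes "S \<subseteq> Formulas" "\<And>\<phi>. T \<turnstile> \<phi> \<Longrightarrow> \<phi> \<in> Formulas \<Longrightarrow> \<phi> \<in> S"
    "\<And>\<phi> \<psi>. \<phi> \<in> S \<Longrightarrow> IMP \<phi> \<psi> \<in> S \<Longrightarrow> \<phi> \<in> Formulas \<Longrightarrow> \<psi> \<in> Formulas \<Longrightarrow> \<psi> \<in> S"
  shows "deductive T S"
  unfolding deductive_def
  by (intro conjI ballI impI assms(1)) (rule assms(2), assumption+, rule assms(3))

lemma ded_mp:
  "deductive T S \<Longrightarrow> \<alpha> \<in> Formulas \<Longrightarrow> \<beta> \<in> Formulas \<Longrightarrow> \<alpha> \<in> S \<Longrightarrow> IMP \<alpha> \<beta> \<in> S \<Longrightarrow> \<beta> \<in> S"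
  by (rule deductiveD(3))

lemma ded_app:
  assumes "deductive T S" "T \<turnstile> IMP \<alpha> \<beta>" "\<alpha> \<in> Formulas" "\<beta> \<in> Formulas" "\<alpha> \<in> S"
  shows "\<beta> \<in> S"
  using ded_mp[OF assms(1,3-5) deductiveD(2)[OF assms(1,2)]] assms(3,4) by simp

lemma ded_K: "deductive T S \<Longrightarrow> \<alpha> \<in> Formulas \<Longrightarrow> \<beta> \<in> Formulas \<Longrightarrow> \<beta> \<in> S \<Longrightarrow> IMP \<alpha> \<beta> \<in> S"
  by (rule ded_app[OF _ der_logical(1)]) simp_all

text \<open>Transitivity of implication is used twice: it turns the first premise into a map from
  (\<beta> implies \<gamma>) to (\<alpha> implies \<gamma>), and then chains this with the second
  premise. The resulting double antecedent \<alpha> is contracted.\<close>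

lemma ded_S:
  assumes S: "deductive T S" and F: "\<alpha> \<in> Formulas" "\<beta> \<in> Formulas" "\<gamma> \<in> Formulas"
    and h: "IMP \<alpha> \<beta> \<in> S" "IMP \<alpha> (IMP \<beta> \<gamma>) \<in> S"
  shows "IMP \<alpha> \<gamma> \<in> S"
proof -
  have 1: "IMP (IMP \<beta> \<gamma>) (IMP \<alpha> \<gamma>) \<in> S"
    by (rule ded_app[OF S der_logical(3) _ _ h(1)]) (use F in simp_all)
  have "IMP (IMP (IMP \<beta> \<gamma>) (IMP \<alpha> \<gamma>)) (IMP \<alpha> (IMP \<alpha> \<gamma>)) \<in> S"
    by (rule ded_app[OF S der_logical(3) _ _ h(2)]) (use F in simp_all)
  then have 2: "IMP \<alpha> (IMP \<alpha> \<gamma>) \<in> S"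
    using ded_mp[OF S _ _ 1] F by simp
  show ?thesis by (rule ded_app[OF S der_logical(2) _ _ 2]) (use F in simp_all)
qed

lemma ded_contrapos:
  "deductive T S \<Longrightarrow> \<alpha> \<in> Formulas \<Longrightarrow> \<beta> \<in> Formulas \<Longrightarrow> IMP \<alpha> \<beta> \<in> S \<Longrightarrow> IMP (NOT \<beta>) (NOT \<alpha>) \<in> S"
  by (rule ded_app[OF _ der_logical(4)]) simp_all

lemma ded_dni: "deductive T S \<Longrightarrow> \<alpha> \<in> Formulas \<Longrightarrow> \<alpha> \<in> S \<Longrightarrow> NOT (NOT \<alpha>) \<in> S"
  by (rule ded_app[OF _ der_logical(5)]) simp_all

lemma ded_dne: "deductive T S \<Longrightarrow> \<alpha> \<in> Formulas \<Longrightarrow> NOT (NOT \<alpha>) \<in> S \<Longrightarrow> \<alpha> \<in> S"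
  by (rule ded_app[OF _ der_logical(6)]) simp_all

lemma ded_exfalso:
  assumes S: "deductive T S" and F: "\<alpha> \<in> Formulas" "\<beta> \<in> Formulas" and h: "\<alpha> \<in> S" "NOT \<alpha> \<in> S"
  shows "\<beta> \<in> S"
proof (rule ded_dne[OF S F(2)])
  have "IMP (NOT \<beta>) \<alpha> \<in> S" by (rule ded_K[OF S]) (use F h in simp_all)
  then have "IMP (NOT \<alpha>) (NOT (NOT \<beta>)) \<in> S" by (intro ded_contrapos[OF S]) (use F in simp_all)
  then show "NOT (NOT \<beta>) \<in> S" using ded_mp[OF S _ _ h(2)] F by simp
qed

lemma ded_refl: "deductive T S \<Longrightarrow> \<alpha> \<in> Formulas \<Longrightarrow> IMP \<alpha> \<alpha> \<in> S"
  by (rule ded_app[OF _ der_logical(2)]) (simp_all add: deductiveD(2) der_logical(1))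

text \<open>This is the deduction theorem: the formulas implied by \<theta> within S form the
  extension of S by the hypothesis \<theta>.\<close>

lemma deductive_extend:
  assumes S: "deductive T S" and \<theta>: "\<theta> \<in> Formulas"
  shows "deductive T {\<eta> \<in> Formulas. IMP \<theta> \<eta> \<in> S}"
    "S \<subseteq> {\<eta> \<in> Formulas. IMP \<theta> \<eta> \<in> S}" "\<theta> \<in> {\<eta> \<in> Formulas. IMP \<theta> \<eta> \<in> S}"
proof -
  let ?S' = "{\<eta> \<in> Formulas. IMP \<theta> \<eta> \<in> S}"
  note sub = deductiveD(1)[OF S] and th = deductiveD(2)[OF S]
  show incl: "S \<subseteq> ?S'" using ded_K[OF S \<theta>] sub by blast
  show "deductive T ?S'"
  proof (rule deductiveI)
    show "\<phi> \<in> ?S'" if "T \<turnstile> \<phi>" "\<phi> \<in> Formulas" for \<phi> using th[OF that] incl by (rule rev_subsetD)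
    show "\<psi> \<in> ?S'" if "\<phi> \<in> ?S'" "IMP \<phi> \<psi> \<in> ?S'" "\<phi> \<in> Formulas" "\<psi> \<in> Formulas" for \<phi> \<psi>
      using ded_S[OF S \<theta> that(3,4)] that by simp
  qed simp
  show "\<theta> \<in> ?S'" using ded_refl[OF S \<theta>] \<theta> by simp
qed

text \<open>Truth tables are imposed for \<open>NOT\<close> and \<open>IMP\<close> only. Quantified
  formulas and infinite junctions are treated like atoms, so the rules for them have to be applied
  to theorems of \<open>T\<close>.\<close>

definition ultra :: "'v set \<Rightarrow> 'v set \<Rightarrow> bool" where
  "ultra T M \<longleftrightarrow> (\<forall>\<phi>\<in>Formulas. T \<turnstile> \<phi> \<longrightarrow> \<phi> \<in> M) \<and>
     (\<forall>\<phi>\<in>Formulas. NOT \<phi> \<in> M \<longleftrightarrow> \<phi> \<notin> M) \<and>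
     (\<forall>\<phi>\<in>Formulas. \<forall>\<psi>\<in>Formulas. IMP \<phi> \<psi> \<in> M \<longleftrightarrow> (\<phi> \<in> M \<longrightarrow> \<psi> \<in> M))"

text \<open>A deductive set that is maximal among those omitting \<phi> is already
  \<open>ultra\<close>. Zorn's lemma applies because modus ponens, the only closure rule imposed, is
  finitary, so the union of a nonempty chain stays deductive. Truth tables thereby replace
  calculations in the Hilbert calculus.\<close>

lemma ultra_complete:
  assumes \<phi>: "\<phi> \<in> Formulas" and all: "\<And>M. ultra T M \<Longrightarrow> \<phi> \<in> M"
  shows "T \<turnstile> \<phi>"
proof (rule ccontr)
  assume n: "\<not> T \<turnstile> \<phi>"
  let ?F = "{S. deductive T S \<and> \<phi> \<notin> S}"
  have "{\<eta> \<in> Formulas. T \<turnstile> \<eta>} \<in> ?F"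
  proof -
    have "deductive T {\<eta> \<in> Formulas. T \<turnstile> \<eta>}"
    proof (rule deductiveI)
      show "\<beta> \<in> {\<eta> \<in> Formulas. T \<turnstile> \<eta>}"
        if "\<alpha> \<in> {\<eta> \<in> Formulas. T \<turnstile> \<eta>}" "IMP \<alpha> \<beta> \<in> {\<eta> \<in> Formulas. T \<turnstile> \<eta>}"
          "\<alpha> \<in> Formulas" "\<beta> \<in> Formulas" for \<alpha> \<beta>
        using that der_mp[where \<phi> = \<alpha> and \<psi> = \<beta>] by simp
    qed simp_all
    then show ?thesis using n by simp
  qed
  then have ne: "?F \<noteq> {}" by blast
  have "\<exists>M\<in>?F. \<forall>X\<in>?F. M \<subseteq> X \<longrightarrow> X = M"
  proof (rule subset_Zorn_nonempty[OF ne])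
    fix C assume C: "C \<noteq> {}" "subset.chain ?F C"
    have CF: "deductive T S \<and> \<phi> \<notin> S" if "S \<in> C" for S
      using C(2) that unfolding subset.chain_def by blast
    have lin: "S \<subseteq> S' \<or> S' \<subseteq> S" if "S \<in> C" "S' \<in> C" for S S'
      using C(2) that unfolding subset.chain_def by blast
    have "deductive T (\<Union>C)"
    proof (rule deductiveI)
      show "\<Union>C \<subseteq> Formulas" using CF deductiveD(1) by blast
      obtain S0 where "S0 \<in> C" using C(1) by blast
      then show "\<eta> \<in> \<Union>C" if "T \<turnstile> \<eta>" "\<eta> \<in> Formulas" for \<eta>
        using deductiveD(2)[of T S0 \<eta>] CF that by blast
      show "\<beta> \<in> \<Union>C" if U: "\<alpha> \<in> \<Union>C" "IMP \<alpha> \<beta> \<in> \<Union>C" and F: "\<alpha> \<in> Formulas" "\<beta> \<in> Formulas" for \<alpha> \<beta>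
      proof -
        obtain S S' where S: "S \<in> C" "S' \<in> C" "\<alpha> \<in> S" "IMP \<alpha> \<beta> \<in> S'" using U by blast
        obtain S'' where "S'' \<in> C" "\<alpha> \<in> S''" "IMP \<alpha> \<beta> \<in> S''" using lin[OF S(1,2)] S by blast
        then show ?thesis using ded_mp[of T S'', OF _ F] CF by blast
      qed
    qed
    then show "\<Union>C \<in> ?F" using CF by blast
  qed
  then obtain M where M: "deductive T M" "\<phi> \<notin> M" and
    max: "\<And>X. deductive T X \<Longrightarrow> \<phi> \<notin> X \<Longrightarrow> M \<subseteq> X \<Longrightarrow> X = M" by blast
  \<comment> \<open>By maximality, extending the set by \<theta> must bring in \<phi>.\<close>
  have out: "IMP \<theta> \<phi> \<in> M" if "\<theta> \<in> Formulas" "\<theta> \<notin> M" for \<theta>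
    using max[OF deductive_extend(1)[OF M(1) that(1)]] deductive_extend(2,3)[OF M(1) that(1)] that(2) \<phi> by blast
  have not: "NOT \<theta> \<in> M \<longleftrightarrow> \<theta> \<notin> M" if \<theta>: "\<theta> \<in> Formulas" for \<theta>
  proof
    assume "NOT \<theta> \<in> M" then show "\<theta> \<notin> M" using ded_exfalso[OF M(1) \<theta> \<phi>] M(2) by blast
  next
    assume 1: "\<theta> \<notin> M"
    show "NOT \<theta> \<in> M"
    proof (rule ccontr)
      assume 2: "NOT \<theta> \<notin> M"
      have N: "NOT \<phi> \<in> Formulas" "NOT \<theta> \<in> Formulas" using \<phi> \<theta> by simp_all
      let ?S = "{\<eta> \<in> Formulas. IMP (NOT \<phi>) \<eta> \<in> M}"
      have S: "deductive T ?S" "M \<subseteq> ?S" "NOT \<phi> \<in> ?S"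
        using deductive_extend[OF M(1) N(1)] by blast+
      have "IMP (NOT \<phi>) (NOT (NOT \<theta>)) \<in> M"
        using ded_contrapos[OF M(1) N(2) \<phi> out[OF N(2) 2]] .
      then have "NOT (NOT \<theta>) \<in> ?S" using \<theta> by simp
      then have "\<theta> \<in> ?S" using ded_dne[OF S(1) \<theta>] by blast
      moreover have "IMP \<theta> \<phi> \<in> ?S" using out[OF \<theta> 1] S(2) by blast
      ultimately have "\<phi> \<in> ?S" using ded_mp[OF S(1) \<theta> \<phi>] by blast
      \<comment> \<open>The extension by \<open>NOT \<phi>\<close> is inconsistent, so it contains
        every formula. The negation of a theorem is chosen because contraposition then yields
        \<open>NOT (NOT \<phi>)\<close> in the original set.\<close>
      then have "NOT (IMP \<phi> \<phi>) \<in> ?S" using ded_exfalso[OF S(1) \<phi>, of "NOT (IMP \<phi> \<phi>)"] S(3) \<phi> by simp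
      then have "IMP (NOT \<phi>) (NOT (IMP \<phi> \<phi>)) \<in> M" by blast
      then have c: "IMP (NOT (NOT (IMP \<phi> \<phi>))) (NOT (NOT \<phi>)) \<in> M"
        by (rule ded_contrapos[OF M(1), rotated -1]) (use \<phi> in simp_all)
      have "NOT (NOT (IMP \<phi> \<phi>)) \<in> M"
        by (rule ded_dni[OF M(1)]) (use \<phi> ded_refl[OF M(1) \<phi>] in simp_all)
      then have "NOT (NOT \<phi>) \<in> M"
        using ded_mp[OF M(1) _ _ _ c] \<phi> by simp
      then show False using ded_dne[OF M(1) \<phi>] M(2) by blast
    qed
  qed
  have imp: "IMP \<theta> \<psi> \<in> M \<longleftrightarrow> (\<theta> \<in> M \<longrightarrow> \<psi> \<in> M)" if F: "\<theta> \<in> Formulas" "\<psi> \<in> Formulas" for \<theta> \<psi>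
  proof
    assume "IMP \<theta> \<psi> \<in> M" then show "\<theta> \<in> M \<longrightarrow> \<psi> \<in> M" using ded_mp[OF M(1) F] by blast
  next
    assume h: "\<theta> \<in> M \<longrightarrow> \<psi> \<in> M"
    show "IMP \<theta> \<psi> \<in> M"
    proof (cases "\<theta> \<in> M")
      case True then show ?thesis using ded_K[OF M(1) F] h by blast
    next
      case False
      then have "NOT \<theta> \<in> M" using not[OF F(1)] by blast
      then show ?thesis
        using ded_exfalso[OF deductive_extend(1)[OF M(1) F(1)] F] deductive_extend(2,3)[OF M(1) F(1)] by blast
    qed
  qed
  have "ultra T M"
    unfolding ultra_def using deductiveD(2)[OF M(1)] not imp by simp
  then show False using all M(2) by blast
qed

lemma ultra_theorem: "ultra T M \<Longrightarrow> T \<turnstile> \<phi> \<Longrightarrow> \<phi> \<in> Formulas \<Longrightarrow> \<phi> \<in> M"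
  unfolding ultra_def by simp

lemma ultra_NOT: "ultra T M \<Longrightarrow> \<phi> \<in> Formulas \<Longrightarrow> NOT \<phi> \<in> M \<longleftrightarrow> \<phi> \<notin> M"
  unfolding ultra_def by simp

lemma ultra_IMP:
  "ultra T M \<Longrightarrow> \<phi> \<in> Formulas \<Longrightarrow> \<psi> \<in> Formulas \<Longrightarrow> IMP \<phi> \<psi> \<in> M \<longleftrightarrow> (\<phi> \<in> M \<longrightarrow> \<psi> \<in> M)"
  unfolding ultra_def by simp

lemma ultra_AND2:
  assumes M: "ultra T M" and F: "\<phi> \<in> Formulas" "\<psi> \<in> Formulas"
  shows "AND2 \<phi> \<psi> \<in> M \<longleftrightarrow> \<phi> \<in> M \<and> \<psi> \<in> M"
proof
  assume "AND2 \<phi> \<psi> \<in> M"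
  then show "\<phi> \<in> M \<and> \<psi> \<in> M"
    using ultra_theorem[OF M der_junction(1)[OF F]] ultra_theorem[OF M der_junction(2)[OF F]] F
    by (simp add: ultra_IMP[OF M])
next
  assume h: "\<phi> \<in> M \<and> \<psi> \<in> M"
  \<comment> \<open>The introduction rule for conjunctions acts on theorems, not on members of
    \<open>M\<close>. An antecedent built from \<open>NOT\<close> and \<open>IMP\<close> that is
    equivalent to the conjunction turns the rule into a theorem to be used in
    \<open>M\<close>.\<close>
  have "T \<turnstile> IMP (NOT (IMP \<phi> (NOT \<psi>))) \<phi>" "T \<turnstile> IMP (NOT (IMP \<phi> (NOT \<psi>))) \<psi>"
    by (rule ultra_complete; use F in \<open>simp add: ultra_IMP ultra_NOT\<close>)+
  then have "T \<turnstile> IMP (NOT (IMP \<phi> (NOT \<psi>))) (AND2 \<phi> \<psi>)"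
    by (intro der_AND2) (use F in simp_all)
  from ultra_theorem[OF M this] show "AND2 \<phi> \<psi> \<in> M"
    using h F by (simp add: ultra_IMP[OF M] ultra_NOT[OF M])
qed

lemma ultra_OR2:
  assumes M: "ultra T M" and F: "\<phi> \<in> Formulas" "\<psi> \<in> Formulas"
  shows "OR2 \<phi> \<psi> \<in> M \<longleftrightarrow> \<phi> \<in> M \<or> \<psi> \<in> M"
proof
  assume h: "OR2 \<phi> \<psi> \<in> M"
  \<comment> \<open>Dually, the elimination rule for disjunctions needs a succedent that expresses
    the disjunction by \<open>NOT\<close> and \<open>IMP\<close>.\<close>
  have "T \<turnstile> IMP \<phi> (IMP (NOT \<phi>) \<psi>)" "T \<turnstile> IMP \<psi> (IMP (NOT \<phi>) \<psi>)"
    by (rule ultra_complete; use F in \<open>simp add: ultra_IMP ultra_NOT\<close>)+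
  then have "T \<turnstile> IMP (OR2 \<phi> \<psi>) (IMP (NOT \<phi>) \<psi>)"
    by (intro der_OR2) (use F in simp_all)
  from ultra_theorem[OF M this] show "\<phi> \<in> M \<or> \<psi> \<in> M"
    using h F by (auto simp add: ultra_IMP[OF M] ultra_NOT[OF M])
next
  assume "\<phi> \<in> M \<or> \<psi> \<in> M"
  then show "OR2 \<phi> \<psi> \<in> M"
    using ultra_theorem[OF M der_junction(3)[OF F]] ultra_theorem[OF M der_junction(4)[OF F]] F
    by (auto simp add: ultra_IMP[OF M])
qed

lemma ultra_IFF:
  "ultra T M \<Longrightarrow> \<phi> \<in> Formulas \<Longrightarrow> \<psi> \<in> Formulas \<Longrightarrow> IFF \<phi> \<psi> \<in> M \<longleftrightarrow> (\<phi> \<in> M \<longleftrightarrow> \<psi> \<in> M)"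
  unfolding IFF_def by (auto simp add: ultra_AND2 ultra_IMP)

lemmas ultra_simps = ultra_NOT ultra_IMP ultra_AND2 ultra_OR2 ultra_IFF

section \<open>Generalization, instantiation and equality of arbitrary terms\<close>

lemma der_gen:
  assumes "T \<turnstile> \<phi>" "\<phi> \<in> Formulas" "a \<in> A"
  shows "T \<turnstile> ALL' a \<phi>"
proof -
  \<comment> \<open>The rule for universal quantifiers needs an implication whose antecedent does
    not contain \<open>Var a\<close>; a provable implication between closed formulas provides
    one.\<close>
  define \<eta> where "\<eta> = EQ (Const a) (Const a)"
  have \<eta>: "\<eta> \<in> Formulas" "\<eta> \<notin> Has_free a" using assms(3) by (simp_all add: \<eta>_def not_free_atomic)
  have 1: "T \<turnstile> IMP \<eta> \<eta>" and 2: "T \<turnstile> IMP (IMP \<eta> \<eta>) \<phi>"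
    by (rule ultra_complete; use \<eta> assms in \<open>simp add: ultra_simps ultra_theorem\<close>)+
  have "T \<turnstile> IMP (IMP \<eta> \<eta>) (ALL' a \<phi>)"
    by (rule der_ALL[OF 2]) (use assms \<eta> in \<open>simp_all add: not_free_intros\<close>)
  then show ?thesis by (rule der_mp[OF 1]) (use assms \<eta> in simp_all)
qed

lemma der_inst_ALL:
  assumes "T \<turnstile> ALL' a \<phi>" "(\<phi>, \<phi>') \<in> Subst a t" "a \<in> A" "t \<in> Terms"
  shows "T \<turnstile> \<phi>'"
  by (rule der_mp[OF assms(1) der_quantifier(1)[OF assms(2-4)]])
    (use Subst_Formulas[OF assms(2-4)] assms in simp_all)

lemma der_inst:
  assumes "T \<turnstile> \<phi>" "(\<phi>, \<phi>') \<in> Subst a t" "a \<in> A" "t \<in> Terms"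
  shows "T \<turnstile> \<phi>'"
  by (rule der_inst_ALL[OF der_gen assms(2-4)]) (use Subst_Formulas[OF assms(2-4)] assms in simp_all)

lemma ultra_ALL:
  assumes M: "ultra T M" and "ALL' a \<phi> \<in> M" "(\<phi>, \<phi>') \<in> Subst a t" "a \<in> A" "t \<in> Terms"
  shows "\<phi>' \<in> M"
  using ultra_theorem[OF M der_quantifier(1)[OF assms(3-5)]] ultra_IMP[OF M]
    Subst_Formulas[OF assms(3-5)] assms by simp

lemma ultra_EX:
  assumes M: "ultra T M" and "\<phi>' \<in> M" "(\<phi>, \<phi>') \<in> Subst a t" "a \<in> A" "t \<in> Terms"
  shows "EX' a \<phi> \<in> M"
  using ultra_theorem[OF M der_quantifier(2)[OF assms(3-5)]] ultra_IMP[OF M]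
    Subst_Formulas[OF assms(3-5)] assms by simp

lemma fresh_Var:
  assumes "a \<in> A" "finite F"
  obtains x where "x \<in> A" "Var x \<notin> F"
proof -
  have "infinite (range (\<lambda>n. Var (tag n)))"
    using finite_imageD[of "\<lambda>n. Var (tag n)" "UNIV :: nat set"] by (auto simp: inj_on_def)
  then have "\<not> range (\<lambda>n. Var (tag n)) \<subseteq> F" using finite_subset assms(2) by metis
  then obtain n where "Var (tag n) \<notin> F" by auto
  then show ?thesis using that tag_A[OF assms(1)] by blast
qed

lemma der_equality:
  assumes "a \<in> A" "b \<in> A" "c \<in> A"
  shows "T \<turnstile> EQ (Var a) (Var a)" "T \<turnstile> IMP (EQ (Var a) (Var b)) (EQ (Var b) (Var a))"
    "T \<turnstile> IMP (EQ (Var a) (Var b)) (IMP (EQ (Var b) (Var c)) (EQ (Var a) (Var c)))"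
  by (rule der_axiom(2), unfold Equality_axioms_def, rule UnI1, rule UnI1, rule UnI1, use assms in blast,
    rule der_axiom(2), unfold Equality_axioms_def, rule UnI1, rule UnI1, rule UnI2, use assms in blast,
    rule der_axiom(2), unfold Equality_axioms_def, rule UnI1, rule UnI2, use assms in blast)

lemma der_Leibniz:
  assumes "a \<in> A" "b \<in> A" "c \<in> A" "(\<phi>, \<phi>a) \<in> Subst c (Var a)" "(\<phi>, \<phi>b) \<in> Subst c (Var b)"
  shows "T \<turnstile> IMP (EQ (Var a) (Var b)) (IMP \<phi>a \<phi>b)"
proof -
  have "\<phi> \<in> Formulas" using Subst_Formulas(1)[OF assms(4,3)] assms(1) by simp
  then show ?thesis
    by (intro der_axiom(2), unfold Equality_axioms_def, intro UnI2) (use assms in blast)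
qed

text \<open>The equality axioms concern variables only. Terms are substituted one at a time,
  starting from variables that occur in neither term, so that a later substitution leaves the terms
  already inserted unchanged.\<close>

lemma der_EQ:
  assumes s: "s \<in> Terms" and t: "t \<in> Terms"
  shows der_EQ_refl: "T \<turnstile> EQ s s" and der_EQ_sym: "T \<turnstile> IMP (EQ s t) (EQ t s)"
proof -
  have sA: "s \<in> A" using s by (rule Terms_A)
  obtain x where x: "x \<in> A" "Var x \<notin> {s, t}" using fresh_Var[OF sA, of "{s, t}"] by auto
  obtain y where y: "y \<in> A" "Var y \<notin> {s, t, Var x}" using fresh_Var[OF sA, of "{s, t, Var x}"] by auto
  have ne: "x \<noteq> y" "y \<noteq> x" "s \<noteq> Var y" "t \<noteq> Var x" "s \<noteq> Var x" "t \<noteq> Var y" using x y by auto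
  have "(EQ (Var x) (Var x), EQ (sbt x s (Var x)) (sbt x s (Var x))) \<in> Subst x s"
    by (rule Subst_intros) (use x in simp_all)
  then show "T \<turnstile> EQ s s"
    using der_inst[OF der_equality(1)[OF x(1) x(1) x(1)] _ x(1) s] by simp
  have "(IMP (EQ (Var x) (Var y)) (EQ (Var y) (Var x)),
     IMP (EQ (sbt x s (Var x)) (sbt x s (Var y))) (EQ (sbt x s (Var y)) (sbt x s (Var x)))) \<in> Subst x s"
    by (intro Subst_intros) (use x y in simp_all)
  then have 1: "T \<turnstile> IMP (EQ s (Var y)) (EQ (Var y) s)"
    using der_inst[OF der_equality(2)[OF x(1) y(1) y(1)] _ x(1) s] ne by simp
  have "(IMP (EQ s (Var y)) (EQ (Var y) s),
     IMP (EQ (sbt y t s) (sbt y t (Var y))) (EQ (sbt y t (Var y)) (sbt y t s))) \<in> Subst y t"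
    by (intro Subst_intros) (use s y in simp_all)
  then show "T \<turnstile> IMP (EQ s t) (EQ t s)"
    using der_inst[OF 1 _ y(1) t] ne by simp
qed

lemma der_EQ3:
  assumes s: "s \<in> Terms" and t: "t \<in> Terms" and r: "r \<in> Terms"
  shows der_EQ_trans: "T \<turnstile> IMP (EQ s t) (IMP (EQ t r) (EQ s r))"
    and der_EQ_IN_left: "T \<turnstile> IMP (EQ s t) (IMP (IN s r) (IN t r))"
    and der_EQ_IN_right: "T \<turnstile> IMP (EQ s t) (IMP (IN r s) (IN r t))"
proof -
  have sA: "s \<in> A" using s by (rule Terms_A)
  obtain x where x: "x \<in> A" "Var x \<notin> {s, t, r}" using fresh_Var[OF sA, of "{s, t, r}"] by auto
  obtain y where y: "y \<in> A" "Var y \<notin> {s, t, r, Var x}"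
    using fresh_Var[OF sA, of "{s, t, r, Var x}"] by auto
  obtain z where z: "z \<in> A" "Var z \<notin> {s, t, r, Var x, Var y}"
    using fresh_Var[OF sA, of "{s, t, r, Var x, Var y}"] by auto
  \<comment> \<open>The variable \<open>w\<close> marks the place of replacement in the Leibniz
    axiom, while x, y, z are placeholders for s, t, r.\<close>
  obtain w where w: "w \<in> A" "Var w \<notin> {s, t, r, Var x, Var y, Var z}"
    using fresh_Var[OF sA, of "{s, t, r, Var x, Var y, Var z}"] by auto
  have ne: "x \<noteq> y" "y \<noteq> x" "x \<noteq> z" "z \<noteq> x" "y \<noteq> z" "z \<noteq> y" "w \<noteq> x" "x \<noteq> w" "w \<noteq> y" "y \<noteq> w" "w \<noteq> z" "z \<noteq> w"
    "s \<noteq> Var x" "s \<noteq> Var y" "s \<noteq> Var z" "t \<noteq> Var x" "t \<noteq> Var y" "t \<noteq> Var z" "r \<noteq> Var x" "r \<noteq> Var y" "r \<noteq> Var z"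
    using x y z w by auto
  \<comment> \<open>Here \<open>Q\<close> and \<open>Q'\<close> abstract the two atomic formulas, so
    that transitivity and both congruences for \<open>IN\<close> arise from the same three
    substitutions.\<close>
  have *: "T \<turnstile> IMP (EQ s t) (IMP (Q t r s) (Q' t r s))"
    if th: "T \<turnstile> IMP (EQ (Var x) (Var y)) (IMP (Q (Var y) (Var z) (Var x)) (Q' (Var y) (Var z) (Var x)))"
    and Q: "\<And>a u t1 t2 t3. t1 \<in> Terms \<Longrightarrow> t2 \<in> Terms \<Longrightarrow> t3 \<in> Terms \<Longrightarrow>
      (Q t1 t2 t3, Q (sbt a u t1) (sbt a u t2) (sbt a u t3)) \<in> Subst a u"
    and Q': "\<And>a u t1 t2 t3. t1 \<in> Terms \<Longrightarrow> t2 \<in> Terms \<Longrightarrow> t3 \<in> Terms \<Longrightarrow>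
      (Q' t1 t2 t3, Q' (sbt a u t1) (sbt a u t2) (sbt a u t3)) \<in> Subst a u" for Q Q'
  proof -
    have I: "(IMP (EQ t3 t1) (IMP (Q t1 t2 t3) (Q' t1 t2 t3)),
       IMP (EQ (sbt a u t3) (sbt a u t1)) (IMP (Q (sbt a u t1) (sbt a u t2) (sbt a u t3)) (Q' (sbt a u t1) (sbt a u t2) (sbt a u t3)))) \<in> Subst a u"
      if "t1 \<in> Terms" "t2 \<in> Terms" "t3 \<in> Terms" for a u t1 t2 t3
      by (intro Subst_intros Q Q' that)
    have 1: "T \<turnstile> IMP (EQ s (Var y)) (IMP (Q (Var y) (Var z) s) (Q' (Var y) (Var z) s))"
      using der_inst[OF th I[where a = x and u = s] x(1) s] x y z ne by simp
    have 2: "T \<turnstile> IMP (EQ s t) (IMP (Q t (Var z) s) (Q' t (Var z) s))"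
      using der_inst[OF 1 I[where a = y and u = t] y(1) t] s y z ne by simp
    show ?thesis
      using der_inst[OF 2 I[where a = z and u = r] z(1) r] s t z ne by simp
  qed
  show "T \<turnstile> IMP (EQ s t) (IMP (EQ t r) (EQ s r))"
    by (rule *[of "\<lambda>t r s. EQ t r" "\<lambda>t r s. EQ s r", OF der_equality(3)[OF x(1) y(1) z(1)]];
      rule Subst_intros; assumption)
  have th: "T \<turnstile> IMP (EQ (Var x) (Var y)) (IMP (IN (Var x) (Var z)) (IN (Var y) (Var z)))"
  proof (rule der_Leibniz[OF x(1) y(1) w(1)])
    show "(IN (Var w) (Var z), IN (Var x) (Var z)) \<in> Subst w (Var x)"
      using Subst_intros(2)[of "Var w" "Var z" w "Var x"] w z ne by simp
    show "(IN (Var w) (Var z), IN (Var y) (Var z)) \<in> Subst w (Var y)"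
      using Subst_intros(2)[of "Var w" "Var z" w "Var y"] w z ne by simp
  qed
  show "T \<turnstile> IMP (EQ s t) (IMP (IN s r) (IN t r))"
    by (rule *[of "\<lambda>t r s. IN s r" "\<lambda>t r s. IN t r", OF th]; rule Subst_intros; assumption)
  have th: "T \<turnstile> IMP (EQ (Var x) (Var y)) (IMP (IN (Var z) (Var x)) (IN (Var z) (Var y)))"
  proof (rule der_Leibniz[OF x(1) y(1) w(1)])
    show "(IN (Var z) (Var w), IN (Var z) (Var x)) \<in> Subst w (Var x)"
      using Subst_intros(2)[of "Var z" "Var w" w "Var x"] w z ne by simp
    show "(IN (Var z) (Var w), IN (Var z) (Var y)) \<in> Subst w (Var y)"
      using Subst_intros(2)[of "Var z" "Var w" w "Var y"] w z ne by simp
  qed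
  show "T \<turnstile> IMP (EQ s t) (IMP (IN r s) (IN r t))"
    by (rule *[of "\<lambda>t r s. IN r s" "\<lambda>t r s. IN r t", OF th]; rule Subst_intros; assumption)
qed

lemma ultra_equality:
  assumes M: "ultra T M" and s: "s \<in> Terms" and t: "t \<in> Terms"
  shows ultra_refl: "EQ s s \<in> M"
    and ultra_sym: "EQ s t \<in> M \<Longrightarrow> EQ t s \<in> M"
    and ultra_trans: "r \<in> Terms \<Longrightarrow> EQ s t \<in> M \<Longrightarrow> EQ t r \<in> M \<Longrightarrow> EQ s r \<in> M"
    and ultra_IN_left: "r \<in> Terms \<Longrightarrow> EQ s t \<in> M \<Longrightarrow> IN s r \<in> M \<Longrightarrow> IN t r \<in> M"
    and ultra_IN_right: "r \<in> Terms \<Longrightarrow> EQ s t \<in> M \<Longrightarrow> IN r s \<in> M \<Longrightarrow> IN r t \<in> M"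
proof -
  note th = ultra_theorem[OF M] and sim = ultra_IMP[OF M]
  show "EQ s s \<in> M" using th[OF der_EQ_refl[OF s t]] s by simp
  show "EQ s t \<in> M \<Longrightarrow> EQ t s \<in> M" using th[OF der_EQ_sym[OF s t]] s t by (simp add: sim)
  assume r: "r \<in> Terms"
  show "EQ s t \<in> M \<Longrightarrow> EQ t r \<in> M \<Longrightarrow> EQ s r \<in> M" using th[OF der_EQ_trans[OF s t r]] s t r by (simp add: sim)
  show "EQ s t \<in> M \<Longrightarrow> IN s r \<in> M \<Longrightarrow> IN t r \<in> M" using th[OF der_EQ_IN_left[OF s t r]] s t r by (simp add: sim)
  show "EQ s t \<in> M \<Longrightarrow> IN r s \<in> M \<Longrightarrow> IN r t \<in> M" using th[OF der_EQ_IN_right[OF s t r]] s t r by (simp add: sim)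
qed

lemma der_EX_EQ:
  assumes "z \<in> A" "d \<in> A"
  shows "T \<turnstile> EX' z (EQ (Var z) (Const d))"
proof (rule der_mp[OF der_EQ_refl[of "Const d" "Const d"] der_quantifier(2)])
  show "(EQ (Var z) (Const d), EQ (Const d) (Const d)) \<in> Subst z (Const d)"
    using Subst_intros(1)[of "Var z" "Const d" z "Const d"] assms by simp
qed (use assms in simp_all)

text \<open>A variable may be introduced as a name of a constant and discharged again. This makes
  results about variables usable for constants without substituting into the formulas.\<close>

lemma der_EX_EQ_elim:
  assumes "T \<turnstile> IMP (EQ (Var z) (Const d)) \<phi>" "\<phi> \<notin> Has_free z" "z \<in> A" "d \<in> A" "\<phi> \<in> Formulas"
  shows "T \<turnstile> \<phi>"
  by (rule der_mp[OF der_EX_EQ[OF assms(3,4)] der_EX[OF assms(1-3)]]) (use assms in simp_all)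

section \<open>The diagonal formula\<close>

lemma der_R_axioms:
  assumes T: "extends T KP_A"
  shows der_IN_Const: "p \<in> A \<Longrightarrow> a \<in> A \<Longrightarrow> p \<^bold>\<in> a \<Longrightarrow> T \<turnstile> IN (Const p) (Const a)"
    and der_IN_vupair: "w \<in> A \<Longrightarrow> p \<in> A \<Longrightarrow> q \<in> A \<Longrightarrow>
      T \<turnstile> BALL w (Const (vupair p q)) (OR2 (EQ (Var w) (Const p)) (EQ (Var w) (Const q)))"
proof -
  have T: "\<phi> \<in> R_axioms \<Longrightarrow> T \<turnstile> \<phi>" for \<phi> using T unfolding extends_def KP_A_def by blast
  show "T \<turnstile> IN (Const p) (Const a)" if "p \<in> A" "a \<in> A" "p \<^bold>\<in> a"
    by (rule T, unfold R_axioms_def, rule UnI1, rule UnI1, use that in blast)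
  show "T \<turnstile> BALL w (Const (vupair p q)) (OR2 (EQ (Var w) (Const p)) (EQ (Var w) (Const q)))"
    if A: "w \<in> A" "p \<in> A" "q \<in> A"
  proof -
    let ?\<Phi> = "vupair (EQ (Var w) (Const p)) (EQ (Var w) (Const q))"
    have "?\<Phi> \<in> A" "vupair p q \<in> A" using A by simp_all
    moreover have "\<forall>\<phi>. \<phi> \<^bold>\<in> ?\<Phi> \<longleftrightarrow> (\<exists>b. b \<^bold>\<in> vupair p q \<and> \<phi> = EQ (Var w) (Const b))" by auto
    ultimately show ?thesis
      unfolding OR2_def by (intro T, unfold R_axioms_def, intro UnI2) (use A(1) in blast)
  qed
qed

lemma der_extensionality:
  assumes T: "extends T KP_A" and A: "x \<in> A" "y \<in> A" "z \<in> A" and ne: "x \<noteq> y" "x \<noteq> z" "y \<noteq> z"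
  shows "T \<turnstile> ALL' x (ALL' y (IMP (ALL' z (IFF (IN (Var z) (Var x)) (IN (Var z) (Var y)))) (EQ (Var x) (Var y))))"
    (is "T \<turnstile> ?\<phi>")
proof -
  have F: "?\<phi> \<in> Formulas" using A by simp
  \<comment> \<open>Axioms are taken from \<open>Sentences\<close> only, so closedness of this
    instance has to be verified.\<close>
  have "?\<phi> \<notin> Has_free a" for a
  proof -
    consider "a = x" | "a = y" | "a = z" | "a \<noteq> x" "a \<noteq> y" "a \<noteq> z" by blast
    then show ?thesis
    proof cases
      case 1 then show ?thesis by (simp add: not_free_bound)
    next
      case 2 then show ?thesis by (simp add: not_free_intros(2) not_free_bound)
    next
      case 3
      then show ?thesis using ne
        by (intro not_free_intros(2)[where b = x] not_free_intros(2)[where b = y] not_free_intros(4))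
          (auto simp: not_free_bound not_free_atomic)
    next
      case 4
      then show ?thesis by (intro not_free_intros not_free_IFF not_free_atomic) auto
    qed
  qed
  then have S: "?\<phi> \<in> Sentences" using F unfolding Sentences_def by blast
  have "?\<phi> \<in> KP_instances"
    unfolding KP_instances_def
    by (rule UnI1, rule UnI1, rule UnI1, rule UnI1, rule UnI1) (use A ne in auto)
  then have "?\<phi> \<in> KP_A"
    using S unfolding KP_A_def KP_axioms_def least_class_def by blast
  then show ?thesis using T unfolding extends_def by blast
qed

lemma der_extensionality_Const:
  assumes T: "extends T KP_A" and A: "w \<in> A" "z \<in> A" "d \<in> A" and ne: "w \<noteq> z"
  shows "T \<turnstile> IMP (ALL' w (IFF (IN (Var w) (Var z)) (IN (Var w) (Const d)))) (EQ (Var z) (Const d))"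
proof -
  obtain y where y: "y \<in> A" "Var y \<notin> {Var w, Var z}" using fresh_Var[OF A(1), of "{Var w, Var z}"] by auto
  have ne': "y \<noteq> w" "w \<noteq> y" "y \<noteq> z" "z \<noteq> y" "z \<noteq> w" using y ne by auto
  let ?\<phi> = "\<lambda>t. IMP (ALL' w (IFF (IN (Var w) (Var z)) (IN (Var w) t))) (EQ (Var z) t)"
  have "T \<turnstile> ALL' z (ALL' y (?\<phi> (Var y)))"
    by (rule der_extensionality[OF T]) (use A y ne ne' in auto)
  \<comment> \<open>The outer quantifier is stripped by the identity substitution; only the inner
    variable is replaced by the constant.\<close>
  then have 1: "T \<turnstile> ALL' y (?\<phi> (Var y))"
    by (rule der_inst_ALL[OF _ Subst_identity A(2)]) (use A y in simp_all)
  have I: "(IN (Var w) (Var z), IN (Var w) (Var z)) \<in> Subst y (Const d)"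
    "(IN (Var w) (Var y), IN (Var w) (Const d)) \<in> Subst y (Const d)"
    "(EQ (Var z) (Var y), EQ (Var z) (Const d)) \<in> Subst y (Const d)"
    using Subst_intros(2)[of "Var w" "Var z" y "Const d"] Subst_intros(2)[of "Var w" "Var y" y "Const d"]
      Subst_intros(1)[of "Var z" "Var y" y "Const d"] A y(1) ne' by simp_all
  have "(?\<phi> (Var y), ?\<phi> (Const d)) \<in> Subst y (Const d)"
    unfolding IFF_def
    by (intro Subst_intros(4,7) Subst_AND2_OR2(1) I) (use A y ne' in simp_all)
  from der_inst_ALL[OF 1 this y(1)] show ?thesis using A by simp
qed

section \<open>Reading a code inside \<open>T\<close>\<close>

definition upair_fm :: "'v \<Rightarrow> 'v \<Rightarrow> 'v \<Rightarrow> 'v \<Rightarrow> 'v" where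
  "upair_fm w z s u = AND2 (BALL w (Var z) (OR2 (EQ (Var w) s) (EQ (Var w) u)))
     (AND2 (IN s (Var z)) (IN u (Var z)))"

lemma upair_fm_Formulas [simp]:
  "w \<in> A \<Longrightarrow> z \<in> A \<Longrightarrow> s \<in> Terms \<Longrightarrow> u \<in> Terms \<Longrightarrow> upair_fm w z s u \<in> Formulas"
  unfolding upair_fm_def by simp

text \<open>The equation z = {s, u} is spelled with atoms, a disjunction, conjunctions and one
  bounded universal quantifier precisely so that this holds.\<close>

lemma upair_fm_Sigma:
  "w \<in> A \<Longrightarrow> z \<in> A \<Longrightarrow> w \<noteq> z \<Longrightarrow> s \<in> Terms \<Longrightarrow> u \<in> Terms \<Longrightarrow> upair_fm w z s u \<in> Sigma_formulas"
  unfolding upair_fm_def by (intro Sigma_intros) (auto simp: Terms_A Formulas_A)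

lemma ultra_BALL:
  assumes M: "ultra T M" and B: "BALL w t \<phi> \<in> M" and I: "IN (Var w) t \<in> M"
    and F: "w \<in> A" "t \<in> Terms" "\<phi> \<in> Formulas"
  shows "\<phi> \<in> M"
proof -
  have "IMP (IN (Var w) t) \<phi> \<in> M"
    by (rule ultra_ALL[OF M B[unfolded BALL_def] Subst_identity]) (use F in simp_all)
  then show ?thesis using ultra_IMP[OF M] I F by simp
qed

text \<open>R[A] tells \<open>T\<close> the elements of the constant {p, c}. If the formula holds, z
  provably has the same members, and Extensionality gives the equation; conversely, the equation
  carries membership over to z. Quantifiers over w are introduced at the level of theorems, whence
  the antecedents must not contain \<open>Var w\<close> freely.\<close>

lemma upair_fm_iff:
  assumes T: "extends T KP_A" and A: "w \<in> A" "z \<in> A" "p \<in> A" "c \<in> A"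
    and s: "s \<in> Terms" "u \<in> Terms" and ne: "w \<noteq> z" "s \<noteq> Var w" "u \<noteq> Var w"
  shows "T \<turnstile> IMP (AND2 (EQ s (Const p)) (EQ u (Const c))) (IFF (upair_fm w z s u) (EQ (Var z) (Const (vupair p c))))"
proof -
  let ?d = "Const (vupair p c)"
  let ?H = "AND2 (EQ s (Const p)) (EQ u (Const c))"
  let ?G = "AND2 ?H (upair_fm w z s u)"
  let ?B = "OR2 (EQ (Var w) s) (EQ (Var w) u)"
  let ?K = "AND2 ?H (EQ (Var z) ?d)"
  have F [simp]: "Const p \<in> Terms" "Const c \<in> Terms" "?d \<in> Terms" "Var w \<in> Terms" "Var z \<in> Terms" "s \<in> Terms" "u \<in> Terms"
    using A s by simp_all
  note wA [simp] = A
  have R: "IN (Const p) ?d \<in> M" "IN (Const c) ?d \<in> M"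
    "BALL w ?d (OR2 (EQ (Var w) (Const p)) (EQ (Var w) (Const c))) \<in> M" if M: "ultra T M" for M
    using ultra_theorem[OF M der_IN_Const[OF T, of p "vupair p c"]] ultra_theorem[OF M der_IN_Const[OF T, of c "vupair p c"]]
      ultra_theorem[OF M der_IN_vupair[OF T, of w p c]] by simp_all
  have nfH: "?H \<notin> Has_free w" using ne by (intro not_free_intros not_free_atomic) simp_all
  have "T \<turnstile> IMP ?G (IFF (IN (Var w) (Var z)) (IN (Var w) ?d))"
  proof (rule ultra_complete)
    fix M assume M: "ultra T M"
    have "IN (Var w) (Var z) \<in> M \<longleftrightarrow> IN (Var w) ?d \<in> M" if G: "?G \<in> M"
    proof -
      have e: "EQ s (Const p) \<in> M" "EQ u (Const c) \<in> M" "BALL w (Var z) ?B \<in> M" "IN s (Var z) \<in> M" "IN u (Var z) \<in> M"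
        using G unfolding upair_fm_def by (simp_all add: ultra_simps[OF M])
      show ?thesis
      proof
        assume "IN (Var w) (Var z) \<in> M"
        then have "?B \<in> M" by (rule ultra_BALL[OF M e(3)]) simp_all
        then have "EQ (Var w) s \<in> M \<or> EQ (Var w) u \<in> M" by (simp add: ultra_simps[OF M])
        then have "EQ (Var w) (Const p) \<in> M \<or> EQ (Var w) (Const c) \<in> M"
          using ultra_trans[OF M F(4,6,1)] ultra_trans[OF M F(4,7,2)] e(1,2) by blast
        then have "EQ (Const p) (Var w) \<in> M \<or> EQ (Const c) (Var w) \<in> M"
          using ultra_sym[OF M F(4,1)] ultra_sym[OF M F(4,2)] by blast
        then show "IN (Var w) ?d \<in> M"
          using ultra_IN_left[OF M F(1,4,3)] ultra_IN_left[OF M F(2,4,3)] R(1,2)[OF M] by blast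
      next
        assume "IN (Var w) ?d \<in> M"
        then have "OR2 (EQ (Var w) (Const p)) (EQ (Var w) (Const c)) \<in> M"
          by (rule ultra_BALL[OF M R(3)[OF M]]) simp_all
        then have "EQ (Var w) (Const p) \<in> M \<or> EQ (Var w) (Const c) \<in> M" by (simp add: ultra_simps[OF M])
        then have "EQ (Const p) (Var w) \<in> M \<or> EQ (Const c) (Var w) \<in> M"
          using ultra_sym[OF M F(4,1)] ultra_sym[OF M F(4,2)] by blast
        then have "EQ s (Var w) \<in> M \<or> EQ u (Var w) \<in> M"
          using ultra_trans[OF M F(6,1,4)] ultra_trans[OF M F(7,2,4)] e(1,2) by blast
        then show "IN (Var w) (Var z) \<in> M"
          using ultra_IN_left[OF M F(6,4,5)] ultra_IN_left[OF M F(7,4,5)] e(4,5) by blast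
      qed
    qed
    then show "IMP ?G (IFF (IN (Var w) (Var z)) (IN (Var w) ?d)) \<in> M" by (simp add: ultra_simps[OF M])
  qed simp
  moreover have "?G \<notin> Has_free w"
    unfolding upair_fm_def BALL_def using ne nfH
    by (intro not_free_intros(5) not_free_bound not_free_atomic) simp_all
  ultimately have 1: "T \<turnstile> IMP ?G (ALL' w (IFF (IN (Var w) (Var z)) (IN (Var w) ?d)))"
    by (rule der_ALL) simp_all
  have 2: "T \<turnstile> IMP (ALL' w (IFF (IN (Var w) (Var z)) (IN (Var w) ?d))) (EQ (Var z) ?d)"
    by (rule der_extensionality_Const[OF T]) (use ne in simp_all)
  have "T \<turnstile> IMP ?K (IMP (IN (Var w) (Var z)) ?B)"
  proof (rule ultra_complete)
    fix M assume M: "ultra T M"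
    have "?B \<in> M" if K: "?K \<in> M" and I: "IN (Var w) (Var z) \<in> M"
    proof -
      have e: "EQ s (Const p) \<in> M" "EQ u (Const c) \<in> M" "EQ (Var z) ?d \<in> M"
        using K by (simp_all add: ultra_simps[OF M])
      have "IN (Var w) ?d \<in> M" using ultra_IN_right[OF M F(5,3,4) e(3) I] .
      then have "OR2 (EQ (Var w) (Const p)) (EQ (Var w) (Const c)) \<in> M"
        by (rule ultra_BALL[OF M R(3)[OF M]]) simp_all
      then have "EQ (Var w) (Const p) \<in> M \<or> EQ (Var w) (Const c) \<in> M" by (simp add: ultra_simps[OF M])
      then have "EQ (Var w) s \<in> M \<or> EQ (Var w) u \<in> M"
        using ultra_trans[OF M F(4,1,6) _ ultra_sym[OF M F(6,1) e(1)]]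
          ultra_trans[OF M F(4,2,7) _ ultra_sym[OF M F(7,2) e(2)]] by blast
      then show ?thesis by (simp add: ultra_simps[OF M])
    qed
    then show "IMP ?K (IMP (IN (Var w) (Var z)) ?B) \<in> M" by (simp add: ultra_simps[OF M])
  qed simp
  then have 3: "T \<turnstile> IMP ?K (BALL w (Var z) ?B)"
    unfolding BALL_def
    by (rule der_ALL) (use nfH ne in \<open>simp_all add: not_free_intros not_free_atomic\<close>)
  show ?thesis
  proof (rule ultra_complete)
    fix M assume M: "ultra T M"
    note sim = ultra_simps[OF M]
    have 1: "IMP ?G (ALL' w (IFF (IN (Var w) (Var z)) (IN (Var w) ?d))) \<in> M"
      and 2: "IMP (ALL' w (IFF (IN (Var w) (Var z)) (IN (Var w) ?d))) (EQ (Var z) ?d) \<in> M"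
      and 3: "IMP ?K (BALL w (Var z) ?B) \<in> M"
      using ultra_theorem[OF M 1] ultra_theorem[OF M 2] ultra_theorem[OF M 3] by simp_all
    have l: "EQ (Var z) ?d \<in> M" if "?H \<in> M" "upair_fm w z s u \<in> M"
      using 1 2 that by (simp add: sim)
    have r: "upair_fm w z s u \<in> M" if H: "?H \<in> M" and z: "EQ (Var z) ?d \<in> M"
    proof -
      have e: "EQ s (Const p) \<in> M" "EQ u (Const c) \<in> M" using H by (simp_all add: sim)
      have "IN (Const p) (Var z) \<in> M" "IN (Const c) (Var z) \<in> M"
        using ultra_IN_right[OF M F(3,5,1) ultra_sym[OF M F(5,3) z]]
          ultra_IN_right[OF M F(3,5,2) ultra_sym[OF M F(5,3) z]] R(1,2)[OF M] by blast+
      then have "IN s (Var z) \<in> M" "IN u (Var z) \<in> M"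
        using ultra_IN_left[OF M F(1,6,5) ultra_sym[OF M F(6,1) e(1)]]
          ultra_IN_left[OF M F(2,7,5) ultra_sym[OF M F(7,2) e(2)]] by blast+
      moreover have "BALL w (Var z) ?B \<in> M" using 3 H z by (simp add: sim)
      ultimately show ?thesis unfolding upair_fm_def by (simp add: sim)
    qed
    show "IMP ?H (IFF (upair_fm w z s u) (EQ (Var z) ?d)) \<in> M"
      using l r by (simp add: sim, blast)
  qed simp
qed

text \<open>Here \<theta> acts as a test on z that returns \<chi> when z denotes b. The hypothesis
  \<Gamma> will later say that \<open>x\<close> denotes \<delta>, which the test needs in order to
  rebuild \<psi>.\<close>

definition reads :: "'v set \<Rightarrow> 'v \<Rightarrow> 'v \<Rightarrow> 'v \<Rightarrow> 'v \<Rightarrow> 'v \<Rightarrow> bool" where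
  "reads T \<Gamma> \<chi> z b \<theta> \<longleftrightarrow> T \<turnstile> IMP \<Gamma> (IMP (EQ (Var z) (Const b)) (IFF \<theta> \<chi>))"

text \<open>One pairing is moved from the set under test into the test: if \<theta> tests {s, z'},
  this formula tests z' by rebuilding that set.\<close>

definition via :: "'v \<Rightarrow> 'v \<Rightarrow> 'v \<Rightarrow> 'v \<Rightarrow> 'v \<Rightarrow> 'v" where
  "via w z s z' \<theta> = EX' z (AND2 (upair_fm w z s (Var z')) \<theta>)"

lemma via_Formulas [simp]:
  "w \<in> A \<Longrightarrow> z \<in> A \<Longrightarrow> z' \<in> A \<Longrightarrow> s \<in> Terms \<Longrightarrow> \<theta> \<in> Formulas \<Longrightarrow> via w z s z' \<theta> \<in> Formulas"
  unfolding via_def by simp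

lemma via_Sigma:
  "w \<in> A \<Longrightarrow> z \<in> A \<Longrightarrow> z' \<in> A \<Longrightarrow> s \<in> Terms \<Longrightarrow> w \<noteq> z \<Longrightarrow> \<theta> \<in> Sigma_formulas \<Longrightarrow> \<theta> \<in> A \<Longrightarrow>
   via w z s z' \<theta> \<in> Sigma_formulas"
  unfolding via_def by (intro Sigma_intros upair_fm_Sigma) (simp_all add: Formulas_A)

text \<open>By \<open>upair_fm_iff\<close> the rebuilt z can only be the constant {p, c}, which
  gives one direction. For the other, z is introduced as a name of this constant by
  \<open>der_EX_EQ_elim\<close>. Both quantifier steps need z not to be free in \<Gamma> and
  \<chi>.\<close>

lemma reads_via:
  assumes T: "extends T KP_A" and rd: "reads T \<Gamma> \<chi> z (vupair p c) \<theta>"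
    and \<Gamma>s: "T \<turnstile> IMP \<Gamma> (EQ s (Const p))"
    and A: "w \<in> A" "z \<in> A" "z' \<in> A" "p \<in> A" "c \<in> A" "s \<in> Terms"
    and F: "\<Gamma> \<in> Formulas" "\<chi> \<in> Formulas" "\<theta> \<in> Formulas"
    and ne: "w \<noteq> z" "w \<noteq> z'" "z \<noteq> z'" "s \<noteq> Var w"
    and nf: "\<Gamma> \<notin> Has_free z" "\<chi> \<notin> Has_free z"
  shows "reads T \<Gamma> \<chi> z' c (via w z s z' \<theta>)"
proof -
  let ?d = "Const (vupair p c)"
  let ?U = "upair_fm w z s (Var z')"
  let ?H = "AND2 \<Gamma> (EQ (Var z') (Const c))"
  have Fs [simp]: "?U \<in> Formulas" "EQ s (Const p) \<in> Formulas" "EQ (Var z') (Const c) \<in> Formulas"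
    "EQ (Var z) ?d \<in> Formulas" "via w z s z' \<theta> \<in> Formulas" "AND2 ?U \<theta> \<in> Formulas" using A F by simp_all
  note F [simp] A [simp]
  have up: "T \<turnstile> IMP (AND2 (EQ s (Const p)) (EQ (Var z') (Const c))) (IFF ?U (EQ (Var z) ?d))"
    by (rule upair_fm_iff[OF T]) (use ne in auto)
  have facts: "?U \<in> M \<longleftrightarrow> EQ (Var z) ?d \<in> M" "EQ (Var z) ?d \<in> M \<Longrightarrow> \<theta> \<in> M \<longleftrightarrow> \<chi> \<in> M"
    if M: "ultra T M" and H: "\<Gamma> \<in> M" "EQ (Var z') (Const c) \<in> M" for M
    using ultra_theorem[OF M up] ultra_theorem[OF M rd[unfolded reads_def]] ultra_theorem[OF M \<Gamma>s] H
    by (simp_all add: ultra_simps[OF M])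
  have "T \<turnstile> IMP (AND2 ?U \<theta>) (IMP ?H \<chi>)"
    by (rule ultra_complete) (use facts in \<open>auto simp add: ultra_simps\<close>)
  then have 1: "T \<turnstile> IMP (via w z s z' \<theta>) (IMP ?H \<chi>)"
    unfolding via_def
    by (rule der_EX) (use nf ne in \<open>simp_all add: not_free_intros not_free_atomic\<close>)
  have 2: "T \<turnstile> IMP ?H (IMP \<chi> (via w z s z' \<theta>))"
  proof (rule der_EX_EQ_elim)
    show "T \<turnstile> IMP (EQ (Var z) ?d) (IMP ?H (IMP \<chi> (via w z s z' \<theta>)))"
    proof (rule ultra_complete)
      fix M assume M: "ultra T M"
      have "via w z s z' \<theta> \<in> M"
        if "EQ (Var z) ?d \<in> M" "\<Gamma> \<in> M" "EQ (Var z') (Const c) \<in> M" "\<chi> \<in> M"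
        unfolding via_def
        by (rule ultra_EX[OF M _ Subst_identity]) (use facts[OF M] that in \<open>simp_all add: ultra_simps[OF M]\<close>)
      then show "IMP (EQ (Var z) ?d) (IMP ?H (IMP \<chi> (via w z s z' \<theta>))) \<in> M"
        by (simp add: ultra_simps[OF M])
    qed simp
    show "IMP ?H (IMP \<chi> (via w z s z' \<theta>)) \<notin> Has_free z"
      using nf ne by (simp add: via_def not_free_intros not_free_atomic not_free_bound)
  qed simp_all
  show ?thesis
    unfolding reads_def
  proof (rule ultra_complete)
    fix M assume M: "ultra T M"
    show "IMP \<Gamma> (IMP (EQ (Var z') (Const c)) (IFF (via w z s z' \<theta>) \<chi>)) \<in> M"
      using ultra_theorem[OF M 1] ultra_theorem[OF M 2] by (auto simp add: ultra_simps[OF M])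
  qed simp
qed

text \<open>As (a, b) is {{a}, {a, b}} and a is fixed, two unordered pairings suffice: y = {a, z'}
  and z = {{a}, y}, where {a} is a constant.\<close>

definition vpair_via :: "'v \<Rightarrow> 'v \<Rightarrow> 'v \<Rightarrow> 'v \<Rightarrow> 'v \<Rightarrow> 'v \<Rightarrow> 'v" where
  "vpair_via w z y z' a \<theta> = via w y (Const a) z' (via w z (Const (vupair a a)) y \<theta>)"

lemma vpair_via_Formulas [simp]:
  "w \<in> A \<Longrightarrow> z \<in> A \<Longrightarrow> y \<in> A \<Longrightarrow> z' \<in> A \<Longrightarrow> a \<in> A \<Longrightarrow> \<theta> \<in> Formulas \<Longrightarrow> vpair_via w z y z' a \<theta> \<in> Formulas"
  unfolding vpair_via_def by simp

lemma vpair_via_Sigma: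
  "w \<in> A \<Longrightarrow> z \<in> A \<Longrightarrow> y \<in> A \<Longrightarrow> z' \<in> A \<Longrightarrow> a \<in> A \<Longrightarrow> w \<noteq> z \<Longrightarrow> w \<noteq> y \<Longrightarrow> \<theta> \<in> Formulas \<Longrightarrow>
   \<theta> \<in> Sigma_formulas \<Longrightarrow> vpair_via w z y z' a \<theta> \<in> Sigma_formulas"
  unfolding vpair_via_def by (intro via_Sigma) (simp_all add: Formulas_A)

lemma reads_vpair_via:
  assumes T: "extends T KP_A" and rd: "reads T \<Gamma> \<chi> z (vpair a b) \<theta>"
    and A: "w \<in> A" "z \<in> A" "y \<in> A" "z' \<in> A" "a \<in> A" "b \<in> A"
    and F: "\<Gamma> \<in> Formulas" "\<chi> \<in> Formulas" "\<theta> \<in> Formulas"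
    and ne: "w \<noteq> z" "w \<noteq> y" "w \<noteq> z'" "z \<noteq> y" "y \<noteq> z'"
    and nf: "\<Gamma> \<notin> Has_free z" "\<chi> \<notin> Has_free z" "\<Gamma> \<notin> Has_free y" "\<chi> \<notin> Has_free y"
  shows "reads T \<Gamma> \<chi> z' b (vpair_via w z y z' a \<theta>)"
proof -
  have refl: "T \<turnstile> IMP \<Gamma> (EQ (Const q) (Const q))" if "q \<in> A" for q
    by (rule ultra_complete) (use that F in \<open>simp_all add: ultra_simps ultra_refl[where t = "Const q"]\<close>)
  have "reads T \<Gamma> \<chi> y (vupair a b) (via w z (Const (vupair a a)) y \<theta>)"
    by (rule reads_via[OF T rd[unfolded vpair_def] refl]) (use A F ne nf in simp_all)
  then show ?thesis
    unfolding vpair_via_def by (rule reads_via[OF T _ refl]) (use A F ne nf in simp_all)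
qed

text \<open>The calculus only provides Leibniz's law for variables, hence the detour through a
  variant \<open>\<phi>u\<close> of \<open>\<phi>\<close> with a fresh variable.\<close>

lemma der_EX_Const:
  assumes \<phi>: "\<phi> \<in> Formulas" and A: "v \<in> A" "c \<in> A" and \<chi>: "(\<phi>, \<chi>) \<in> Subst v (Const c)"
  defines "\<chi>' \<equiv> EX' v (AND2 (EQ (Var v) (Const c)) \<phi>)"
  shows "T \<turnstile> IMP (EQ (Var v) (Const c)) (IFF \<phi> \<chi>')" and "T \<turnstile> IFF \<chi> \<chi>'"
proof -
  obtain u \<phi>u where u: "u \<in> A" "u \<noteq> v" "\<phi> \<notin> Has_free u" and \<phi>u: "(\<phi>, \<phi>u) \<in> Subst v (Var u)" "\<phi>u \<notin> Has_free v"
    using Subst_fresh[OF \<phi> A(1)] by blast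
  \<comment> \<open>With the bound variable renamed to u, the witness and a free
    \<open>Var v\<close> can both equal the constant, so Leibniz's law compares the two. Thus
    \<chi>' implies, through \<chi>'', that \<phi> holds of every v equal to the constant.\<close>
  define \<chi>'' where "\<chi>'' = EX' u (AND2 (EQ (Var u) (Const c)) \<phi>u)"
  let ?v = "EQ (Var v) (Const c)" and ?u = "EQ (Var u) (Const c)"
  have [simp]: "\<phi>u \<in> Formulas" "\<chi> \<in> Formulas"
    using Subst_Formulas(2)[OF \<phi>u(1)] Subst_Formulas(2)[OF \<chi>] A u by simp_all
  note [simp] = \<phi> A u(1)
  have [simp]: "\<chi>' \<in> Formulas" "\<chi>'' \<in> Formulas" unfolding \<chi>'_def \<chi>''_def by simp_all
  have leib: "\<phi> \<in> M \<longleftrightarrow> \<phi>u \<in> M" if M: "ultra T M" and e: "?v \<in> M" "?u \<in> M" for M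
  proof -
    have T: "Var v \<in> Terms" "Var u \<in> Terms" "Const c \<in> Terms" by simp_all
    have 1: "EQ (Var v) (Var u) \<in> M"
      by (rule ultra_trans[OF M T(1,3,2) e(1) ultra_sym[OF M T(2,3) e(2)]])
    have 2: "EQ (Var u) (Var v) \<in> M" by (rule ultra_sym[OF M T(1,2) 1])
    have "T \<turnstile> IMP (EQ (Var v) (Var u)) (IMP \<phi> \<phi>u)"
      by (rule der_Leibniz[OF A(1) u(1) A(1) Subst_identity[OF \<phi>] \<phi>u(1)])
    moreover have "T \<turnstile> IMP (EQ (Var u) (Var v)) (IMP \<phi>u \<phi>)"
      by (rule der_Leibniz[OF u(1) A(1) A(1) \<phi>u(1) Subst_identity[OF \<phi>]])
    ultimately show ?thesis
      using 1 2 ultra_theorem[OF M, of "IMP (EQ (Var v) (Var u)) (IMP \<phi> \<phi>u)"]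
        ultra_theorem[OF M, of "IMP (EQ (Var u) (Var v)) (IMP \<phi>u \<phi>)"] by (auto simp add: ultra_simps[OF M])
  qed
  have v': "T \<turnstile> IMP ?v (IMP \<phi> \<chi>')"
  proof (rule ultra_complete)
    fix M assume M: "ultra T M"
    have "\<chi>' \<in> M" if "?v \<in> M" "\<phi> \<in> M"
      unfolding \<chi>'_def by (rule ultra_EX[OF M _ Subst_identity]) (use that in \<open>simp_all add: ultra_simps[OF M]\<close>)
    then show "IMP ?v (IMP \<phi> \<chi>') \<in> M" by (simp add: ultra_simps[OF M])
  qed simp
  have "T \<turnstile> IMP ?u (IMP (AND2 ?v \<phi>) \<chi>'')"
  proof (rule ultra_complete)
    fix M assume M: "ultra T M"
    have "\<chi>'' \<in> M" if "?u \<in> M" "?v \<in> M" "\<phi> \<in> M"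
      unfolding \<chi>''_def
      by (rule ultra_EX[OF M _ Subst_identity]) (use that leib[OF M] in \<open>simp_all add: ultra_simps[OF M]\<close>)
    then show "IMP ?u (IMP (AND2 ?v \<phi>) \<chi>'') \<in> M" by (simp add: ultra_simps[OF M])
  qed simp
  then have "T \<turnstile> IMP (AND2 ?v \<phi>) \<chi>''"
    by (rule der_EX_EQ_elim) (use u in \<open>simp_all add: \<chi>''_def not_free_intros not_free_atomic not_free_bound\<close>)
  moreover have nf'': "\<chi>'' \<notin> Has_free v"
    unfolding \<chi>''_def using u \<phi>u(2) by (intro not_free_intros not_free_atomic) simp_all
  ultimately have 1: "T \<turnstile> IMP \<chi>' \<chi>''"
    unfolding \<chi>'_def by (rule der_EX) simp_all
  have "T \<turnstile> IMP (AND2 ?u \<phi>u) (IMP ?v \<phi>)"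
    by (rule ultra_complete) (use leib in \<open>simp_all add: ultra_simps\<close>)
  then have 2: "T \<turnstile> IMP \<chi>'' (IMP ?v \<phi>)"
    unfolding \<chi>''_def
    by (rule der_EX) (use u in \<open>simp_all add: not_free_intros not_free_atomic\<close>)
  have 3: "T \<turnstile> IMP \<chi>'' (ALL' v (IMP ?v \<phi>))"
    by (rule der_ALL[OF 2 nf'']) simp_all
  have vc: "(?v, EQ (Const c) (Const c)) \<in> Subst v (Const c)"
    using Subst_intros(1)[of "Var v" "Const c" v "Const c"] by simp
  have 4: "T \<turnstile> IMP (ALL' v (IMP ?v \<phi>)) (IMP (EQ (Const c) (Const c)) \<chi>)"
    by (rule der_quantifier(1)[OF Subst_intros(4)[OF vc \<chi>]]) simp_all
  have 5: "T \<turnstile> IMP (AND2 (EQ (Const c) (Const c)) \<chi>) \<chi>'"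
    unfolding \<chi>'_def by (rule der_quantifier(2)[OF Subst_AND2_OR2(1)[OF vc \<chi>]]) simp_all
  have 6: "EQ (Const c) (Const c) \<in> M" if "ultra T M" for M
    by (rule ultra_refl[OF that, where t = "Const c"]) simp_all
  show "T \<turnstile> IMP ?v (IFF \<phi> \<chi>')"
  proof (rule ultra_complete)
    fix M assume M: "ultra T M"
    show "IMP ?v (IFF \<phi> \<chi>') \<in> M"
      using ultra_theorem[OF M v'] ultra_theorem[OF M 1] ultra_theorem[OF M 2]
      by (auto simp add: ultra_simps[OF M])
  qed simp
  show "T \<turnstile> IFF \<chi> \<chi>'"
  proof (rule ultra_complete)
    fix M assume M: "ultra T M"
    show "IFF \<chi> \<chi>' \<in> M"
      using ultra_theorem[OF M 1] ultra_theorem[OF M 3] ultra_theorem[OF M 4] ultra_theorem[OF M 5] 6[OF M]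
      by (auto simp add: ultra_simps[OF M])
  qed simp
qed

section \<open>Fresh variables and the fixed point\<close>

lemma fresh_variables:
  assumes "\<phi> \<in> A" "v \<in> A"
  obtains x where "\<And>n :: nat. x n \<in> A" "inj x" "\<And>n. x n \<noteq> v" "\<And>n. \<phi> \<notin> Has_free (x n)"
proof -
  have "vpair \<phi> v \<in> A" using assms by simp
  then obtain u where u: "u \<in> A" "transitive u" "vpair \<phi> v \<^bold>\<in> u"
    using transitive_superset by blast
  have m: "\<phi> \<^bold>\<in> u" "v \<^bold>\<in> u" using transitive_vpair[OF u(2,3)] by auto
  have n: "\<not> vpair (tag n) u \<^bold>\<in> u" for n
    using transitive_vpair[OF u(2)] mem_irrefl by blast
  \<comment> \<open>The tags make the indices distinct. None of them lies in the transitive set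
    \<open>u\<close>, since its second component would make \<open>u\<close> an element of
    itself.\<close>
  show ?thesis
  proof (rule that[of "\<lambda>n. vpair (tag n) u"])
    show "vpair (tag n) u \<noteq> v" for n using n m(2) by blast
    show "\<phi> \<notin> Has_free (vpair (tag n) u)" for n by (rule not_free_fresh[OF u(2) m(1) n])
  qed (use u(1) in \<open>auto simp: tag_A inj_def\<close>)
qed

lemma diagonal_lemma:
  assumes T: "extends T KP_A" and \<phi>: "\<phi> \<in> Formulas" and v: "v \<in> A"
  shows "\<exists>\<psi>\<in>Formulas. (\<exists>\<chi>. (\<phi>, \<chi>) \<in> Subst v (Const \<psi>) \<and> T \<turnstile> IFF \<chi> \<psi>) \<and>
    (\<phi> \<in> Sigma_formulas \<longrightarrow> \<psi> \<in> Sigma_formulas)"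
proof -
  obtain X where X: "\<And>n :: nat. X n \<in> A" "inj X" "\<And>n. X n \<noteq> v" "\<And>n. \<phi> \<notin> Has_free (X n)"
    using fresh_variables[OF Formulas_A[OF \<phi>] v] by blast
  define x y z w where "x = X 0" and "y = X 1" and "z = X 2" and "w = X 3"
  have A [simp]: "x \<in> A" "y \<in> A" "z \<in> A" "w \<in> A" "v \<in> A" "\<And>n. tag n \<in> A"
    using X(1) v tag_A[OF v] by (simp_all add: x_def y_def z_def w_def)
  have ne [simp]: "x \<noteq> y" "y \<noteq> x" "x \<noteq> z" "z \<noteq> x" "x \<noteq> w" "w \<noteq> x" "y \<noteq> z" "z \<noteq> y" "y \<noteq> w" "w \<noteq> y" "z \<noteq> w" "w \<noteq> z"
    "x \<noteq> v" "v \<noteq> x" "y \<noteq> v" "v \<noteq> y" "z \<noteq> v" "v \<noteq> z" "w \<noteq> v" "v \<noteq> w"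
    using X(2,3) X(3)[symmetric] by (simp_all add: x_def y_def z_def w_def inj_eq)
  have nf: "\<phi> \<notin> Has_free x" "\<phi> \<notin> Has_free y" "\<phi> \<notin> Has_free z"
    using X(4) by (simp_all add: x_def y_def z_def)
  note [simp] = \<phi>
  \<comment> \<open>The constants are those of \<psi> = (7, (x, (8, {\<delta>, \<Gamma>}))) and
    \<Gamma> = (2, (Var x, (1, \<delta>))), where the numbers stand for the tags of
    \<open>EX'\<close>, \<open>AND\<close>, \<open>EQ\<close> and \<open>Const\<close>. The first
    and the last variable of a pair link may coincide, because a third one separates its two
    pairings.\<close>
  define \<theta>1 where "\<theta>1 = vpair_via w v y z (tag 7) \<phi>"
  define \<theta>2 where "\<theta>2 = vpair_via w z y z x \<theta>1"
  define \<theta>3 where "\<theta>3 = vpair_via w z y z (tag 8) \<theta>2"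
  \<comment> \<open>This link rebuilds {\<delta>, \<Gamma>} from \<Gamma>. The code of \<delta>
    cannot be a constant of its own chain, so it is supplied by the variable
    \<open>x\<close>.\<close>
  define \<theta>4 where "\<theta>4 = via w z (Var x) y \<theta>3"
  define \<theta>5 where "\<theta>5 = vpair_via w y z y (tag 2) \<theta>4"
  define \<theta>6 where "\<theta>6 = vpair_via w y z y (Var x) \<theta>5"
  \<comment> \<open>The chain ends inside the name of \<delta> in \<Gamma>; the set read here is
    therefore \<delta> once more, and again it is taken from \<open>x\<close>.\<close>
  define \<delta> where "\<delta> = vpair_via w y z x (tag 1) \<theta>6"
  have F1 [simp]: "\<theta>1 \<in> Formulas" by (simp add: \<theta>1_def)
  have F2 [simp]: "\<theta>2 \<in> Formulas" by (simp add: \<theta>2_def)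
  have F3 [simp]: "\<theta>3 \<in> Formulas" by (simp add: \<theta>3_def)
  have F4 [simp]: "\<theta>4 \<in> Formulas" by (simp add: \<theta>4_def)
  have F5 [simp]: "\<theta>5 \<in> Formulas" by (simp add: \<theta>5_def)
  have F6 [simp]: "\<theta>6 \<in> Formulas" by (simp add: \<theta>6_def)
  have F7 [simp]: "\<delta> \<in> Formulas" by (simp add: \<delta>_def)
  have \<delta>A [simp]: "\<delta> \<in> A" by (rule Formulas_A) simp
  \<comment> \<open>The chain above refers to \<delta> and \<Gamma> only through variables, so there
    is no circularity.\<close>
  define \<Gamma> where "\<Gamma> = EQ (Var x) (Const \<delta>)"
  define \<psi> where "\<psi> = EX' x (AND2 \<Gamma> \<delta>)"
  have \<Gamma> [simp]: "\<Gamma> \<in> Formulas" by (simp add: \<Gamma>_def)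
  have \<psi>F [simp]: "\<psi> \<in> Formulas" by (simp add: \<psi>_def)
  have \<psi>A [simp]: "\<psi> \<in> A" by (rule Formulas_A) simp
  have \<Gamma>A: "\<Gamma> \<in> A" by (rule Formulas_A) simp
  obtain \<chi> where \<chi>: "(\<phi>, \<chi>) \<in> Subst v (Const \<psi>)" using Subst_Const[OF \<phi> v \<psi>A] by blast
  \<comment> \<open>The tests return \<chi>' instead of the equivalent \<chi>: that the auxiliary
    variables are not free in it follows directly from their freshness for \<phi>.\<close>
  define \<chi>' where "\<chi>' = EX' v (AND2 (EQ (Var v) (Const \<psi>)) \<phi>)"
  note base = der_EX_Const[OF \<phi> v \<psi>A \<chi>, of T, folded \<chi>'_def]
  have [simp]: "\<chi>' \<in> Formulas" "\<chi> \<in> Formulas"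
    using Subst_Formulas(2)[OF \<chi>] by (simp_all add: \<chi>'_def)
  have nf\<chi>: "\<chi>' \<notin> Has_free x" "\<chi>' \<notin> Has_free y" "\<chi>' \<notin> Has_free z" "\<chi>' \<notin> Has_free v"
    using nf by (simp_all add: \<chi>'_def not_free_intros not_free_atomic not_free_bound)
  have nf\<Gamma>: "\<Gamma> \<notin> Has_free y" "\<Gamma> \<notin> Has_free z" "\<Gamma> \<notin> Has_free v"
    by (simp_all add: \<Gamma>_def not_free_atomic)
  note nfs = nf\<chi> nf\<Gamma>
  \<comment> \<open>the chain \<open>\<theta>1, \<dots>, \<theta>6, \<delta>\<close> undoes these pairings from the outside in\<close>
  have code: "\<psi> = vpair (tag 7) (vpair x (vpair (tag 8) (vupair \<delta> \<Gamma>)))"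
    "\<Gamma> = vpair (tag 2) (vpair (Var x) (vpair (tag 1) \<delta>))"
    unfolding \<psi>_def \<Gamma>_def AND2_def EX'_def AND_def EQ_def Const_def by (simp_all add: vupair_commute)
  have inner: "vpair x (vpair (tag 8) (vupair \<delta> \<Gamma>)) \<in> A" "vpair (tag 8) (vupair \<delta> \<Gamma>) \<in> A" "vupair \<delta> \<Gamma> \<in> A"
    "vpair (Var x) (vpair (tag 1) \<delta>) \<in> A" "vpair (tag 1) \<delta> \<in> A"
    using \<Gamma>A by simp_all
  have r0: "reads T \<Gamma> \<chi>' v \<psi> \<phi>"
    unfolding reads_def
  proof (rule ultra_complete)
    fix M assume M: "ultra T M"
    show "IMP \<Gamma> (IMP (EQ (Var v) (Const \<psi>)) (IFF \<phi> \<chi>')) \<in> M"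
      using ultra_theorem[OF M base(1)] by (simp add: ultra_simps[OF M])
  qed simp
  have r1: "reads T \<Gamma> \<chi>' z (vpair x (vpair (tag 8) (vupair \<delta> \<Gamma>))) \<theta>1"
    unfolding \<theta>1_def by (rule reads_vpair_via[OF T r0[unfolded code(1)]]) (use inner nfs in simp_all)
  have r2: "reads T \<Gamma> \<chi>' z (vpair (tag 8) (vupair \<delta> \<Gamma>)) \<theta>2"
    unfolding \<theta>2_def by (rule reads_vpair_via[OF T r1]) (use inner nfs in simp_all)
  have r3: "reads T \<Gamma> \<chi>' z (vupair \<delta> \<Gamma>) \<theta>3"
    unfolding \<theta>3_def by (rule reads_vpair_via[OF T r2]) (use inner nfs in simp_all)
  have "T \<turnstile> IMP \<Gamma> (EQ (Var x) (Const \<delta>))"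
    unfolding \<Gamma>_def[symmetric] by (rule ultra_complete) (simp_all add: ultra_simps)
  then have r4: "reads T \<Gamma> \<chi>' y \<Gamma> \<theta>4"
    unfolding \<theta>4_def by (intro reads_via[OF T r3]) (use inner nfs \<Gamma>A in simp_all)
  have r4': "reads T \<Gamma> \<chi>' y (vpair (tag 2) (vpair (Var x) (vpair (tag 1) \<delta>))) \<theta>4"
    using r4 by (simp only: code(2)[symmetric])
  have r5: "reads T \<Gamma> \<chi>' y (vpair (Var x) (vpair (tag 1) \<delta>)) \<theta>5"
    unfolding \<theta>5_def by (rule reads_vpair_via[OF T r4']) (use inner nfs in simp_all)
  have r6: "reads T \<Gamma> \<chi>' y (vpair (tag 1) \<delta>) \<theta>6"
    unfolding \<theta>6_def by (rule reads_vpair_via[OF T r5]) (use inner nfs in simp_all)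
  \<comment> \<open>The first \<delta> is the set denoted by \<open>x\<close>, the second the
    testing formula. As the variable read is \<open>x\<close> itself, the reading hypothesis is once
    more \<Gamma>.\<close>
  have r7: "reads T \<Gamma> \<chi>' x \<delta> \<delta>"
  proof -
    have "reads T \<Gamma> \<chi>' x \<delta> (vpair_via w y z x (tag 1) \<theta>6)"
      by (rule reads_vpair_via[OF T r6]) (use inner nfs in simp_all)
    then show ?thesis by (simp only: \<delta>_def[symmetric])
  qed
  then have \<delta>: "T \<turnstile> IMP \<Gamma> (IMP \<Gamma> (IFF \<delta> \<chi>'))" unfolding reads_def \<Gamma>_def .
  have "T \<turnstile> IMP (AND2 \<Gamma> \<delta>) \<chi>'"
  proof (rule ultra_complete)
    fix M assume M: "ultra T M"
    show "IMP (AND2 \<Gamma> \<delta>) \<chi>' \<in> M" using ultra_theorem[OF M \<delta>] by (auto simp add: ultra_simps[OF M])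
  qed simp
  then have 1: "T \<turnstile> IMP \<psi> \<chi>'"
    unfolding \<psi>_def by (rule der_EX) (use nf\<chi> in simp_all)
  \<comment> \<open>To find a witness for \<psi>, \<open>x\<close> is introduced as a name of
    \<delta>; under \<Gamma> the formula \<chi>' then yields \<delta>.\<close>
  have 2: "T \<turnstile> IMP \<chi>' \<psi>"
  proof (rule der_EX_EQ_elim)
    show "T \<turnstile> IMP (EQ (Var x) (Const \<delta>)) (IMP \<chi>' \<psi>)"
      unfolding \<Gamma>_def[symmetric]
    proof (rule ultra_complete)
      fix M assume M: "ultra T M"
      have "\<psi> \<in> M" if "\<Gamma> \<in> M" "\<chi>' \<in> M"
        unfolding \<psi>_def
        by (rule ultra_EX[OF M _ Subst_identity])
          (use that ultra_theorem[OF M \<delta>] in \<open>simp_all add: ultra_simps[OF M]\<close>)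
      then show "IMP \<Gamma> (IMP \<chi>' \<psi>) \<in> M" by (simp add: ultra_simps[OF M])
    qed simp
    show "IMP \<chi>' \<psi> \<notin> Has_free x"
      using nf\<chi> by (simp add: \<psi>_def not_free_intros not_free_bound)
  qed simp_all
  have "T \<turnstile> IFF \<chi> \<psi>"
  proof (rule ultra_complete)
    fix M assume M: "ultra T M"
    show "IFF \<chi> \<psi> \<in> M"
      using ultra_theorem[OF M 1] ultra_theorem[OF M 2] ultra_theorem[OF M base(2)]
      by (auto simp add: ultra_simps[OF M])
  qed simp
  moreover have "\<psi> \<in> Sigma_formulas" if S: "\<phi> \<in> Sigma_formulas"
  proof -
    \<comment> \<open>Each link adds an existential quantifier and a conjunct that is itself
      \<Sigma>, so the class is preserved along the chain.\<close>
    have "\<theta>3 \<in> Sigma_formulas"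
      unfolding \<theta>3_def \<theta>2_def \<theta>1_def by (intro vpair_via_Sigma) (use S in simp_all)
    then have "\<theta>4 \<in> Sigma_formulas"
      unfolding \<theta>4_def by (intro via_Sigma) (simp_all add: Formulas_A)
    then have "\<delta> \<in> Sigma_formulas"
      unfolding \<delta>_def \<theta>6_def \<theta>5_def by (intro vpair_via_Sigma) simp_all
    moreover have "\<Gamma> \<in> Sigma_formulas" unfolding \<Gamma>_def by (intro Sigma_intros) simp_all
    ultimately show ?thesis unfolding \<psi>_def by (intro Sigma_intros) (use \<Gamma>A in simp_all)
  qed
  ultimately show ?thesis using \<chi> by (intro bexI[of _ \<psi>] conjI exI[of _ \<chi>]) simp_all
qed

end

theorem lemma4p17:
  fixes mem :: "'v \<Rightarrow> 'v \<Rightarrow> bool" and A T :: "'v set" and \<phi> v :: 'v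
  assumes "admissible_class mem A"
    and "set_structure.Sigma_A_theory mem A T"
    and "set_structure.extends mem A T (set_structure.KP_A mem A)"
    and "\<phi> \<in> set_structure.Formulas mem A"
    and "v \<in> A"
  shows "\<exists>\<psi> \<in> set_structure.Formulas mem A.
           (\<exists>\<chi>. (\<phi>, \<chi>) \<in> set_structure.Subst mem A v (set_structure.Const mem \<psi>) \<and>
                 set_structure.derives mem A T (set_structure.IFF mem \<chi> \<psi>)) \<and>
           (\<phi> \<in> set_structure.Sigma_formulas mem A \<longrightarrow> \<psi> \<in> set_structure.Sigma_formulas mem A)"
  using assms(3-5) by (rule admissible_class.diagonal_lemma[OF assms(1)])

end
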